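(* Let $\mathcal C$ be a full trio. The following are equivalent: (1) separability of languages of $\mathcal C$ by piecewise testable languages is decidable (i.e., given $I,E\in\mathcal C$ one can decide whether some piecewise testable $S$ satisfies $I\subseteq S$, $S\cap E=\emptyset$); (2) the diagonal problem for $\mathcal C$ is decidable; (3) the simultaneous unboundedness problem (SUP) for $\mathcal C$ is decidable; (4) downward closures are computable for $\mathcal C$.
   Context: A piece language over $A$ is $A^*a_1A^*\cdots A^*a_nA^*$ ($a_i\in A$); a piecewise testable language is a finite Boolean combination of piece languages. For $B$ an alphabet, the $B$-projection of a word is its longest subsequence consisting of symbols of $B$ (extended to languages elementwise); the $B$-upward closure of $L\subseteq A^*$ is the set of words $w\in(A\cup B)^*$ from which some word of $L$ is obtained by deleting occurrences of symbols of $B$. A full trio is a nonempty class of languages (given by effective representations) effectively closed under $B$-projection and $B$-upward closure for every finite alphabet $B$, and under intersection with regular languages (equivalently, closed under rational transductions). The subword (subsequence) order is $\preceq$; the downward closure of $L$ is $\{u\mid \exists v\in L, u\preceq v\}$; downward closures are computable for $\mathcal C$ if a finite automaton for the downward closure of any given $L\in\mathcal C$ can be computed. For $A=\{a_1,\dots,a_n\}$ the Parikh image of $w$ is $(\#_{a_1}(w),\dots,\#_{a_n}(w))$. The diagonal problem: given $L\subseteq A^*$ in $\mathcal C$, decide whether for every $m\in\mathbb N$ the tuple $(m,\dots,m)$ is componentwise dominated by the Parikh image of some word of $L$. The SUP is the same question restricted to inputs $L\subseteq b_1^*\cdots b_n^*$ for some enumeration $b_1,\dots,b_n$ of $A$.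 *)

theory Defs
  imports Main "HOL-Library.Nat_Bijection" "HOL-Library.Sublist"
begin

type_synonym word = "nat list"
type_synonym lang = "word set"

definition piece_lang :: "nat set \<Rightarrow> nat list \<Rightarrow> lang" where
  "piece_lang A as = {w \<in> lists A. subseq as w}"

inductive_set PT :: "nat set \<Rightarrow> lang set" for A :: "nat set" where
  piece: "set as \<subseteq> A \<Longrightarrow> piece_lang A as \<in> PT A"
| compl: "S \<in> PT A \<Longrightarrow> lists A - S \<in> PT A"
| union: "S \<in> PT A \<Longrightarrow> T \<in> PT A \<Longrightarrow> S \<union> T \<in> PT A"
| inter: "S \<in> PT A \<Longrightarrow> T \<in> PT A \<Longrightarrow> S \<inter> T \<in> PT A"

definition PT_separable :: "nat set \<Rightarrow> lang \<Rightarrow> lang \<Rightarrow> bool" where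
  "PT_separable A I E \<longleftrightarrow> (\<exists>S \<in> PT A. I \<subseteq> S \<and> S \<inter> E = {})"

definition proj :: "nat set \<Rightarrow> word \<Rightarrow> word" where
  "proj B w = filter (\<lambda>a. a \<in> B) w"

inductive del_by :: "nat set \<Rightarrow> word \<Rightarrow> word \<Rightarrow> bool" for B :: "nat set" where
  nil: "del_by B [] []"
| keep: "del_by B u w \<Longrightarrow> del_by B (a # u) (a # w)"
| drop: "b \<in> B \<Longrightarrow> del_by B u w \<Longrightarrow> del_by B u (b # w)"

definition upclose :: "nat set \<Rightarrow> lang \<Rightarrow> lang" where
  "upclose B L = {w. \<exists>u \<in> L. del_by B u w}"

definition downclose :: "lang \<Rightarrow> lang" where
  "downclose L = {u. \<exists>v \<in> L. subseq u v}"

definition diagonal :: "nat set \<Rightarrow> lang \<Rightarrow> bool" where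
  "diagonal A L \<longleftrightarrow> (\<forall>m. \<exists>w \<in> L. \<forall>a \<in> A. m \<le> count_list w a)"

definition bounded_lang :: "nat list \<Rightarrow> lang" where
  "bounded_lang bs = {concat (map (\<lambda>(b, k). replicate k b) (zip bs ks)) | ks. length ks = length bs}"

datatype nfa = NFA (init: "nat list") (trans: "(nat \<times> nat \<times> nat) list") (final: "nat list")

inductive run :: "nfa \<Rightarrow> nat \<Rightarrow> word \<Rightarrow> nat \<Rightarrow> bool" for M :: nfa where
  run_nil: "run M p [] p"
| run_step: "(p, a, q) \<in> set (trans M) \<Longrightarrow> run M q w r \<Longrightarrow> run M p (a # w) r"

definition nfa_lang :: "nfa \<Rightarrow> lang" where
  "nfa_lang M = {w. \<exists>p q. p \<in> set (init M) \<and> q \<in> set (final M) \<and> run M p w q}"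

definition decode_triple :: "nat \<Rightarrow> nat \<times> nat \<times> nat" where
  "decode_triple k = (let (p, r) = prod_decode k; (a, q) = prod_decode r in (p, a, q))"

definition decode_nfa :: "nat \<Rightarrow> nfa" where
  "decode_nfa n = (let (x, y) = prod_decode n; (z, v) = prod_decode y in
     NFA (list_decode x) (map decode_triple (list_decode z)) (list_decode v))"

definition decode_set :: "nat \<Rightarrow> nat set" where
  "decode_set k = set (list_decode k)"

definition pair :: "nat \<Rightarrow> nat \<Rightarrow> nat" where
  "pair x y = prod_encode (x, y)"

datatype recf = Zero | Succ | Proj nat | Comp recf "recf list" | Prec recf recf | Minr recf

inductive eval :: "recf \<Rightarrow> nat list \<Rightarrow> nat \<Rightarrow> bool" where
  ev_zero: "eval Zero xs 0"
| ev_succ: "eval Succ (x # xs) (Suc x)"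
| ev_proj: "i < length xs \<Longrightarrow> eval (Proj i) xs (xs ! i)"
| ev_comp: "length ys = length gs \<Longrightarrow> (\<forall>i < length gs. eval (gs ! i) xs (ys ! i))
             \<Longrightarrow> eval f ys z \<Longrightarrow> eval (Comp f gs) xs z"
| ev_prec0: "eval g xs z \<Longrightarrow> eval (Prec g h) (0 # xs) z"
| ev_precS: "eval (Prec g h) (n # xs) y \<Longrightarrow> eval h (n # y # xs) z
             \<Longrightarrow> eval (Prec g h) (Suc n # xs) z"
| ev_min: "eval f (n # xs) 0 \<Longrightarrow> (\<forall>m < n. \<exists>y. eval f (m # xs) (Suc y))
             \<Longrightarrow> eval (Minr f) xs n"

text \<open>A class of languages given by effective representations: a set R of codes with a
  semantics Lg. Each language is over some finite alphabet.\<close>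

definition full_trio :: "nat set \<Rightarrow> (nat \<Rightarrow> lang) \<Rightarrow> bool" where
  "full_trio R Lg \<longleftrightarrow>
     R \<noteq> {} \<and>
     (\<forall>r \<in> R. \<exists>A. finite A \<and> Lg r \<subseteq> lists A) \<and>
     (\<exists>p. \<forall>r \<in> R. \<forall>b. \<exists>r'. eval p [pair r b] r' \<and> r' \<in> R \<and>
            Lg r' = proj (decode_set b) ` Lg r) \<and>
     (\<exists>p. \<forall>r \<in> R. \<forall>b. \<exists>r'. eval p [pair r b] r' \<and> r' \<in> R \<and>
            Lg r' = upclose (decode_set b) (Lg r)) \<and>
     (\<exists>p. \<forall>r \<in> R. \<forall>n. \<exists>r'. eval p [pair r n] r' \<and> r' \<in> R \<and>
            Lg r' = Lg r \<inter> nfa_lang (decode_nfa n))"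

definition PT_sep_decidable :: "nat set \<Rightarrow> (nat \<Rightarrow> lang) \<Rightarrow> bool" where
  "PT_sep_decidable R Lg \<longleftrightarrow> (\<exists>p. \<forall>r1 \<in> R. \<forall>r2 \<in> R. \<forall>a.
      Lg r1 \<union> Lg r2 \<subseteq> lists (decode_set a) \<longrightarrow>
      eval p [pair r1 (pair r2 a)]
        (if PT_separable (decode_set a) (Lg r1) (Lg r2) then 1 else 0))"

definition diagonal_decidable :: "nat set \<Rightarrow> (nat \<Rightarrow> lang) \<Rightarrow> bool" where
  "diagonal_decidable R Lg \<longleftrightarrow> (\<exists>p. \<forall>r \<in> R. \<forall>a.
      Lg r \<subseteq> lists (decode_set a) \<longrightarrow>
      eval p [pair r a] (if diagonal (decode_set a) (Lg r) then 1 else 0))"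

definition SUP_decidable :: "nat set \<Rightarrow> (nat \<Rightarrow> lang) \<Rightarrow> bool" where
  "SUP_decidable R Lg \<longleftrightarrow> (\<exists>p. \<forall>r \<in> R. \<forall>a.
      distinct (list_decode a) \<and> Lg r \<subseteq> bounded_lang (list_decode a) \<longrightarrow>
      eval p [pair r a] (if diagonal (set (list_decode a)) (Lg r) then 1 else 0))"

definition downclosure_computable :: "nat set \<Rightarrow> (nat \<Rightarrow> lang) \<Rightarrow> bool" where
  "downclosure_computable R Lg \<longleftrightarrow> (\<exists>p. \<forall>r \<in> R. \<forall>a.
      Lg r \<subseteq> lists (decode_set a) \<longrightarrow>
      (\<exists>n. eval p [pair r a] n \<and> nfa_lang (decode_nfa n) = downclose (Lg r)))"

end

theory Submission
  imports Defs "HOL-Library.Infinite_Set"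
begin

text \<open>
  Everything rests on the ideals of the subword order. By Higman's lemma a downward closed language
  over a finite alphabet is a finite union of products of factors \<open>B\<^sup>* (a + \<epsilon>)\<close>. Whether such a product
  \<open>J\<close> lies in the downward closure of a language \<open>L\<close> of the class is one instance of the simultaneous
  unboundedness problem: mark each passage through an enumeration of \<open>B\<close> by a fresh letter and
  project to the markers. Complements of ideals are regular, so the downward closure of \<open>L\<close> can be
  found by searching for a list of ideals that lie in it and cover \<open>L\<close>.

  Separability is decided by two searches. Separating languages are determined by membership in
  finitely many ideals; and \<open>I\<close>, \<open>E\<close> are inseparable iff there is an ideal \<open>J\<close> contained in the downward
  closures of both \<open>I \<inter> J\<close> and \<open>E \<inter> J\<close>. Conversely, unboundedness reduces to separability by replacing
  the blocks \<open>b\<^sup>k\<close> by words \<open>(bc)\<^sup>k b\<close>, which are hard to tell from words \<open>(cb)\<^sup>m c\<close> iff \<open>k\<close> is unbounded.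
  Finally, a pumping argument shows that an automaton with code \<open>n\<close> for the downward closure of \<open>L\<close>
  reduces diagonality of \<open>L\<close> to the existence of a word of \<open>L\<close> with every letter more than \<open>n + 1\<close> times.
\<close>

section \<open>Partial recursive functions\<close>

text \<open>Programs can be trusted only where they are specified: an operation of the class on
  codes in \<open>R\<close>, a decision procedure on inputs that keep a containment promise, which
  no algorithm is asked to recognise. So computability is relative to a domain throughout, branches
  are evaluated lazily, and iterations carry an invariant. The class need not be closed under union
  or under intersection of two members, so a test may combine one language with regular ones only: a
  covering by ideals is checked by intersecting with complements of ideals, and the comparison of
  \<open>I\<close> and \<open>E\<close> is split into separate conditions on each. In the
  inseparability criterion the words have to be taken inside \<open>J\<close>: the ideal of all
  powers of \<open>a\<close> lies in the downward closures of the powers of \<open>a\<close> and of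
  the words \<open>a^k b\<close>, yet these two languages are separable. Both answers to the
  separability question have finite witnesses, so a single search over pairs of candidates always
  ends.\<close>

definition rcomputable :: "nat \<Rightarrow> (nat list \<Rightarrow> nat) \<Rightarrow> bool" where
  "rcomputable l f \<longleftrightarrow> (\<exists>p. \<forall>xs. length xs = l \<longrightarrow> eval p xs (f xs))"

lemma rcomputable_nth: "i < l \<Longrightarrow> rcomputable l (\<lambda>xs. xs ! i)"
  unfolding rcomputable_def by (intro exI[of _ "Proj i"]) (auto intro: ev_proj)

lemma rcomputable_zero: "rcomputable l (\<lambda>xs. 0)"
  unfolding rcomputable_def by (intro exI[of _ Zero]) (auto intro: ev_zero)

lemma rcomputable_Suc:
  assumes "rcomputable l f" shows "rcomputable l (\<lambda>xs. Suc (f xs))"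
proof -
  obtain p where "\<And>xs. length xs = l \<Longrightarrow> eval p xs (f xs)"
    using assms unfolding rcomputable_def by blast
  then have "\<forall>xs. length xs = l \<longrightarrow> eval (Comp Succ [p]) xs (Suc (f xs))"
    by (auto intro!: ev_comp[where ys = "[f xs]" for xs] ev_succ)
  then show ?thesis unfolding rcomputable_def by blast
qed

lemma rcomputable_rec_nat:
  assumes "rcomputable l n" "rcomputable l g" "rcomputable (Suc (Suc l)) h"
  shows "rcomputable l (\<lambda>xs. rec_nat (g xs) (\<lambda>k acc. h (k # acc # xs)) (n xs))"
proof -
  obtain pn pg ph where p: "\<And>xs. length xs = l \<Longrightarrow> eval pn xs (n xs)"
    "\<And>xs. length xs = l \<Longrightarrow> eval pg xs (g xs)"
    "\<And>xs. length xs = Suc (Suc l) \<Longrightarrow> eval ph xs (h xs)"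
    using assms unfolding rcomputable_def by blast
  have prec: "eval (Prec pg ph) (m # xs) (rec_nat (g xs) (\<lambda>k acc. h (k # acc # xs)) m)"
    if "length xs = l" for m xs
  proof (induction m)
    case 0
    show ?case using that by (simp add: ev_prec0 p)
  next
    case (Suc m)
    have "eval ph (m # rec_nat (g xs) (\<lambda>k acc. h (k # acc # xs)) m # xs)
        (h (m # rec_nat (g xs) (\<lambda>k acc. h (k # acc # xs)) m # xs))"
      using that by (intro p) simp
    from ev_precS[OF Suc this] show ?case by simp
  qed
  have "eval (Comp (Prec pg ph) (pn # map Proj [0..<l])) xs
      (rec_nat (g xs) (\<lambda>k acc. h (k # acc # xs)) (n xs))" if "length xs = l" for xs
  proof (rule ev_comp)
    show "length (n xs # xs) = length (pn # map Proj [0..<l])" using that by simp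
    show "\<forall>i<length (pn # map Proj [0..<l]).
        eval ((pn # map Proj [0..<l]) ! i) xs ((n xs # xs) ! i)"
      using p(1)[OF that] that by (auto simp: nth_Cons split: nat.split intro: ev_proj)
  qed (rule prec[OF that])
  then show ?thesis unfolding rcomputable_def by blast
qed

lemma rcomputable_comp:
  assumes "rcomputable l f" "\<And>i. i < l \<Longrightarrow> rcomputable m (gs i)"
  shows "rcomputable m (\<lambda>xs. f (map (\<lambda>i. gs i xs) [0..<l]))"
proof -
  obtain p where p: "\<And>xs. length xs = l \<Longrightarrow> eval p xs (f xs)"
    using assms(1) unfolding rcomputable_def by blast
  have "\<forall>i. \<exists>q. i < l \<longrightarrow> (\<forall>xs. length xs = m \<longrightarrow> eval q xs (gs i xs))"
    using assms(2) unfolding rcomputable_def by blast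
  then obtain q where q: "\<And>i xs. i < l \<Longrightarrow> length xs = m \<Longrightarrow> eval (q i) xs (gs i xs)"
    by metis
  have "eval (Comp p (map q [0..<l])) xs (f (map (\<lambda>i. gs i xs) [0..<l]))" if "length xs = m" for xs
    using that by (intro ev_comp) (auto intro: p q)
  then show ?thesis unfolding rcomputable_def by blast
qed

lemma rcomputable_comp2:
  assumes "rcomputable 2 (\<lambda>xs. F (xs ! 0) (xs ! 1))" "rcomputable l f" "rcomputable l g"
  shows "rcomputable l (\<lambda>xs. F (f xs) (g xs))"
  using rcomputable_comp[OF assms(1), of l "\<lambda>i. if i = 0 then f else g"] assms(2,3)
  by (simp add: numeral_2_eq_2)

section \<open>Arithmetic and Cantor's pairing function on plain numbers\<close>

lemma rcomputable_add:
  assumes "rcomputable l f" "rcomputable l g"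
  shows "rcomputable l (\<lambda>xs. f xs + g xs)"
proof -
  have "rec_nat a (\<lambda>k acc. Suc acc) b = a + b" for a b :: nat by (induction b) auto
  then have "rcomputable 2 (\<lambda>xs. xs ! 0 + xs ! 1)"
    using rcomputable_rec_nat[OF rcomputable_nth[of 1 2] rcomputable_nth[of 0 2] 
      rcomputable_Suc[OF rcomputable_nth[of 1]]] by simp
  then show ?thesis using assms by (rule rcomputable_comp2)
qed

lemma rcomputable_pred:
  assumes "rcomputable l f"
  shows "rcomputable l (\<lambda>xs. f xs - 1)"
proof -
  have "rec_nat 0 (\<lambda>k acc. k) b = b - 1" for b :: nat by (induction b) auto
  then show ?thesis
    using rcomputable_rec_nat[OF assms rcomputable_zero rcomputable_nth[of 0]] by simp
qed

lemma rcomputable_diff: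
  assumes "rcomputable l f" "rcomputable l g"
  shows "rcomputable l (\<lambda>xs. f xs - g xs)"
proof -
  have "rec_nat a (\<lambda>k acc. acc - 1) b = a - b" for a b :: nat by (induction b) auto
  then show ?thesis
    using rcomputable_rec_nat[OF assms(2,1) rcomputable_pred[OF rcomputable_nth[of 1]]] by simp
qed

lemma rcomputable_triangle:
  assumes "rcomputable l f"
  shows "rcomputable l (\<lambda>xs. triangle (f xs))"
proof -
  have "rec_nat 0 (\<lambda>k acc. acc + Suc k) b = triangle b" for b :: nat by (induction b) auto
  then show ?thesis
    using rcomputable_rec_nat[OF assms rcomputable_zero
      rcomputable_add[OF rcomputable_nth[of 1] rcomputable_Suc[OF rcomputable_nth[of 0]]]] by simp
qed

lemma rcomputable_pair:
  assumes "rcomputable l f" "rcomputable l g"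
  shows "rcomputable l (\<lambda>xs. prod_encode (f xs, g xs))"
  unfolding prod_encode_def
  by (simp add: rcomputable_add rcomputable_triangle assms)

text \<open>The index of the diagonal on which Cantor's pairing places a number; a scalar recursion,
  since pairs cannot be decoded yet.\<close>

primrec diag_index :: "nat \<Rightarrow> nat" where
  "diag_index 0 = 0"
| "diag_index (Suc n) = diag_index n + (1 - (triangle (Suc (diag_index n)) - Suc n))"

text \<open>With \<open>d\<close> the index of \<open>n\<close>, the truncated difference
  \<open>1 - (triangle (Suc d) - Suc n)\<close> is 1 exactly when \<open>Suc n\<close> reaches the
  next triangular number, so the index increases there and only there.\<close>

lemma diag_index_bounds: "triangle (diag_index n) \<le> n \<and> n < triangle (Suc (diag_index n))"
proof (induction n)
  case (Suc n)
  then show ?case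
    by (cases "Suc n = triangle (Suc (diag_index n))") auto
qed auto

lemma triangle_mono: "m \<le> n \<Longrightarrow> triangle m \<le> triangle n"
  by (induction n) (auto simp: le_Suc_eq)

lemma diag_index_prod_encode: "diag_index (prod_encode (a, b)) = a + b"
proof -
  let ?n = "triangle (a + b) + a" let ?d = "diag_index ?n"
  have "\<not> ?d < a + b"
  proof
    assume "?d < a + b"
    then have "triangle (Suc ?d) \<le> triangle (a + b)" by (intro triangle_mono) simp
    then show False using diag_index_bounds[of ?n] by linarith
  qed
  moreover have "\<not> a + b < ?d"
  proof
    assume "a + b < ?d"
    then have "triangle (Suc (a + b)) \<le> triangle ?d" by (intro triangle_mono) simp
    then show False using diag_index_bounds[of ?n] by simp
  qed
  ultimately show ?thesis by (simp add: prod_encode_def)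
qed

lemma rcomputable_diag_index:
  assumes "rcomputable l f"
  shows "rcomputable l (\<lambda>xs. diag_index (f xs))"
proof -
  have "rec_nat 0 (\<lambda>k acc. acc + (1 - (triangle (Suc acc) - Suc k))) n = diag_index n" for n
    by (induction n) auto
  moreover have "rcomputable (Suc (Suc l)) (\<lambda>ys. ys ! 1 + (Suc 0 - (triangle (Suc (ys ! 1)) - Suc (ys ! 0))))"
    by (intro rcomputable_add rcomputable_diff rcomputable_Suc rcomputable_zero rcomputable_triangle
        rcomputable_nth) auto
  ultimately show ?thesis
    using rcomputable_rec_nat[OF assms rcomputable_zero] by fastforce
qed

lemma fst_prod_decode_eq: "fst (prod_decode n) = n - triangle (diag_index n)"
  and snd_prod_decode_eq: "snd (prod_decode n) = diag_index n - (n - triangle (diag_index n))"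
proof -
  obtain a b where "n = prod_encode (a, b)" by (metis prod_decode_inverse surj_pair)
  then show "fst (prod_decode n) = n - triangle (diag_index n)"
    "snd (prod_decode n) = diag_index n - (n - triangle (diag_index n))"
    by (simp_all only: diag_index_prod_encode prod_encode_inverse) (simp_all add: prod_encode_def)
qed

lemma rcomputable_fst: "rcomputable l f \<Longrightarrow> rcomputable l (\<lambda>xs. fst (prod_decode (f xs)))"
  and rcomputable_snd: "rcomputable l f \<Longrightarrow> rcomputable l (\<lambda>xs. snd (prod_decode (f xs)))"
  unfolding fst_prod_decode_eq snd_prod_decode_eq
  by (intro rcomputable_diff rcomputable_diag_index rcomputable_triangle; assumption)+

section \<open>Computable functions on encoded data\<close>

text \<open>A bijection with the numbers rather than a mere injection: minimisation over numbers
  then searches through all objects of the type, and every input number of a decision problem is the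
  code of some object. The instances repeat the encodings by which the problems are stated.\<close>

class codable =
  fixes enc :: "'a \<Rightarrow> nat" and dec :: "nat \<Rightarrow> 'a"
  assumes enc_dec [simp]: "enc (dec n) = n" and dec_enc [simp]: "dec (enc x) = x"

lemma enc_eq_iff [simp]: "enc x = enc y \<longleftrightarrow> x = y"
  by (metis dec_enc)

instantiation nat :: codable
begin
definition enc_nat_def [simp]: "enc (n :: nat) = n"
definition dec_nat_def [simp]: "dec n = (n :: nat)"
instance by standard simp_all
end

instantiation prod :: (codable, codable) codable
begin
definition enc_prod_def: "enc p = prod_encode (enc (fst p), enc (snd p))"
definition dec_prod_def: "dec n = map_prod dec dec (prod_decode n)"
instance by standard (simp_all add: enc_prod_def dec_prod_def)
end

instantiation list :: (codable) codable
begin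
definition enc_list_def: "enc xs = list_encode (map enc xs)"
definition dec_list_def: "dec n = map dec (list_decode n)"
instance by standard (simp_all add: enc_list_def dec_list_def comp_def)
end

lemma enc_Pair [simp]: "enc (x, y) = prod_encode (enc x, enc y)"
  by (simp add: enc_prod_def)

lemma enc_Nil: "enc [] = 0"
  and enc_Cons: "enc (x # xs) = Suc (prod_encode (enc x, enc xs))"
  by (simp_all add: enc_list_def)

text \<open>Lets the code of a list serve as the iteration count of a recursion along the list; the
  surplus rounds are idle.\<close>

lemma length_le_enc: "length xs \<le> enc xs"
  by (induction xs) (auto simp: enc_Cons intro: order_trans[OF _ le_prod_encode_2])

lemma enc_nat_list [simp]: "enc (xs :: nat list) = list_encode xs"
  by (induction xs) (auto simp: enc_Cons enc_Nil)

text \<open>Nothing is required outside \<open>D\<close>, where the program may diverge. This is the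
  right notion for promise problems and for operations that are specified on codes in
  \<open>R\<close> only.\<close>

definition computable :: "'a::codable set \<Rightarrow> ('a \<Rightarrow> 'b::codable) \<Rightarrow> bool" where
  "computable D f \<longleftrightarrow> (\<exists>p. \<forall>x\<in>D. eval p [enc x] (enc (f x)))"

definition decidable :: "'a::codable set \<Rightarrow> ('a \<Rightarrow> bool) \<Rightarrow> bool" where
  "decidable D P \<longleftrightarrow> computable D (\<lambda>x. of_bool (P x) :: nat)"

lemma computable_cong:
  "computable D f \<Longrightarrow> (\<And>x. x \<in> D \<Longrightarrow> f x = g x) \<Longrightarrow> computable D g"
  unfolding computable_def by simp

lemma decidable_cong:
  "decidable D P \<Longrightarrow> (\<And>x. x \<in> D \<Longrightarrow> P x = Q x) \<Longrightarrow> decidable D Q"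
  unfolding decidable_def by (erule computable_cong) simp

lemma computable_subset: "computable D f \<Longrightarrow> D' \<subseteq> D \<Longrightarrow> computable D' f"
  unfolding computable_def by blast

lemma computable_comp:
  assumes "computable D f" "computable E g" "\<And>x. x \<in> D \<Longrightarrow> f x \<in> E"
  shows "computable D (\<lambda>x. g (f x))"
proof -
  obtain p q where "\<And>x. x \<in> D \<Longrightarrow> eval p [enc x] (enc (f x))"
    "\<And>x. x \<in> E \<Longrightarrow> eval q [enc x] (enc (g x))"
    using assms(1,2) unfolding computable_def by blast
  then have "\<forall>x\<in>D. eval (Comp q [p]) [enc x] (enc (g (f x)))"
    using assms(3) by (auto intro!: ev_comp[where ys = "[enc (f x)]" for x])
  then show ?thesis unfolding computable_def by blast
qed

lemma computable_lift1:
  assumes "rcomputable 1 (\<lambda>xs. F (xs ! 0))" "computable D f"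
    "\<And>x. x \<in> D \<Longrightarrow> enc (h x) = F (enc (f x))"
  shows "computable D h"
proof -
  obtain q where q: "\<And>xs. length xs = 1 \<Longrightarrow> eval q xs (F (xs ! 0))"
    using assms(1) unfolding rcomputable_def by blast
  obtain p where p: "\<And>x. x \<in> D \<Longrightarrow> eval p [enc x] (enc (f x))"
    using assms(2) unfolding computable_def by blast
  have "\<forall>x\<in>D. eval (Comp q [p]) [enc x] (enc (h x))"
    using q[of "[y]" for y] p assms(3) by (auto intro!: ev_comp[where ys = "[enc (f x)]" for x])
  then show ?thesis unfolding computable_def by blast
qed

lemma computable_lift2:
  assumes "rcomputable 2 (\<lambda>xs. F (xs ! 0) (xs ! 1))" "computable D f" "computable D g"
    "\<And>x. x \<in> D \<Longrightarrow> enc (h x) = F (enc (f x)) (enc (g x))"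
  shows "computable D h"
proof -
  obtain q where q: "\<And>xs. length xs = 2 \<Longrightarrow> eval q xs (F (xs ! 0) (xs ! 1))"
    using assms(1) unfolding rcomputable_def by blast
  obtain p1 p2 where p: "\<And>x. x \<in> D \<Longrightarrow> eval p1 [enc x] (enc (f x))"
    "\<And>x. x \<in> D \<Longrightarrow> eval p2 [enc x] (enc (g x))"
    using assms(2,3) unfolding computable_def by blast
  have "\<forall>x\<in>D. eval (Comp q [p1, p2]) [enc x] (enc (h x))"
    using q[of "[y, z]" for y z] p assms(4)
    by (auto simp: less_Suc_eq nth_Cons split: nat.split intro!: ev_comp[where ys = "[enc (f x), enc (g x)]" for x])
  then show ?thesis unfolding computable_def by blast
qed

lemma computable_id: "computable D (\<lambda>x. x)"
  unfolding computable_def using ev_proj[of 0 "[y]" for y] by auto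

lemma rcomputable_const: "rcomputable l (\<lambda>xs. c)"
  by (induction c) (auto intro: rcomputable_zero rcomputable_Suc)

lemma computable_const: "computable D (\<lambda>x. c)"
  by (rule computable_lift1[where F = "\<lambda>_. enc c", OF rcomputable_const computable_id]) simp

lemma computable_Suc: "computable D f \<Longrightarrow> computable D (\<lambda>x. Suc (f x))"
  by (rule computable_lift1[where F = Suc]) (auto intro: rcomputable_Suc rcomputable_nth)

lemma computable_add:
  fixes f :: "'a::codable \<Rightarrow> nat"
  assumes "computable D f" "computable D g"
  shows "computable D (\<lambda>x. f x + g x)"
  by (rule computable_lift2[where F = "(+)", OF _ assms]) (auto intro!: rcomputable_add rcomputable_nth)

lemma computable_diff:
  fixes f :: "'a::codable \<Rightarrow> nat"
  assumes "computable D f" "computable D g"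
  shows "computable D (\<lambda>x. f x - g x)"
  by (rule computable_lift2[where F = "(-)", OF _ assms]) (auto intro!: rcomputable_diff rcomputable_nth)

lemma computable_Pair:
  "computable D f \<Longrightarrow> computable D g \<Longrightarrow> computable D (\<lambda>x. (f x, g x))"
  by (rule computable_lift2[where F = "\<lambda>a b. prod_encode (a, b)"])
    (auto intro!: rcomputable_pair rcomputable_nth)

lemma computable_fst: "computable D f \<Longrightarrow> computable D (\<lambda>x. fst (f x))"
  by (rule computable_lift1[where F = "\<lambda>n. fst (prod_decode n)"])
    (auto intro!: rcomputable_fst rcomputable_nth simp: enc_prod_def)

lemma computable_snd: "computable D f \<Longrightarrow> computable D (\<lambda>x. snd (f x))"
  by (rule computable_lift1[where F = "\<lambda>n. snd (prod_decode n)"])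
    (auto intro!: rcomputable_snd rcomputable_nth simp: enc_prod_def)

lemma computable_enc: "computable D f \<Longrightarrow> computable D (\<lambda>x. enc (f x))"
  by (rule computable_lift1[where F = "\<lambda>n. n"]) (auto intro!: rcomputable_nth)

lemma computable_Cons:
  "computable D f \<Longrightarrow> computable D g \<Longrightarrow> computable D (\<lambda>x. f x # g x)"
  by (rule computable_lift2[where F = "\<lambda>a b. Suc (prod_encode (a, b))"])
    (auto intro!: rcomputable_pair rcomputable_nth rcomputable_Suc simp: enc_Cons)

lemma computable_hd:
  assumes "computable D f" "\<And>x. x \<in> D \<Longrightarrow> f x \<noteq> []"
  shows "computable D (\<lambda>x. hd (f x))"
proof (rule computable_lift1[where F = "\<lambda>n. fst (prod_decode (n - 1))", OF _ assms(1)])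
  show "rcomputable 1 (\<lambda>xs. fst (prod_decode (xs ! 0 - 1)))"
    by (intro rcomputable_fst rcomputable_pred rcomputable_nth) simp
  show "enc (hd (f x)) = fst (prod_decode (enc (f x) - 1))" if "x \<in> D" for x
    using assms(2)[OF that] by (cases "f x") (simp_all add: enc_Cons)
qed

lemma computable_tl:
  assumes "computable D f" "\<And>x. x \<in> D \<Longrightarrow> f x \<noteq> []"
  shows "computable D (\<lambda>x. tl (f x))"
proof (rule computable_lift1[where F = "\<lambda>n. snd (prod_decode (n - 1))", OF _ assms(1)])
  show "rcomputable 1 (\<lambda>xs. snd (prod_decode (xs ! 0 - 1)))"
    by (intro rcomputable_snd rcomputable_pred rcomputable_nth) simp
  show "enc (tl (f x)) = snd (prod_decode (enc (f x) - 1))" if "x \<in> D" for x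
    using assms(2)[OF that] by (cases "f x") (simp_all add: enc_Cons)
qed

lemma decidable_Not: "decidable D P \<Longrightarrow> decidable D (\<lambda>x. \<not> P x)"
  unfolding decidable_def
  by (rule computable_cong[OF computable_diff[OF computable_const[where c = 1]]]) auto

lemma decidable_nat_le:
  fixes f g :: "'a::codable \<Rightarrow> nat"
  assumes "computable D f" "computable D g"
  shows "decidable D (\<lambda>x. f x \<le> g x)"
  unfolding decidable_def
  by (rule computable_cong[OF computable_diff[OF computable_const[where c = 1] computable_diff[OF assms]]])
    auto

text \<open>The branch \<open>f\<close> is evaluated only where \<open>P\<close> holds, so it may be a partial function.\<close>

lemma computable_lazy_if:
  assumes P: "decidable D P" and f: "computable {x \<in> D. P x} f" and g: "computable D g"
  shows "computable D (\<lambda>x. if P x then f x else g x)"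
proof -
  obtain pb pf pg where pb: "\<forall>x\<in>D. eval pb [enc x] (enc (of_bool (P x) :: nat))"
    and pf: "\<forall>x\<in>{x \<in> D. P x}. eval pf [enc x] (enc (f x))"
    and pg: "\<forall>x\<in>D. eval pg [enc x] (enc (g x))"
    using assms unfolding decidable_def computable_def by blast
  then have p: "\<And>x. x \<in> D \<Longrightarrow> eval pb [enc x] (of_bool (P x))"
    "\<And>x. x \<in> D \<Longrightarrow> P x \<Longrightarrow> eval pf [enc x] (enc (f x))"
    "\<And>x. x \<in> D \<Longrightarrow> eval pg [enc x] (enc (g x))"
    by simp_all
  \<comment> \<open>Primitive recursion along the truth value: the base case runs \<open>pg\<close>,
    and the only possible step runs \<open>pf\<close> on the third argument, the input itself. The
    base case is evaluated in either case, so \<open>g\<close> has to be computable on all of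
    \<open>D\<close>.\<close>
  let ?prec = "Prec pg (Comp pf [Proj 2])"
  have prec: "eval ?prec [of_bool (P x), enc x] (enc (if P x then f x else g x))" if x: "x \<in> D" for x
  proof (cases "P x")
    case True
    have "eval (Proj 2) [0, enc (g x), enc x] (enc x)"
      using ev_proj[of 2 "[0, enc (g x), enc x]"] by simp
    then have "eval (Comp pf [Proj 2]) [0, enc (g x), enc x] (enc (f x))"
      using p(2)[OF x True] by (intro ev_comp[where ys = "[enc x]"]) auto
    from ev_precS[OF ev_prec0[OF p(3)[OF x]] this] show ?thesis using True by simp
  next
    case False
    then show ?thesis using ev_prec0[OF p(3)[OF x]] by simp
  qed
  have "\<forall>x\<in>D. eval (Comp ?prec [pb, Proj 0]) [enc x] (enc (if P x then f x else g x))"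
  proof
    fix x assume x: "x \<in> D"
    have "eval (Proj 0) [enc x] (enc x)" using ev_proj[of 0 "[enc x]"] by simp
    then show "eval (Comp ?prec [pb, Proj 0]) [enc x] (enc (if P x then f x else g x))"
      using p(1)[OF x] prec[OF x]
      by (intro ev_comp[where ys = "[of_bool (P x), enc x]"]) (auto simp: less_Suc_eq)
  qed
  then show ?thesis unfolding computable_def by blast
qed

lemma computable_if:
  assumes "decidable D P" "computable D f" "computable D g"
  shows "computable D (\<lambda>x. if P x then f x else g x)"
  using assms by (auto intro: computable_lazy_if computable_subset)

lemma decidable_conj:
  assumes "decidable D P" "decidable D Q"
  shows "decidable D (\<lambda>x. P x \<and> Q x)"
  using computable_if[OF assms(1) assms(2)[unfolded decidable_def] computable_const[where c = 0]]
  unfolding decidable_def by (rule computable_cong) auto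

lemma decidable_disj:
  assumes "decidable D P" "decidable D Q"
  shows "decidable D (\<lambda>x. P x \<or> Q x)"
  using decidable_Not[OF decidable_conj[OF decidable_Not[OF assms(1)] decidable_Not[OF assms(2)]]]
  by simp

lemma decidable_eq:
  assumes "computable D f" "computable D g"
  shows "decidable D (\<lambda>x. f x = g x)"
  using decidable_conj[OF decidable_nat_le[OF computable_enc computable_enc, OF assms]
      decidable_nat_le[OF computable_enc computable_enc, OF assms(2,1)]]
  by (rule decidable_cong) (simp add: order_eq_iff[symmetric])

text \<open>\<open>hd\<close> and \<open>tl\<close> are available only for nonempty lists and
  \<open>g\<close> may be partial, so the cons branch must not be evaluated on the empty
  list.\<close>

lemma computable_case_list:
  assumes "computable D l" "computable D f"
    and "computable E g"
    and "\<And>x y ys. x \<in> D \<Longrightarrow> l x = y # ys \<Longrightarrow> (y, ys, x) \<in> E"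
  shows "computable D (\<lambda>x. case l x of [] \<Rightarrow> f x | y # ys \<Rightarrow> g (y, ys, x))"
proof -
  let ?D = "{x \<in> D. l x \<noteq> []}"
  have "computable ?D (\<lambda>x. (hd (l x), tl (l x), x))"
    using computable_subset[OF assms(1)]
    by (intro computable_Pair computable_hd computable_tl computable_id) auto
  then have "computable ?D (\<lambda>x. g (hd (l x), tl (l x), x))"
    using assms(3) by (rule computable_comp) (auto simp: assms(4))
  with decidable_Not[OF decidable_eq[OF assms(1) computable_const[where c = "[]"]]]
  have "computable D (\<lambda>x. if l x \<noteq> [] then g (hd (l x), tl (l x), x) else f x)"
    using assms(2) by (rule computable_lazy_if)
  then show ?thesis by (rule computable_cong) (auto split: list.split)
qed

text \<open>The step function may be partial; the invariant keeps every accumulator inside its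
  domain \<open>E\<close>. In this way iterated operations of the class never leave the codes in
  \<open>R\<close>.\<close>

lemma computable_rec_nat_invariant:
  assumes n: "computable D n" and g: "computable D g" and h: "computable E h"
    and init: "\<And>x. x \<in> D \<Longrightarrow> Inv x (g x)"
    and step: "\<And>x k acc. x \<in> D \<Longrightarrow> Inv x acc \<Longrightarrow> (k, acc, x) \<in> E \<and> Inv x (h (k, acc, x))"
  shows "computable D (\<lambda>x. rec_nat (g x) (\<lambda>k acc. h (k, acc, x)) (n x))"
proof -
  obtain pn pg ph where pn: "\<forall>x\<in>D. eval pn [enc x] (enc (n x))"
    and pg: "\<forall>x\<in>D. eval pg [enc x] (enc (g x))"
    and ph: "\<forall>x\<in>E. eval ph [enc x] (enc (h x))"
    using n g h unfolding computable_def by blast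
  then have p: "\<And>x. x \<in> D \<Longrightarrow> eval pn [enc x] (n x)"
    "\<And>x. x \<in> D \<Longrightarrow> eval pg [enc x] (enc (g x))"
    "\<And>x. x \<in> E \<Longrightarrow> eval ph [enc x] (enc (h x))"
    by simp_all
  have "rcomputable 3 (\<lambda>xs. prod_encode (xs ! 0, prod_encode (xs ! 1, xs ! 2)))"
    by (intro rcomputable_pair rcomputable_nth) auto
  then obtain q where "\<And>xs. length xs = 3 \<Longrightarrow> eval q xs (prod_encode (xs ! 0, prod_encode (xs ! 1, xs ! 2)))"
    unfolding rcomputable_def by blast
  from this[of "[a, b, c]" for a b c]
  have q: "\<And>a b c. eval q [a, b, c] (prod_encode (a, prod_encode (b, c)))" by simp
  let ?r = "\<lambda>x m. rec_nat (g x) (\<lambda>k acc. h (k, acc, x)) m"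
  have inv: "Inv x (?r x m)" if "x \<in> D" for x m
    using that by (induction m) (auto simp: init step)
  have prec: "eval (Prec pg (Comp ph [q])) [m, enc x] (enc (?r x m))" if x: "x \<in> D" for x m
  proof (induction m)
    case 0
    show ?case using ev_prec0[OF p(2)[OF x]] by simp
  next
    case (Suc m)
    have "eval ph [enc (m, ?r x m, x)] (enc (h (m, ?r x m, x)))"
      using step[OF x inv[OF x]] by (intro p) auto
    then have "eval (Comp ph [q]) [m, enc (?r x m), enc x] (enc (h (m, ?r x m, x)))"
      using q by (intro ev_comp[where ys = "[enc (m, ?r x m, x)]"]) auto
    from ev_precS[OF Suc this] show ?case by simp
  qed
  have "\<forall>x\<in>D. eval (Comp (Prec pg (Comp ph [q])) [pn, Proj 0]) [enc x] (enc (?r x (n x)))"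
  proof
    fix x assume x: "x \<in> D"
    have "eval (Proj 0) [enc x] (enc x)" using ev_proj[of 0 "[enc x]"] by simp
    then show "eval (Comp (Prec pg (Comp ph [q])) [pn, Proj 0]) [enc x] (enc (?r x (n x)))"
      using p(1)[OF x] prec[OF x]
      by (intro ev_comp[where ys = "[n x, enc x]"]) (auto simp: less_Suc_eq)
  qed
  then show ?thesis unfolding computable_def by blast
qed

text \<open>The recursion runs on pairs of an accumulator and the rest of the list. It makes
  \<open>enc (xs x)\<close> rounds, at least the length of the list, and once the rest is empty the
  accumulator no longer changes.\<close>

lemma computable_foldl_invariant:
  fixes a :: "'a::codable \<Rightarrow> 'b::codable" and xs :: "'a \<Rightarrow> 'c::codable list"
  assumes a: "computable D a" and xs: "computable D xs" and f: "computable E f"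
    and init: "\<And>x. x \<in> D \<Longrightarrow> Inv x (a x)"
    and step: "\<And>x acc y. x \<in> D \<Longrightarrow> Inv x acc \<Longrightarrow> (acc, y, x) \<in> E \<and> Inv x (f (acc, y, x))"
  shows "computable D (\<lambda>x. foldl (\<lambda>acc y. f (acc, y, x)) (a x) (xs x))"
proof -
  define h :: "nat \<times> ('b \<times> 'c list) \<times> 'a \<Rightarrow> 'b \<times> 'c list" where "h = (\<lambda>e. case snd (fst (snd e)) of [] \<Rightarrow> fst (snd e)
     | y # ys \<Rightarrow> (\<lambda>(y, ys, e). (f (fst (fst (snd e)), y, snd (snd e)), ys)) (y, ys, e))"
  define E' :: "(nat \<times> ('b \<times> 'c list) \<times> 'a) set"
    where "E' = {(k, s, x). x \<in> D \<and> Inv x (fst s)}"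
  have h_eq: "h (k, (acc, l), x) = (case l of [] \<Rightarrow> (acc, []) | y # ys \<Rightarrow> (f (acc, y, x), ys))" for k acc l x
    by (simp add: h_def split: list.split)
  define F :: "('c \<times> 'c list \<times> nat \<times> ('b \<times> 'c list) \<times> 'a) set"
    where "F = {(y, ys, e). e \<in> E'}"
  have "computable F (\<lambda>e. f (fst (fst (snd (snd (snd e)))), fst e, snd (snd (snd (snd e)))))"
    by (rule computable_comp[OF _ f])
      (auto simp: E'_def F_def step intro!: computable_Pair computable_fst computable_snd computable_id)
  from computable_Pair[OF this computable_fst[OF computable_snd[OF computable_id]]]
  have "computable F (\<lambda>(y, ys, e). (f (fst (fst (snd e)), y, snd (snd e)), ys))"
    by (rule computable_cong) (simp add: case_prod_beta)
  then have "computable E' h" unfolding h_def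
    by (rule computable_case_list[OF computable_snd[OF computable_fst[OF computable_snd[OF computable_id]]]
          computable_fst[OF computable_snd[OF computable_id]]]) (simp add: F_def)
  then have "computable D (\<lambda>x. rec_nat (a x, xs x) (\<lambda>k acc. h (k, acc, x)) (enc (xs x)))"
    by (rule computable_rec_nat_invariant[where Inv = "\<lambda>x s. Inv x (fst s)",
          OF computable_enc[OF xs] computable_Pair[OF a xs]])
      (use init step in \<open>auto simp: E'_def h_eq split: list.split\<close>)
  moreover have "rec_nat (a x, l) (\<lambda>k acc. h (k, acc, x)) m
      = (foldl (\<lambda>acc y. f (acc, y, x)) (a x) (take m l), drop m l)" for x l m
  proof (induction m)
    case (Suc m)
    show ?case
    proof (cases "m < length l")
      case True
      then show ?thesis
        by (simp add: Suc h_eq take_Suc_conv_app_nth Cons_nth_drop_Suc[symmetric])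
    qed (simp add: Suc h_eq)
  qed simp
  ultimately have "computable D (\<lambda>x. fst (foldl (\<lambda>acc y. f (acc, y, x)) (a x) (take (enc (xs x)) (xs x)), drop (enc (xs x)) (xs x)))"
    by (intro computable_fst) simp
  then show ?thesis by (simp add: length_le_enc)
qed

lemma computable_foldl:
  assumes "computable D a" "computable D xs"
    "computable {e. snd (snd e) \<in> D} (\<lambda>e. f (snd (snd e)) (fst e) (fst (snd e)))"
  shows "computable D (\<lambda>x. foldl (\<lambda>acc y. f x acc y) (a x) (xs x))"
  using computable_foldl_invariant[OF assms, of "\<lambda>_ _. True"] by simp

lemma computable_rev:
  assumes "computable D xs" shows "computable D (\<lambda>x. rev (xs x))"
proof -
  have "computable D (\<lambda>x. foldl (\<lambda>acc y. y # acc) [] (xs x))"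
    by (intro computable_foldl assms computable_const computable_Cons computable_fst computable_snd
        computable_id)
  moreover have "foldl (\<lambda>acc y. y # acc) acc l = rev l @ acc" for l acc :: "'b list"
    by (induction l arbitrary: acc) auto
  ultimately show ?thesis by simp
qed

text \<open>A left fold over the reversed list visits the suffixes in order of increasing length.
  The first component of its state rebuilds the suffix \<open>ys\<close>, which the recursor passes
  to \<open>h\<close> along with the recursive value. Structural recursions on syntax are computed
  through this lemma.\<close>

lemma computable_rec_list:
  assumes xs: "computable D xs" and g: "computable D g"
    and h: "computable {e. snd (snd (snd e)) \<in> D}
      (\<lambda>e. h (snd (snd (snd e))) (fst e) (fst (snd e)) (fst (snd (snd e))))"
  shows "computable D (\<lambda>x. rec_list (g x) (\<lambda>y ys acc. h x y ys acc) (xs x))"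
proof -
  let ?step = "\<lambda>x s y. (y # fst s, h x y (fst s) (snd s))"
  have "computable {e. snd (snd e) \<in> D} (\<lambda>e. (fst (snd e), fst (fst e), snd (fst e), snd (snd e)))"
    by (intro computable_Pair computable_fst computable_snd computable_id)
  from computable_comp[OF this h]
  have "computable {e. snd (snd e) \<in> D} (\<lambda>e. h (snd (snd e)) (fst (snd e)) (fst (fst e)) (snd (fst e)))"
    by simp
  then have "computable {e. snd (snd e) \<in> D} (\<lambda>e. ?step (snd (snd e)) (fst e) (fst (snd e)))"
    by (intro computable_Pair computable_Cons computable_fst computable_snd computable_id)
  then have "computable D (\<lambda>x. snd (foldl (\<lambda>s y. ?step x s y) ([], g x) (rev (xs x))))"
    by (intro computable_snd, rule computable_foldl[rotated 2])
      (intro computable_rev computable_Pair xs g computable_const)+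
  moreover have "foldl (\<lambda>s y. ?step x s y) ([], g x) (rev l)
      = (l, rec_list (g x) (\<lambda>y ys acc. h x y ys acc) l)" for x l
    by (induction l) auto
  ultimately show ?thesis by simp
qed

lemma computable_rec_nat:
  assumes "computable D n" "computable D g"
    "computable {e. snd (snd e) \<in> D} (\<lambda>e. h (snd (snd e)) (fst e) (fst (snd e)))"
  shows "computable D (\<lambda>x. rec_nat (g x) (\<lambda>k acc. h x k acc) (n x))"
  using computable_rec_nat_invariant[OF assms, of "\<lambda>_ _. True"] by simp

lemma computable_apply2:
  assumes "computable D g" "computable {e. snd e \<in> D'} (\<lambda>e. f (snd e) (fst e))"
    "computable D h" "\<And>x. x \<in> D \<Longrightarrow> h x \<in> D'"
  shows "computable D (\<lambda>x. f (h x) (g x))"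
  using computable_comp[OF computable_Pair[OF assms(1,3)] assms(2)] assms(4) by simp

section \<open>List functions and quantifiers over finite lists\<close>

lemma computable_append:
  assumes "computable D xs" "computable D ys"
  shows "computable D (\<lambda>x. xs x @ ys x)"
proof -
  have "computable D (\<lambda>x. rec_list (ys x) (\<lambda>y zs acc. y # acc) (xs x))"
    by (intro computable_rec_list assms computable_Cons computable_fst computable_snd computable_id)
  moreover have "rec_list l (\<lambda>y zs acc. y # acc) k = k @ l" for l k :: "'b list"
    by (induction k) auto
  ultimately show ?thesis by simp
qed

lemma computable_concat:
  assumes "computable D xs"
  shows "computable D (\<lambda>x. concat (xs x))"
proof -
  have "computable D (\<lambda>x. rec_list [] (\<lambda>y zs acc. y @ acc) (xs x))"
    by (intro computable_rec_list assms computable_append computable_const computable_fst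
        computable_snd computable_id)
  moreover have "rec_list [] (\<lambda>y zs acc. y @ acc) k = concat k" for k :: "'b list list"
    by (induction k) auto
  ultimately show ?thesis by simp
qed

lemma computable_map:
  assumes "computable D xs" "computable {e. snd e \<in> D} (\<lambda>e. f (snd e) (fst e))"
  shows "computable D (\<lambda>x. map (\<lambda>y. f x y) (xs x))"
proof -
  have "computable {e. snd (snd (snd e)) \<in> D} (\<lambda>e. f (snd (snd (snd e))) (fst e))"
    by (rule computable_apply2[OF _ assms(2)]) (auto intro!: computable_fst computable_snd computable_id)
  then have "computable D (\<lambda>x. rec_list [] (\<lambda>y zs acc. f x y # acc) (xs x))"
    by (intro computable_rec_list assms computable_Cons computable_const computable_fst
        computable_snd computable_id)
  moreover have "rec_list [] (\<lambda>y zs acc. f x y # acc) k = map (\<lambda>y. f x y) k" for x k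
    by (induction k) auto
  ultimately show ?thesis by simp
qed

lemma computable_length:
  assumes "computable D xs" shows "computable D (\<lambda>x. length (xs x))"
proof -
  have "computable D (\<lambda>x. rec_list 0 (\<lambda>y zs acc. Suc acc) (xs x))"
    by (intro computable_rec_list assms computable_Suc computable_const computable_fst
        computable_snd computable_id)
  moreover have "rec_list 0 (\<lambda>y zs acc. Suc acc) k = length k" for k :: "'b list"
    by (induction k) auto
  ultimately show ?thesis by simp
qed

lemma computable_sum_list:
  fixes xs :: "'a::codable \<Rightarrow> nat list"
  assumes "computable D xs" shows "computable D (\<lambda>x. sum_list (xs x))"
proof -
  have "computable D (\<lambda>x. rec_list 0 (\<lambda>y zs acc. y + acc) (xs x))"
    by (intro computable_rec_list assms computable_add computable_const computable_fst
        computable_snd computable_id)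
  moreover have "rec_list 0 (\<lambda>y zs acc. y + acc) k = sum_list k" for k :: "nat list"
    by (induction k) auto
  ultimately show ?thesis by simp
qed

lemma computable_replicate:
  assumes "computable D n" "computable D f"
  shows "computable D (\<lambda>x. replicate (n x) (f x))"
proof -
  have "computable {e. snd (snd e) \<in> D} (\<lambda>e. f (snd (snd e)))"
    by (rule computable_comp[OF _ assms(2)]) (auto intro!: computable_snd computable_id)
  then have "computable D (\<lambda>x. rec_nat [] (\<lambda>k acc. f x # acc) (n x))"
    by (intro computable_rec_nat assms computable_const computable_Cons computable_fst
        computable_snd computable_id)
  moreover have "rec_nat [] (\<lambda>k acc. f x # acc) k = replicate k (f x)" for x k
    by (induction k) auto
  ultimately show ?thesis by simp
qed

lemma decidable_ball_set:
  assumes "computable D xs" "decidable {e. snd e \<in> D} (\<lambda>e. P (snd e) (fst e))"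
  shows "decidable D (\<lambda>x. \<forall>y\<in>set (xs x). P x y)"
proof -
  have "computable D (\<lambda>x. map (\<lambda>y. of_bool (P x y) :: nat) (xs x))"
    using assms unfolding decidable_def by (rule computable_map)
  then have "computable D (\<lambda>x. rec_list 1 (\<lambda>y zs acc. if y = 0 then 0 else acc :: nat)
      (map (\<lambda>y. of_bool (P x y) :: nat) (xs x)))"
    by (intro computable_rec_list computable_if decidable_eq computable_const computable_fst
        computable_snd computable_id)
  moreover have "rec_list 1 (\<lambda>y zs acc. if y = 0 then 0 else acc :: nat)
      (map (\<lambda>y. of_bool (P x y) :: nat) l) = of_bool (\<forall>y\<in>set l. P x y)" for x l
    by (induction l) auto
  ultimately show ?thesis by (simp add: decidable_def)
qed

lemma decidable_bex_set:
  assumes "computable D xs" "decidable {e. snd e \<in> D} (\<lambda>e. P (snd e) (fst e))"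
  shows "decidable D (\<lambda>x. \<exists>y\<in>set (xs x). P x y)"
  using decidable_Not[OF decidable_ball_set[OF assms(1) decidable_Not[OF assms(2)]]] by simp

lemma decidable_comp:
  assumes "computable D f" "decidable E P" "\<And>x. x \<in> D \<Longrightarrow> f x \<in> E"
  shows "decidable D (\<lambda>x. P (f x))"
  using assms unfolding decidable_def by (rule computable_comp)

lemma decidable_in_set:
  assumes "computable D f" "computable D xs"
  shows "decidable D (\<lambda>x. f x \<in> set (xs x))"
proof -
  have "computable {e. snd e \<in> D} (\<lambda>e. f (snd e))"
    by (rule computable_comp[OF _ assms(1)]) (auto intro!: computable_snd computable_id)
  then have "decidable D (\<lambda>x. \<exists>y\<in>set (xs x). f x = y)"
    by (intro decidable_bex_set assms decidable_eq computable_fst computable_id)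
  then show ?thesis by simp
qed

text \<open>Minimisation of the negated test, so that value 0 means success. Every smaller candidate
  yields the value 1, as minimisation demands, and the assumed witness makes the search end.\<close>

lemma computable_search:
  fixes P :: "'a::codable \<Rightarrow> 'b::codable \<Rightarrow> bool"
  assumes P: "decidable {e. fst e \<in> D} (\<lambda>e. P (fst e) (snd e))"
    and ex: "\<And>x. x \<in> D \<Longrightarrow> \<exists>c. P x c"
  shows "\<exists>f. computable D f \<and> (\<forall>x\<in>D. P x (f x))"
proof -
  from decidable_Not[OF P] obtain q
    where q: "\<And>x c. x \<in> D \<Longrightarrow> eval q [enc (x, c)] (of_bool (\<not> P x c))"
    unfolding decidable_def computable_def by auto
  have "rcomputable 2 (\<lambda>xs. prod_encode (xs ! 1, xs ! 0))"
    by (intro rcomputable_pair rcomputable_nth) auto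
  then obtain s where "\<And>xs. length xs = 2 \<Longrightarrow> eval s xs (prod_encode (xs ! 1, xs ! 0))"
    unfolding rcomputable_def by blast
  from this[of "[a, b]" for a b] have s: "\<And>a b. eval s [a, b] (prod_encode (b, a))" by simp
  have qs: "eval (Comp q [s]) [n, enc x] (of_bool (\<not> P x (dec n)))" if "x \<in> D" for x n
    using s q[OF that, of "dec n"] by (intro ev_comp[where ys = "[prod_encode (enc x, n)]"]) auto
  define f :: "'a \<Rightarrow> 'b" where "f = (\<lambda>x. dec (LEAST n. P x (dec n)))"
  have holds: "P x (f x)" if x: "x \<in> D" for x
  proof -
    obtain c where "P x c" using ex[OF x] by blast
    then have "P x (dec (enc c))" by simp
    then show ?thesis unfolding f_def by (rule LeastI)
  qed
  have "eval (Minr (Comp q [s])) [enc x] (enc (f x))" if x: "x \<in> D" for x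
  proof (rule ev_min)
    show "eval (Comp q [s]) [enc (f x), enc x] 0" using qs[OF x, of "enc (f x)"] holds[OF x] by simp
    show "\<forall>m<enc (f x). \<exists>y. eval (Comp q [s]) [m, enc x] (Suc y)"
    proof (intro allI impI)
      fix m assume "m < enc (f x)"
      then have "\<not> P x (dec m)" unfolding f_def by (auto dest: not_less_Least)
      then show "\<exists>y. eval (Comp q [s]) [m, enc x] (Suc y)" using qs[OF x, of m] by auto
    qed
  qed
  then show ?thesis using holds unfolding computable_def by blast
qed

lemmas computable_intros =
  computable_id computable_const computable_fst computable_snd computable_Pair computable_Cons
  computable_Suc computable_add computable_diff computable_enc computable_append computable_concat
  computable_map computable_length computable_sum_list computable_replicate computable_rev
  computable_if decidable_eq decidable_in_set decidable_Not decidable_conj decidable_disj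

section \<open>Higman's lemma\<close>

text \<open>Well-quasi-ordering in the form of infinite increasing subsequences instead of one good
  pair: this form passes to concatenations by thinning out twice, and to unions by picking the part
  that is visited infinitely often.\<close>

definition wqo_lang :: "'a list set \<Rightarrow> bool" where
  "wqo_lang S \<longleftrightarrow> (\<forall>f :: nat \<Rightarrow> 'a list. (\<forall>i. f i \<in> S) \<longrightarrow>
     (\<exists>\<phi> :: nat \<Rightarrow> nat. strict_mono \<phi> \<and> (\<forall>i j. i \<le> j \<longrightarrow> subseq (f (\<phi> i)) (f (\<phi> j)))))"

lemma wqo_langD:
  assumes "wqo_lang S" "\<And>i. f i \<in> S"
  shows "\<exists>\<phi> :: nat \<Rightarrow> nat. strict_mono \<phi> \<and> (\<forall>i j. i \<le> j \<longrightarrow> subseq (f (\<phi> i)) (f (\<phi> j)))"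
  using assms unfolding wqo_lang_def by blast

lemma wqo_lang_subset: "wqo_lang T \<Longrightarrow> S \<subseteq> T \<Longrightarrow> wqo_lang S"
  unfolding wqo_lang_def by blast

lemma wqo_lang_empty: "wqo_lang {}"
  unfolding wqo_lang_def by blast

lemma wqo_lang_infinitely_often:
  assumes S: "wqo_lang S" and inf: "infinite {i :: nat. f i \<in> S}"
  shows "\<exists>\<phi> :: nat \<Rightarrow> nat. strict_mono \<phi> \<and> (\<forall>i j. i \<le> j \<longrightarrow> subseq (f (\<phi> i)) (f (\<phi> j)))"
proof -
  let ?e = "Infinite_Set.enumerate {i. f i \<in> S}"
  have e: "strict_mono ?e" using inf by (rule strict_mono_enumerate)
  have "f (?e i) \<in> S" for i using enumerate_in_set[OF inf, of i] by simp
  then obtain \<phi> :: "nat \<Rightarrow> nat" where "strict_mono \<phi>" "\<And>i j. i \<le> j \<Longrightarrow> subseq (f (?e (\<phi> i))) (f (?e (\<phi> j)))"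
    using wqo_langD[OF S, of "\<lambda>i. f (?e i)"] by blast
  then show ?thesis using e by (intro exI[of _ "?e \<circ> \<phi>"]) (auto simp: strict_mono_def)
qed

lemma wqo_lang_Un:
  assumes "wqo_lang S" "wqo_lang T" shows "wqo_lang (S \<union> T)"
  unfolding wqo_lang_def
proof (intro allI impI)
  fix f :: "nat \<Rightarrow> 'a list" assume "\<forall>i. f i \<in> S \<union> T"
  then have "{i. f i \<in> S} \<union> {i. f i \<in> T} = UNIV" by auto
  then have "infinite {i. f i \<in> S} \<or> infinite {i. f i \<in> T}"
    by (metis finite_Un infinite_UNIV_nat)
  then show "\<exists>\<phi> :: nat \<Rightarrow> nat. strict_mono \<phi> \<and> (\<forall>i j. i \<le> j \<longrightarrow> subseq (f (\<phi> i)) (f (\<phi> j)))"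
    using wqo_lang_infinitely_often assms by blast
qed

lemma wqo_lang_append:
  assumes "wqo_lang S" "wqo_lang T"
  shows "wqo_lang {u @ v |u v. u \<in> S \<and> v \<in> T}"
  unfolding wqo_lang_def
proof (intro allI impI)
  fix f :: "nat \<Rightarrow> 'a list" assume "\<forall>i. f i \<in> {u @ v |u v. u \<in> S \<and> v \<in> T}"
  then have "\<forall>i. \<exists>p. f i = fst p @ snd p \<and> fst p \<in> S \<and> snd p \<in> T" by fastforce
  then obtain p where "\<forall>i. f i = fst (p i) @ snd (p i) \<and> fst (p i) \<in> S \<and> snd (p i) \<in> T"
    by (rule choice[THEN exE])
  moreover define u v where "u = (\<lambda>i. fst (p i))" and "v = (\<lambda>i. snd (p i))"
  ultimately have uv: "\<And>i. f i = u i @ v i" "\<And>i. u i \<in> S" "\<And>i. v i \<in> T" by simp_all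
  obtain \<phi> :: "nat \<Rightarrow> nat" where \<phi>: "strict_mono \<phi>" "\<And>i j. i \<le> j \<Longrightarrow> subseq (u (\<phi> i)) (u (\<phi> j))"
    using wqo_langD[where f = u, OF assms(1) uv(2)] by auto
  obtain \<psi> :: "nat \<Rightarrow> nat" where \<psi>: "strict_mono \<psi>" "\<And>i j. i \<le> j \<Longrightarrow> subseq (v (\<phi> (\<psi> i))) (v (\<phi> (\<psi> j)))"
    using wqo_langD[where f = "\<lambda>i. v (\<phi> i)", OF assms(2) uv(3)] by auto
  have "subseq (f (\<phi> (\<psi> i))) (f (\<phi> (\<psi> j)))" if "i \<le> j" for i j
    unfolding uv(1) using \<phi>(2)[of "\<psi> i" "\<psi> j"] \<psi> that strict_mono_less_eq[OF \<psi>(1)]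
    by (intro list_emb_append_mono) auto
  then show "\<exists>\<phi> :: nat \<Rightarrow> nat. strict_mono \<phi> \<and> (\<forall>i j. i \<le> j \<longrightarrow> subseq (f (\<phi> i)) (f (\<phi> j)))"
    using \<phi>(1) \<psi>(1) by (intro exI[of _ "\<phi> \<circ> \<psi>"]) (auto simp: strict_mono_def)
qed

lemma wqo_lang_singleton: "wqo_lang {w}"
  unfolding wqo_lang_def by (intro allI impI exI[of _ id]) (auto simp: strict_mono_def)

text \<open>Cutting at the first \<open>a\<close> loses nothing, since an embedding can always use
  the first occurrence. So avoiding \<open>a # w\<close> reduces to a smaller alphabet before the
  cut and to avoiding \<open>w\<close> after it.\<close>

lemma not_subseq_Cons_cases:
  assumes "\<not> subseq (a # w) x"
  shows "a \<notin> set x \<or> (\<exists>y z. x = y @ a # z \<and> a \<notin> set y \<and> \<not> subseq w z)"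
proof (cases "a \<in> set x")
  case True
  then obtain y z where x: "x = y @ a # z" "a \<notin> set y" by (meson split_list_first)
  then have "\<not> subseq w z" using assms by (auto simp: subseq_drop_many)
  then show ?thesis using x by blast
qed simp

text \<open>Higman's lemma for a finite alphabet. By induction on the alphabet the words avoiding a fixed
  word form a well-quasi-order: they are built by concatenation from words over smaller alphabets.
  A sequence either avoids one of its members infinitely often, or every member is eventually
  dominated and an increasing subsequence can be chosen greedily.\<close>

theorem Higman_lists: "finite A \<Longrightarrow> wqo_lang (lists A)"
proof (induction A rule: finite_psubset_induct)
  case (psubset A)
  have avoid: "wqo_lang {x \<in> lists A. \<not> subseq w x}" if "w \<in> lists A" for w
    using that
  proof (induction w)
    case Nil
    then show ?case by (simp add: wqo_lang_empty)
  next
    case (Cons a w)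
    let ?B = "lists (A - {a})"
    \<comment> \<open>Here \<open>a\<close> belongs to \<open>A\<close>, because
      \<open>a # w\<close> is a word over \<open>A\<close>; the alphabet really shrinks.\<close>
    have "wqo_lang ?B" using Cons.hyps psubset.IH[of "A - {a}"] by blast
    then have "wqo_lang (?B \<union> {u @ v |u v. u \<in> ?B \<and>
        v \<in> {u @ v |u v. u \<in> {[a]} \<and> v \<in> {x \<in> lists A. \<not> subseq w x}}})"
      using Cons.IH by (intro wqo_lang_Un wqo_lang_append wqo_lang_singleton)
    moreover have "x \<in> ?B \<union> {u @ v |u v. u \<in> ?B \<and>
        v \<in> {u @ v |u v. u \<in> {[a]} \<and> v \<in> {x \<in> lists A. \<not> subseq w x}}}"
      if x: "x \<in> lists A" "\<not> subseq (a # w) x" for x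
    proof (cases "a \<in> set x")
      case True
      then obtain y z where "x = y @ a # z" "a \<notin> set y" "\<not> subseq w z"
        using not_subseq_Cons_cases[OF x(2)] by blast
      then show ?thesis using x(1) by (intro UnI2 CollectI exI[of _ y] exI[of _ "a # z"]) auto
    qed (use x(1) in auto)
    ultimately show ?case by (elim wqo_lang_subset) blast
  qed
  show ?case unfolding wqo_lang_def
  proof (intro allI impI)
    fix f :: "nat \<Rightarrow> 'a list" assume f: "\<forall>i. f i \<in> lists A"
    show "\<exists>\<phi> :: nat \<Rightarrow> nat. strict_mono \<phi> \<and> (\<forall>i j. i \<le> j \<longrightarrow> subseq (f (\<phi> i)) (f (\<phi> j)))"
    proof (cases "\<exists>i. infinite {j. f j \<in> {x \<in> lists A. \<not> subseq (f i) x}}")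
      case True
      then show ?thesis using wqo_lang_infinitely_often avoid f by blast
    next
      case False
      have "\<exists>j>i. subseq (f i) (f j)" for i
      proof -
        have "finite {j. \<not> subseq (f i) (f j)}" using False f by auto
        then have "finite ({j. \<not> subseq (f i) (f j)} \<union> {..i})" by simp
        then obtain j where "j \<notin> {j. \<not> subseq (f i) (f j)} \<union> {..i}"
          using ex_new_if_finite infinite_UNIV_nat by blast
        then show ?thesis by (auto simp: not_le)
      qed
      then obtain s where s: "\<And>i. s i > i" "\<And>i. subseq (f i) (f (s i))" by metis
      let ?\<phi> = "\<lambda>n. (s ^^ n) 0"
      have "strict_mono ?\<phi>" by (simp add: strict_mono_Suc_iff s)
      moreover have "subseq (f (?\<phi> i)) (f (?\<phi> j))" if "i \<le> j" for i j
        using that by (induction j rule: dec_induct) (auto intro: subseq_order.order_trans s)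
      ultimately show ?thesis by blast
    qed
  qed
qed

section \<open>Downward closed languages and their finitely many minimal forbidden words\<close>

definition downclosed :: "'a list set \<Rightarrow> bool" where
  "downclosed D \<longleftrightarrow> (\<forall>u v. v \<in> D \<longrightarrow> subseq u v \<longrightarrow> u \<in> D)"

lemma downclosedD: "downclosed D \<Longrightarrow> v \<in> D \<Longrightarrow> subseq u v \<Longrightarrow> u \<in> D"
  unfolding downclosed_def by blast


lemma subseq_set_subset: "subseq u v \<Longrightarrow> set u \<subseteq> set v"
  by (metis set_nths_subset subseq_conv_nths)

text \<open>\<open>W\<close> consists of the minimal words of the complement. They form an
  antichain, which is finite by Higman's lemma, and descent on the length finds one of them below
  every word outside \<open>D\<close>.\<close>

lemma downclosed_finite_basis:
  assumes A: "finite A" and D: "downclosed D" "D \<subseteq> lists A"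
  obtains W where "finite W" "W \<subseteq> lists A" "D = {x \<in> lists A. \<forall>w\<in>W. \<not> subseq w x}"
proof
  define U where "U = lists A - D"
  define W where "W = {w \<in> U. \<forall>u\<in>U. subseq u w \<longrightarrow> u = w}"
  show "finite W"
  proof (rule ccontr)
    assume "infinite W"
    then obtain f :: "nat \<Rightarrow> 'a list" where f: "inj f" "range f \<subseteq> W"
      using infinite_countable_subset by blast
    then have "f i \<in> lists A" for i by (auto simp: W_def U_def)
    then obtain \<phi> :: "nat \<Rightarrow> nat" where \<phi>: "strict_mono \<phi>" "\<And>i j. i \<le> j \<Longrightarrow> subseq (f (\<phi> i)) (f (\<phi> j))"
      using wqo_langD[OF Higman_lists[OF A], of f] by blast
    have "f (\<phi> 0) \<in> W" "f (\<phi> 1) \<in> W" using f(2) by blast+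
    then have "f (\<phi> 0) = f (\<phi> 1)" using \<phi>(2)[of 0 1] by (simp add: W_def)
    then show False using f(1) \<phi>(1) by (metis inj_eq strict_mono_eq zero_neq_one)
  qed
  show "W \<subseteq> lists A" by (auto simp: W_def U_def)
  have above: "\<exists>w\<in>W. subseq w x" if "x \<in> U" for x
    using that
  proof (induction "length x" arbitrary: x rule: less_induct)
    case less
    show ?case
    proof (cases "x \<in> W")
      case False
      then obtain u where u: "u \<in> U" "subseq u x" "u \<noteq> x" using less.prems unfolding W_def by blast
      then have "length u < length x"
        by (metis le_neq_implies_less list_emb_length subseq_same_length)
      then obtain w where "w \<in> W" "subseq w u" using less.hyps[of u] u(1) by blast
      then show ?thesis using u(2) subseq_order.order_trans by blast
    qed auto
  qed
  show "D = {x \<in> lists A. \<forall>w\<in>W. \<not> subseq w x}"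
  proof (intro equalityI subsetI CollectI conjI ballI notI)
    fix x w assume "x \<in> D" "w \<in> W" "subseq w x"
    then show False using downclosedD[OF D(1)] unfolding W_def U_def by blast
  next
    fix x assume "x \<in> {x \<in> lists A. \<forall>w\<in>W. \<not> subseq w x}"
    then show "x \<in> D" using above[of x] unfolding U_def by blast
  qed (use D(2) in blast)
qed

section \<open>Ideals of the subword order\<close>

definition conc :: "'a list set \<Rightarrow> 'a list set \<Rightarrow> 'a list set" where
  "conc S T = {u @ v |u v. u \<in> S \<and> v \<in> T}"

lemma concI: "u \<in> S \<Longrightarrow> v \<in> T \<Longrightarrow> u @ v \<in> conc S T"
  unfolding conc_def by blast

lemma concE:
  assumes "x \<in> conc S T"
  obtains u v where "x = u @ v" "u \<in> S" "v \<in> T"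
  using assms unfolding conc_def by blast

lemma conc_Nil [simp]: "conc {[]} S = S" "conc S {[]} = S"
  unfolding conc_def by auto

lemma conc_assoc: "conc (conc S T) U = conc S (conc T U)"
proof (intro equalityI subsetI)
  fix x assume "x \<in> conc (conc S T) U"
  then show "x \<in> conc S (conc T U)" by (elim concE) (auto intro!: concI)
next
  fix x assume "x \<in> conc S (conc T U)"
  then show "x \<in> conc (conc S T) U"
    by (elim concE) (auto simp: append_assoc[symmetric] simp del: append_assoc intro!: concI)
qed

lemma conc_UN: "conc S (\<Union>i\<in>I. T i) = (\<Union>i\<in>I. conc S (T i))"
  unfolding conc_def by blast

lemma in_conc_optional: "x \<in> conc {[], [a]} S \<longleftrightarrow> x \<in> S \<or> (\<exists>y\<in>S. x = a # y)"
  using concI[of "[]" "{[], [a]}" x S] concI[of "[a]" "{[], [a]}" _ S] by (auto elim!: concE)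

lemma Cons_in_conc_lists:
  assumes "x \<notin> B" shows "x # xs \<in> conc (lists B) S \<longleftrightarrow> x # xs \<in> S"
proof
  assume "x # xs \<in> conc (lists B) S"
  then obtain u v where "x # xs = u @ v" "u \<in> lists B" "v \<in> S" by (rule concE)
  then show "x # xs \<in> S" using assms by (cases u) auto
next
  assume "x # xs \<in> S"
  then show "x # xs \<in> conc (lists B) S" using concI[of "[]" "lists B" "x # xs" S] by simp
qed

lemma downclosed_conc: "downclosed S \<Longrightarrow> downclosed T \<Longrightarrow> downclosed (conc S T)"
  unfolding downclosed_def by (auto elim!: concE subseq_appendE intro: concI)

lemma downclosed_lists: "downclosed (lists A)"
  unfolding downclosed_def by (meson in_lists_conv_set subseq_set_subset subsetD)

lemma downclosed_optional: "downclosed {[], [a]}"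
proof -
  have "u = [] \<or> u = [a]" if "subseq u [a]" for u
    using that by (cases u) (auto simp: subseq_Cons2_iff split: if_splits)
  then show ?thesis unfolding downclosed_def by auto
qed

text \<open>Codes for the ideals of the subword order: \<open>(B, a)\<close> stands for the factor \<open>B\<^sup>* (a + \<epsilon>)\<close>.
  A factor \<open>B\<^sup>*\<close> is obtained by taking \<open>a \<in> B\<close>.\<close>

type_synonym ideal_expr = "(nat list \<times> nat) list"

fun ideal_lang :: "ideal_expr \<Rightarrow> lang" where
  "ideal_lang [] = {[]}"
| "ideal_lang ((B, a) # J) = conc (lists (set B)) (conc {[], [a]} (ideal_lang J))"

lemma downclosed_ideal_lang: "downclosed (ideal_lang J)"
proof (induction J rule: ideal_lang.induct)
  case 1
  show ?case by (simp add: downclosed_def)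
next
  case (2 B a J)
  then show ?case by (auto intro!: downclosed_conc downclosed_lists downclosed_optional)
qed

lemma Nil_in_ideal_lang [simp]: "[] \<in> ideal_lang J"
  by (induction J rule: ideal_lang.induct) (auto simp: conc_def)

text \<open>Greedy matching loses nothing: ideals are closed under deleting the first letter, so
  consuming \<open>x\<close> at the earliest possible place leaves the largest language for the
  rest. This equation is the transition rule of the automaton for ideals.\<close>

lemma Cons_in_ideal_lang [simp]:
  "x # xs \<in> ideal_lang ((B, a) # J) \<longleftrightarrow>
     (if x \<in> set B then xs \<in> ideal_lang ((B, a) # J)
      else if x = a then xs \<in> ideal_lang J else x # xs \<in> ideal_lang J)"
proof -
  have dc: "xs \<in> ideal_lang K" if "x # xs \<in> ideal_lang K" for K
    using downclosedD[OF downclosed_ideal_lang that] by (simp add: subseq_Cons')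
  consider "x \<in> set B" | "x \<notin> set B" "x = a" | "x \<notin> set B" "x \<noteq> a" by blast
  then show ?thesis
  proof cases
    case 1
    have "x # xs \<in> ideal_lang ((B, a) # J)" if xs: "xs \<in> ideal_lang ((B, a) # J)"
    proof -
      obtain u v where "xs = u @ v" "u \<in> lists (set B)" "v \<in> conc {[], [a]} (ideal_lang J)"
        using xs unfolding ideal_lang.simps by (rule concE)
      then have "(x # u) @ v \<in> ideal_lang ((B, a) # J)" using 1 by (auto simp del: append_Cons intro!: concI)
      then show ?thesis using \<open>xs = u @ v\<close> by simp
    qed
    then show ?thesis using 1 dc by (auto simp del: ideal_lang.simps)
  next
    case 2
    then have "x # xs \<in> ideal_lang ((B, a) # J) \<longleftrightarrow> xs \<in> ideal_lang J \<or> x # xs \<in> ideal_lang J"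
      by (auto simp: Cons_in_conc_lists in_conc_optional)
    then show ?thesis using 2 dc by (auto simp del: ideal_lang.simps)
  next
    case 3
    then show ?thesis by (auto simp: Cons_in_conc_lists in_conc_optional)
  qed
qed

text \<open>One passage through the list \<open>B\<close> contains each of its letters, so
  \<open>k\<close> passages contain every word over \<open>B\<close> of length at most
  \<open>k\<close>. Hence the pumped words are cofinal in the ideal.\<close>

fun pump :: "nat list \<Rightarrow> ideal_expr \<Rightarrow> word" where
  "pump (k # ks) ((B, a) # J) = concat (replicate k B) @ a # pump ks J"
| "pump _ _ = []"

lemma pump_in_ideal_lang: "pump ks J \<in> ideal_lang J"
proof (induction ks J rule: pump.induct)
  case (1 k ks B a J)
  have "concat (replicate k B) \<in> lists (set B)" by (induction k) auto
  then show ?case using 1 concI[of "[a]" "{[], [a]}", OF _ 1] by (auto intro!: concI)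
qed auto

lemma subseq_concat_replicate:
  assumes "u \<in> lists (set B)" "length u \<le> k"
  shows "subseq u (concat (replicate k B))"
  using assms
proof (induction u arbitrary: k)
  case (Cons x u)
  then obtain k' where k: "k = Suc k'" by (cases k) auto
  have "subseq ([x] @ u) (B @ concat (replicate k' B))"
    using Cons k by (intro list_emb_append_mono) (auto simp: subseq_singleton_left)
  then show ?case using k by simp
qed simp

lemma subseq_pump:
  assumes "x \<in> ideal_lang J" "length ks = length J" "\<forall>k\<in>set ks. length x \<le> k"
  shows "subseq x (pump ks J)"
  using assms
proof (induction ks J arbitrary: x rule: pump.induct)
  case (1 k ks B a J)
  obtain u v w where x: "x = u @ v @ w" "u \<in> lists (set B)" "v \<in> {[], [a]}" "w \<in> ideal_lang J"
    using 1(2) by (auto elim!: concE)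
  have "subseq w (pump ks J)" using 1(3,4) x(1) by (intro 1(1) x(4)) auto
  moreover have "subseq v [a]" using x by auto
  moreover have "subseq u (concat (replicate k B))" using x 1(4) by (intro subseq_concat_replicate) auto
  ultimately have "subseq (u @ v @ w) (concat (replicate k B) @ [a] @ pump ks J)"
    by (intro list_emb_append_mono)
  then show ?case using x by simp
qed auto

text \<open>By cofinality only pumped words with large exponents matter. Containment of an ideal
  thus becomes simultaneous unboundedness of the exponents \<open>ks\<close>.\<close>

lemma ideal_lang_subset_downclose_iff:
  "ideal_lang J \<subseteq> downclose L \<longleftrightarrow>
    (\<forall>m. \<exists>ks. length ks = length J \<and> (\<forall>k\<in>set ks. m \<le> k) \<and> pump ks J \<in> downclose L)"
proof (intro iffI allI subsetI)
  fix m assume "ideal_lang J \<subseteq> downclose L"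
  then show "\<exists>ks. length ks = length J \<and> (\<forall>k\<in>set ks. m \<le> k) \<and> pump ks J \<in> downclose L"
    using pump_in_ideal_lang by (intro exI[of _ "replicate (length J) m"]) auto
next
  fix x assume "\<forall>m. \<exists>ks. length ks = length J \<and> (\<forall>k\<in>set ks. m \<le> k) \<and> pump ks J \<in> downclose L"
    and x: "x \<in> ideal_lang J"
  then obtain ks where "length ks = length J" "\<forall>k\<in>set ks. length x \<le> k" "pump ks J \<in> downclose L"
    by blast
  then show "x \<in> downclose L" using subseq_pump[OF x] subseq_order.order_trans
    unfolding downclose_def by blast
qed

lemma ideal_lang_directed:
  assumes "finite F" "F \<subseteq> ideal_lang J"
  shows "\<exists>y\<in>ideal_lang J. \<forall>x\<in>F. subseq x y"
proof (intro bexI ballI)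
  fix x assume "x \<in> F"
  then show "subseq x (pump (replicate (length J) (Max (length ` F))) J)"
    using assms by (intro subseq_pump) auto
qed (rule pump_in_ideal_lang)

section \<open>Finite unions of ideals, and what remains of them when a subword is forbidden\<close>

definition ideal_union :: "lang \<Rightarrow> bool" where
  "ideal_union D \<longleftrightarrow> (\<exists>Js. D = (\<Union>J\<in>set Js. ideal_lang J))"

lemma ideal_union_empty: "ideal_union {}"
  unfolding ideal_union_def by (intro exI[of _ "[]"]) simp

lemma ideal_union_ideal: "ideal_union (ideal_lang J)"
  unfolding ideal_union_def by (intro exI[of _ "[J]"]) simp

lemma ideal_union_Un:
  assumes "ideal_union D" "ideal_union E" shows "ideal_union (D \<union> E)"
proof -
  obtain Js Ks where "D = (\<Union>J\<in>set Js. ideal_lang J)" "E = (\<Union>J\<in>set Ks. ideal_lang J)"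
    using assms unfolding ideal_union_def by blast
  then show ?thesis unfolding ideal_union_def by (intro exI[of _ "Js @ Ks"]) auto
qed

lemma ideal_union_UN:
  "finite I \<Longrightarrow> (\<And>i. i \<in> I \<Longrightarrow> ideal_union (D i)) \<Longrightarrow> ideal_union (\<Union>i\<in>I. D i)"
  by (induction I rule: finite_induct) (auto intro: ideal_union_empty ideal_union_Un)

lemma ideal_union_factor:
  assumes "ideal_union D" shows "ideal_union (conc (lists (set B)) (conc {[], [a]} D))"
proof -
  obtain Js where "D = (\<Union>J\<in>set Js. ideal_lang J)" using assms unfolding ideal_union_def by blast
  then have "conc (lists (set B)) (conc {[], [a]} D) = (\<Union>J\<in>set (map ((#) (B, a)) Js). ideal_lang J)"
    by (simp add: conc_UN)
  then show ?thesis unfolding ideal_union_def by blast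
qed

lemma ideal_union_optional: "ideal_union D \<Longrightarrow> ideal_union (conc {[], [a]} D)"
  using ideal_union_factor[of D "[]" a] by simp

lemma ideal_union_star:
  assumes "ideal_union D" "finite B" shows "ideal_union (conc (lists B) D)"
proof (cases "B = {}")
  case False
  then obtain b where b: "b \<in> B" by blast
  obtain bs where bs: "set bs = B" using assms(2) finite_list by blast
  have "conc (lists B) {[], [b]} = lists B"
    using b concI[of x "lists B" "[]" "{[], [b]}" for x] by (auto elim!: concE)
  then have "conc (lists (set bs)) (conc {[], [b]} D) = conc (lists B) D"
    by (simp add: bs conc_assoc[symmetric])
  then show ?thesis using ideal_union_factor[OF assms(1)] by metis
qed (simp add: assms)

definition avoiding :: "word \<Rightarrow> lang" where
  "avoiding w = {x. \<not> subseq w x}"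

lemma subseq_Cons_append_iff: "c \<notin> set u \<Longrightarrow> subseq (c # w) (u @ y) \<longleftrightarrow> subseq (c # w) y"
  by (induction u) (auto simp: subseq_Cons2_neq)

text \<open>If \<open>c\<close> is not in \<open>B\<close>, the star cannot help to embed
  \<open>c # w\<close>. Otherwise the words split by whether the starred part contains
  \<open>c\<close>: if not, the rest in \<open>D\<close> avoids \<open>c # w\<close>; if so,
  everything after the first \<open>c\<close> avoids \<open>w\<close>. Making that \<open>c\<close>
  optional adds no wrong word, because avoiding \<open>w\<close> implies avoiding
  \<open>c # w\<close>.\<close>

lemma ideal_union_star_avoiding:
  assumes D: "\<And>w. ideal_union (D \<inter> avoiding w)" and B: "finite B"
  shows "ideal_union (conc (lists B) D \<inter> avoiding w)"
proof (induction w)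
  case Nil
  then show ?case by (simp add: avoiding_def ideal_union_empty)
next
  case (Cons c w)
  show ?case
  proof (cases "c \<in> B")
    case False
    have "conc (lists B) D \<inter> avoiding (c # w) = conc (lists B) (D \<inter> avoiding (c # w))"
    proof (intro equalityI subsetI)
      fix x assume "x \<in> conc (lists B) D \<inter> avoiding (c # w)"
      then obtain u d where x: "x = u @ d" "u \<in> lists B" "d \<in> D" "\<not> subseq (c # w) (u @ d)"
        by (auto simp: avoiding_def elim!: concE)
      moreover have "c \<notin> set u" using x False by auto
      ultimately show "x \<in> conc (lists B) (D \<inter> avoiding (c # w))"
        by (auto simp: avoiding_def subseq_Cons_append_iff intro!: concI)
    next
      fix x assume "x \<in> conc (lists B) (D \<inter> avoiding (c # w))"
      then obtain u d where x: "x = u @ d" "u \<in> lists B" "d \<in> D" "\<not> subseq (c # w) d"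
        by (auto simp: avoiding_def elim!: concE)
      moreover have "c \<notin> set u" using x False by auto
      ultimately show "x \<in> conc (lists B) D \<inter> avoiding (c # w)"
        by (auto simp: avoiding_def subseq_Cons_append_iff intro!: concI)
    qed
    then show ?thesis using ideal_union_star[OF D B] by simp
  next
    case True
    let ?B = "lists (B - {c})"
    have "conc (lists B) D \<inter> avoiding (c # w) = conc ?B (D \<inter> avoiding (c # w)) \<union>
        conc ?B (conc {[], [c]} (conc (lists B) D \<inter> avoiding w))"
    proof (intro equalityI subsetI)
      fix x assume "x \<in> conc (lists B) D \<inter> avoiding (c # w)"
      then obtain u d where x: "x = u @ d" "u \<in> lists B" "d \<in> D" "\<not> subseq (c # w) (u @ d)"
        by (auto simp: avoiding_def elim!: concE)
      show "x \<in> conc ?B (D \<inter> avoiding (c # w)) \<union>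
        conc ?B (conc {[], [c]} (conc (lists B) D \<inter> avoiding w))"
      proof (cases "c \<in> set u")
        case True
        then obtain y z where u: "u = y @ c # z" "c \<notin> set y" by (meson split_list_first)
        then have "\<not> subseq w (z @ d)" using x(4) by (auto simp: subseq_drop_many)
        then have "z @ d \<in> conc (lists B) D \<inter> avoiding w"
          using x u by (auto simp: avoiding_def intro!: concI)
        then have "y @ [c] @ z @ d \<in> conc ?B (conc {[], [c]} (conc (lists B) D \<inter> avoiding w))"
          using x u by (intro concI) auto
        then show ?thesis using x u by simp
      next
        case False
        then have "x \<in> conc ?B (D \<inter> avoiding (c # w))"
          using x by (auto simp: avoiding_def subseq_Cons_append_iff intro!: concI)
        then show ?thesis by blast
      qed
    next
      fix x assume "x \<in> conc ?B (D \<inter> avoiding (c # w)) \<union>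
        conc ?B (conc {[], [c]} (conc (lists B) D \<inter> avoiding w))"
      then consider u d where "x = u @ d" "u \<in> ?B" "d \<in> D" "\<not> subseq (c # w) d"
        | u v b d where "x = u @ v @ b @ d" "u \<in> ?B" "v \<in> {[], [c]}" "b \<in> lists B" "d \<in> D"
            "\<not> subseq w (b @ d)"
        unfolding avoiding_def by (elim UnE concE IntE) blast+
      then show "x \<in> conc (lists B) D \<inter> avoiding (c # w)"
      proof cases
        case 1
        then have "c \<notin> set u" by auto
        then show ?thesis using 1 by (auto simp: avoiding_def subseq_Cons_append_iff intro!: concI)
      next
        case 2
        then have "c \<notin> set u" by auto
        moreover have "\<not> subseq (c # w) (v @ b @ d)" using 2 by (auto dest: subseq_Cons')
        moreover have "(u @ v @ b) @ d \<in> conc (lists B) D" using 2 True by (intro concI) auto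
        ultimately show ?thesis using 2 by (simp add: avoiding_def subseq_Cons_append_iff)
      qed
    qed
    moreover have "finite (B - {c})" using B by simp
    ultimately show ?thesis
      using ideal_union_Un[OF ideal_union_star[OF D] ideal_union_star[OF ideal_union_optional[OF Cons.IH]]]
      by simp
  qed
qed

lemma ideal_union_optional_avoiding:
  assumes D: "\<And>w. ideal_union (D \<inter> avoiding w)"
  shows "ideal_union (conc {[], [a]} D \<inter> avoiding w)"
proof (cases w)
  case Nil
  then show ?thesis by (simp add: avoiding_def ideal_union_empty)
next
  case (Cons c w')
  show ?thesis
  proof (cases "a = c")
    case False
    then have "conc {[], [a]} D \<inter> avoiding w = conc {[], [a]} (D \<inter> avoiding w)"
      by (auto simp: in_conc_optional avoiding_def Cons subseq_Cons2_neq)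
    then show ?thesis using ideal_union_optional[OF D] by simp
  next
    case True
    have "conc {[], [a]} D \<inter> avoiding w = (D \<inter> avoiding w) \<union> conc {[], [a]} (D \<inter> avoiding w')"
      unfolding set_eq_iff in_conc_optional Un_iff Int_iff
      by (auto simp: avoiding_def Cons True dest: subseq_Cons')
    then show ?thesis using ideal_union_Un[OF D ideal_union_optional[OF D]] by simp
  qed
qed

lemma ideal_union_ideal_avoiding: "ideal_union (ideal_lang J \<inter> avoiding w)"
proof (induction J arbitrary: w rule: ideal_lang.induct)
  case 1
  have "ideal_lang [] \<inter> avoiding w = (if w = [] then {} else ideal_lang [])"
    by (auto simp: avoiding_def)
  then show ?case by (simp add: ideal_union_empty ideal_union_ideal del: ideal_lang.simps)
next
  case (2 B a J)
  then show ?case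
    by (auto intro!: ideal_union_star_avoiding ideal_union_optional_avoiding)
qed

lemma ideal_union_avoiding:
  assumes "ideal_union D" shows "ideal_union (D \<inter> avoiding w)"
proof -
  obtain Js where D: "D = (\<Union>J\<in>set Js. ideal_lang J)" using assms unfolding ideal_union_def by blast
  have "ideal_union (\<Union>J\<in>set Js. ideal_lang J \<inter> avoiding w)"
    by (intro ideal_union_UN ideal_union_ideal_avoiding) simp
  then show ?thesis unfolding D by simp
qed

text \<open>\<open>lists A\<close> is an ideal union, and forbidding the finitely many basis words
  one at a time preserves this property.\<close>

theorem downclosed_ideal_union:
  assumes A: "finite A" and D: "downclosed D" "D \<subseteq> lists A"
  shows "ideal_union D"
proof -
  obtain W where W: "finite W" "W \<subseteq> lists A" "D = {x \<in> lists A. \<forall>w\<in>W. \<not> subseq w x}"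
    by (rule downclosed_finite_basis[OF A D])
  have "ideal_union {x \<in> lists A. \<forall>w\<in>W. \<not> subseq w x}"
    using W(1)
  proof (induction W rule: finite_induct)
    case empty
    then show ?case using ideal_union_star[OF ideal_union_ideal[of "[]"] A] by simp
  next
    case (insert w W)
    have "{x \<in> lists A. \<forall>w\<in>insert w W. \<not> subseq w x}
        = {x \<in> lists A. \<forall>w\<in>W. \<not> subseq w x} \<inter> avoiding w"
      by (auto simp: avoiding_def)
    then show ?case using ideal_union_avoiding[OF insert.IH] by simp
  qed
  then show ?thesis using W(3) by simp
qed

section \<open>Piecewise testable separability\<close>

lemma PT_lists: "lists A \<in> PT A"
  using PT.piece[of "[]" A] by (simp add: piece_lang_def)

lemma PT_empty: "{} \<in> PT A"
  using PT.compl[OF PT_lists] by simp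

lemma PT_UN: "finite I \<Longrightarrow> (\<And>i. i \<in> I \<Longrightarrow> S i \<in> PT A) \<Longrightarrow> (\<Union>i\<in>I. S i) \<in> PT A"
  by (induction I rule: finite_induct) (auto intro: PT_empty PT.union)

lemma PT_INT: "finite I \<Longrightarrow> (\<And>i. i \<in> I \<Longrightarrow> S i \<in> PT A) \<Longrightarrow> lists A \<inter> (\<Inter>i\<in>I. S i) \<in> PT A"
proof (induction I rule: finite_induct)
  case (insert i I)
  have "lists A \<inter> (\<Inter>i\<in>insert i I. S i) = S i \<inter> (lists A \<inter> (\<Inter>i\<in>I. S i))" by blast
  then show ?case using insert by (auto intro: PT.inter)
qed (simp add: PT_lists)

lemma downclosed_PT:
  assumes "finite A" "downclosed D" "D \<subseteq> lists A"
  shows "D \<in> PT A"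
proof -
  obtain W where W: "finite W" "W \<subseteq> lists A" "D = {x \<in> lists A. \<forall>w\<in>W. \<not> subseq w x}"
    by (rule downclosed_finite_basis[OF assms])
  have "D = lists A \<inter> (\<Inter>w\<in>W. lists A - piece_lang A w)"
    unfolding W(3) by (auto simp: piece_lang_def)
  moreover have "lists A - piece_lang A w \<in> PT A" if "w \<in> W" for w
    using that W(2) by (intro PT.compl PT.piece) auto
  ultimately show ?thesis using PT_INT[OF W(1)] by metis
qed

lemma downclosed_inter_lists: "downclosed D \<Longrightarrow> downclosed (D \<inter> lists A)"
  using downclosed_lists[of A] unfolding downclosed_def by blast

lemma downclosed_downclose: "downclosed (downclose L)"
  unfolding downclosed_def downclose_def mem_Collect_eq by (meson subseq_order.order_trans)

lemma downclosed_avoiding: "downclosed (avoiding w)"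
  unfolding downclosed_def avoiding_def using subseq_order.order_trans by blast

definition ideal_indist :: "ideal_expr set \<Rightarrow> word \<Rightarrow> word \<Rightarrow> bool" where
  "ideal_indist Js x y \<longleftrightarrow> (\<forall>J\<in>Js. x \<in> ideal_lang J \<longleftrightarrow> y \<in> ideal_lang J)"

text \<open>The words over \<open>A\<close> outside a piece language are downward closed, hence a
  finite union of ideals, and membership in these ideals determines membership in the piece. Boolean
  operations only require joining the lists.\<close>

lemma PT_saturated:
  assumes A: "finite A" and "S \<in> PT A"
  shows "\<exists>Js. \<forall>x\<in>lists A. \<forall>y\<in>lists A. ideal_indist (set Js) x y \<longrightarrow> (x \<in> S \<longleftrightarrow> y \<in> S)"
  using assms(2)
proof (induction rule: PT.induct)
  case (piece as)
  have "ideal_union (avoiding as \<inter> lists A)"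
    using A by (intro downclosed_ideal_union downclosed_inter_lists downclosed_avoiding) auto
  then obtain Js where Js: "avoiding as \<inter> lists A = (\<Union>J\<in>set Js. ideal_lang J)"
    unfolding ideal_union_def by blast
  show ?case
  proof (intro exI[of _ Js] ballI impI)
    fix x y assume xy: "x \<in> lists A" "y \<in> lists A" "ideal_indist (set Js) x y"
    then have "x \<in> (\<Union>J\<in>set Js. ideal_lang J) \<longleftrightarrow> y \<in> (\<Union>J\<in>set Js. ideal_lang J)"
      unfolding ideal_indist_def by blast
    then show "x \<in> piece_lang A as \<longleftrightarrow> y \<in> piece_lang A as"
      using xy unfolding Js[symmetric] by (auto simp: piece_lang_def avoiding_def)
  qed
next
  case (compl S)
  obtain Js where "\<forall>x\<in>lists A. \<forall>y\<in>lists A. ideal_indist (set Js) x y \<longrightarrow> (x \<in> S \<longleftrightarrow> y \<in> S)"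
    using compl.IH by (elim exE)
  then show ?case by (intro exI[of _ Js]) simp
next
  case (union S T)
  obtain Js where Js: "\<forall>x\<in>lists A. \<forall>y\<in>lists A. ideal_indist (set Js) x y \<longrightarrow> (x \<in> S \<longleftrightarrow> y \<in> S)"
    using union.IH(1) by (elim exE)
  obtain Ks where Ks: "\<forall>x\<in>lists A. \<forall>y\<in>lists A. ideal_indist (set Ks) x y \<longrightarrow> (x \<in> T \<longleftrightarrow> y \<in> T)"
    using union.IH(2) by (elim exE)
  have "ideal_indist (set Js) x y \<and> ideal_indist (set Ks) x y" if "ideal_indist (set (Js @ Ks)) x y" for x y
    using that by (simp add: ideal_indist_def ball_Un)
  then show ?case using Js Ks by (intro exI[of _ "Js @ Ks"]) blast
next
  case (inter S T)
  obtain Js where Js: "\<forall>x\<in>lists A. \<forall>y\<in>lists A. ideal_indist (set Js) x y \<longrightarrow> (x \<in> S \<longleftrightarrow> y \<in> S)"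
    using inter.IH(1) by (elim exE)
  obtain Ks where Ks: "\<forall>x\<in>lists A. \<forall>y\<in>lists A. ideal_indist (set Ks) x y \<longrightarrow> (x \<in> T \<longleftrightarrow> y \<in> T)"
    using inter.IH(2) by (elim exE)
  have "ideal_indist (set Js) x y \<and> ideal_indist (set Ks) x y" if "ideal_indist (set (Js @ Ks)) x y" for x y
    using that by (simp add: ideal_indist_def ball_Un)
  then show ?case using Js Ks by (intro exI[of _ "Js @ Ks"]) blast
qed

lemma ideal_class_PT:
  assumes "finite A"
  shows "{y \<in> lists A. ideal_indist (set Js) x y} \<in> PT A"
proof -
  let ?C = "\<lambda>J. if x \<in> ideal_lang J then ideal_lang J \<inter> lists A else lists A - (ideal_lang J \<inter> lists A)"
  have "ideal_lang J \<inter> lists A \<in> PT A" for J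
    using assms by (intro downclosed_PT downclosed_inter_lists downclosed_ideal_lang) auto
  then have "?C J \<in> PT A" for J by (auto intro: PT.compl)
  then have "lists A \<inter> (\<Inter>J\<in>set Js. ?C J) \<in> PT A" by (intro PT_INT) auto
  moreover have "{y \<in> lists A. ideal_indist (set Js) x y} = lists A \<inter> (\<Inter>J\<in>set Js. ?C J)"
  proof -
    have "y \<in> ?C J \<longleftrightarrow> y \<in> lists A \<and> (x \<in> ideal_lang J \<longleftrightarrow> y \<in> ideal_lang J)" for y J by auto
    then show ?thesis unfolding ideal_indist_def by blast
  qed
  ultimately show ?thesis by simp
qed

text \<open>Replaces the separating language by a finite list of ideals, an object that can be
  enumerated and tested. Conversely, the union of the indistinguishability classes that meet
  \<open>I\<close> separates.\<close>

lemma PT_separable_iff: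
  assumes A: "finite A" and "I \<subseteq> lists A" "E \<subseteq> lists A"
  shows "PT_separable A I E \<longleftrightarrow> (\<exists>Js. \<forall>x\<in>I. \<forall>y\<in>E. \<not> ideal_indist (set Js) x y)"
proof
  assume "PT_separable A I E"
  then obtain S where S: "S \<in> PT A" "I \<subseteq> S" "S \<inter> E = {}" unfolding PT_separable_def by blast
  obtain Js where "\<forall>x\<in>lists A. \<forall>y\<in>lists A. ideal_indist (set Js) x y \<longrightarrow> (x \<in> S \<longleftrightarrow> y \<in> S)"
    using PT_saturated[OF A S(1)] by blast
  then show "\<exists>Js. \<forall>x\<in>I. \<forall>y\<in>E. \<not> ideal_indist (set Js) x y" using S assms by blast
next
  assume "\<exists>Js. \<forall>x\<in>I. \<forall>y\<in>E. \<not> ideal_indist (set Js) x y"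
  then obtain Js where Js: "\<forall>x\<in>I. \<forall>y\<in>E. \<not> ideal_indist (set Js) x y" by blast
  let ?cl = "\<lambda>x. {y \<in> lists A. ideal_indist (set Js) x y}"
  have "?cl x = ?cl y" if "{J \<in> set Js. x \<in> ideal_lang J} = {J \<in> set Js. y \<in> ideal_lang J}" for x y
    using that unfolding ideal_indist_def by blast
  \<comment> \<open>A class depends only on which of the listed ideals contain \<open>x\<close>.
    Choosing a representative for each subset of the list bounds the number of classes.\<close>
  then have "?cl ` I \<subseteq> (\<lambda>K. ?cl (SOME x. {J \<in> set Js. x \<in> ideal_lang J} = K)) ` Pow (set Js)"
  proof (intro subsetI, elim imageE)
    fix C x assume cl: "\<And>x y. {J \<in> set Js. x \<in> ideal_lang J} = {J \<in> set Js. y \<in> ideal_lang J}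
      \<Longrightarrow> ?cl x = ?cl y" and C: "C = ?cl x"
    let ?K = "{J \<in> set Js. x \<in> ideal_lang J}"
    have "{J \<in> set Js. (SOME x. {J \<in> set Js. x \<in> ideal_lang J} = ?K) \<in> ideal_lang J} = ?K"
      by (rule someI[of "\<lambda>y. {J \<in> set Js. y \<in> ideal_lang J} = ?K" x]) simp
    then have "?cl (SOME x. {J \<in> set Js. x \<in> ideal_lang J} = ?K) = ?cl x" by (rule cl)
    then show "C \<in> (\<lambda>K. ?cl (SOME x. {J \<in> set Js. x \<in> ideal_lang J} = K)) ` Pow (set Js)"
      unfolding C by (intro image_eqI[of _ _ ?K]) auto
  qed
  then have "finite (?cl ` I)" by (rule finite_subset) simp
  then have "(\<Union>C\<in>?cl ` I. C) \<in> PT A" using ideal_class_PT[OF A] by (intro PT_UN) auto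
  moreover have "I \<subseteq> (\<Union>C\<in>?cl ` I. C)" using assms(2) by (auto simp: ideal_indist_def)
  moreover have "(\<Union>C\<in>?cl ` I. C) \<inter> E = {}" using Js by blast
  ultimately show "PT_separable A I E" unfolding PT_separable_def by blast
qed

text \<open>By directedness \<open>J\<close> has a word \<open>y\<close> above a witness against
  each listed ideal that does not include \<open>J\<close>. A word of \<open>J\<close> above
  \<open>y\<close> then lies in exactly those listed ideals that include \<open>J\<close>. Both
  \<open>I\<close> and \<open>E\<close> contain such a word, so no list tells them apart.\<close>

lemma common_ideal_not_PT_separable:
  assumes A: "finite A" and sub: "I \<subseteq> lists A" "E \<subseteq> lists A"
    and J: "ideal_lang J \<subseteq> downclose (I \<inter> ideal_lang J)" "ideal_lang J \<subseteq> downclose (E \<inter> ideal_lang J)"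
  shows "\<not> PT_separable A I E"
  unfolding PT_separable_iff[OF A sub]
proof (rule notI, elim exE)
  fix Js assume Js: "\<forall>x\<in>I. \<forall>y\<in>E. \<not> ideal_indist (set Js) x y"
  let ?bad = "{K \<in> set Js. \<not> ideal_lang J \<subseteq> ideal_lang K}"
  have "\<forall>K\<in>?bad. \<exists>w. w \<in> ideal_lang J \<and> w \<notin> ideal_lang K" by blast
  then obtain w where w: "\<forall>K\<in>?bad. w K \<in> ideal_lang J \<and> w K \<notin> ideal_lang K" by (rule bchoice[THEN exE])
  then obtain y where y: "y \<in> ideal_lang J" "\<forall>v\<in>w ` ?bad. subseq v y"
    using ideal_lang_directed[of "w ` ?bad" J] by auto
  have in_iff: "z \<in> ideal_lang K \<longleftrightarrow> ideal_lang J \<subseteq> ideal_lang K"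
    if z: "z \<in> ideal_lang J" "subseq y z" and K: "K \<in> set Js" for z K
  proof (cases "ideal_lang J \<subseteq> ideal_lang K")
    case False
    then have "K \<in> ?bad" using K by blast
    then have "subseq (w K) z" "w K \<notin> ideal_lang K"
      using w y(2) z(2) subseq_order.order_trans by blast+
    then show ?thesis using False downclosedD[OF downclosed_ideal_lang] by blast
  qed (use z in blast)
  obtain x1 where "x1 \<in> I \<inter> ideal_lang J" "subseq y x1" using J(1) y(1) unfolding downclose_def by blast
  moreover obtain x2 where "x2 \<in> E \<inter> ideal_lang J" "subseq y x2"
    using J(2) y(1) unfolding downclose_def by blast
  ultimately show False using Js in_iff unfolding ideal_indist_def by blast
qed

text \<open>If no finite set of ideals separates, pick words \<open>u n \<in> I\<close>, \<open>v n \<in> E\<close> that agree on the first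
  \<open>n\<close> ideals, and thin out so that \<open>u\<close> increases. The ideal generated by \<open>u\<close> is the common one.\<close>

lemma not_PT_separable_common_ideal:
  assumes A: "finite A" and sub: "I \<subseteq> lists A" "E \<subseteq> lists A" and nsep: "\<not> PT_separable A I E"
  shows "\<exists>J. ideal_lang J \<subseteq> downclose (I \<inter> ideal_lang J) \<and> ideal_lang J \<subseteq> downclose (E \<inter> ideal_lang J)"
proof -
  have "\<exists>p. fst p \<in> I \<and> snd p \<in> E \<and> ideal_indist (dec ` {..<n}) (fst p) (snd p)" for n
  proof -
    have "set (map dec [0..<n]) = dec ` {..<n}" by auto
    then show ?thesis using nsep unfolding PT_separable_iff[OF A sub] by (metis fst_conv snd_conv)
  qed
  then have "\<forall>n. \<exists>p. fst p \<in> I \<and> snd p \<in> E \<and> ideal_indist (dec ` {..<n}) (fst p) (snd p)" by blast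
  then obtain p where p: "\<forall>n. fst (p n) \<in> I \<and> snd (p n) \<in> E \<and> ideal_indist (dec ` {..<n}) (fst (p n)) (snd (p n))"
    by (rule choice[THEN exE])
  define u v where "u = (\<lambda>n. fst (p n))" and "v = (\<lambda>n. snd (p n))"
  have u: "u n \<in> I" and v: "v n \<in> E" for n using p by (simp_all add: u_def v_def)
  have agree: "u n \<in> ideal_lang J \<longleftrightarrow> v n \<in> ideal_lang J" if "enc J < n" for n J
  proof -
    have "J \<in> dec ` {..<n}" using that by (intro image_eqI[of _ _ "enc J"]) auto
    then show ?thesis using p unfolding ideal_indist_def u_def v_def by blast
  qed
  have "u n \<in> lists A" for n using u sub(1) by blast
  then obtain \<phi> :: "nat \<Rightarrow> nat" where \<phi>: "strict_mono \<phi>"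
    and inc: "\<forall>i j. i \<le> j \<longrightarrow> subseq (u (\<phi> i)) (u (\<phi> j))"
    using wqo_langD[OF Higman_lists[OF A], of u] by auto
  define D where "D = downclose (range (\<lambda>i. u (\<phi> i)))"
  have "downclosed D" unfolding D_def by (rule downclosed_downclose)
  moreover have "D \<subseteq> lists A"
  proof
    fix x assume "x \<in> D"
    then obtain i where "subseq x (u (\<phi> i))" unfolding D_def downclose_def by blast
    then show "x \<in> lists A" by (rule downclosedD[OF downclosed_lists \<open>u (\<phi> i) \<in> lists A\<close>])
  qed
  ultimately obtain Js where Js: "D = (\<Union>J\<in>set Js. ideal_lang J)"
    using downclosed_ideal_union[OF A] unfolding ideal_union_def by blast
  have uD: "u (\<phi> i) \<in> D" for i unfolding D_def downclose_def by blast
  \<comment> \<open>One of the finitely many ideals contains infinitely many members of the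
    increasing sequence, and therefore all of them.\<close>
  have "(UNIV :: nat set) = (\<Union>J\<in>set Js. {i. u (\<phi> i) \<in> ideal_lang J})" using uD unfolding Js by blast
  then obtain J where J: "J \<in> set Js" "infinite {i. u (\<phi> i) \<in> ideal_lang J}"
    by (metis (no_types, lifting) finite_UN finite_set infinite_UNIV_nat)
  have uJ: "u (\<phi> i) \<in> ideal_lang J" for i
  proof -
    obtain j where "i \<le> j" "u (\<phi> j) \<in> ideal_lang J"
      using J(2) unfolding infinite_nat_iff_unbounded_le by blast
    then show ?thesis using inc downclosedD[OF downclosed_ideal_lang] by blast
  qed
  have "\<exists>z. z \<in> I \<inter> ideal_lang J \<and> subseq w z" "\<exists>z. z \<in> E \<inter> ideal_lang J \<and> subseq w z"
    if w: "w \<in> ideal_lang J" for w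
  proof -
    have "w \<in> D" using w J(1) unfolding Js by blast
    then obtain i where i: "subseq w (u (\<phi> i))" unfolding D_def downclose_def by blast
    then show "\<exists>z. z \<in> I \<inter> ideal_lang J \<and> subseq w z" using u uJ by blast
    \<comment> \<open>Lying above \<open>w\<close> has to be carried over from \<open>u\<close> to
      \<open>v\<close>, which agree only on membership in ideals. But not lying above
      \<open>w\<close> is membership in one of finitely many ideals.\<close>
    have "ideal_union (avoiding w \<inter> lists A)"
      using A by (intro downclosed_ideal_union downclosed_inter_lists downclosed_avoiding) auto
    then obtain Ks where Ks: "avoiding w \<inter> lists A = (\<Union>K\<in>set Ks. ideal_lang K)"
      unfolding ideal_union_def by blast
    \<comment> \<open>Late enough for the increasing sequence to lie above \<open>w\<close> and for
      \<open>u\<close> and \<open>v\<close> to agree on \<open>J\<close> and on all of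
      \<open>Ks\<close>.\<close>
    define j where "j = Suc (i + Max (enc ` set (J # Ks)))"
    have "j \<le> \<phi> j" using \<phi> by (rule strict_mono_imp_increasing)
    moreover have "enc K \<le> Max (enc ` set (J # Ks))" if "K \<in> set (J # Ks)" for K
      using that by (intro Max_ge) auto
    ultimately have big: "enc K < \<phi> j" if "K \<in> set (J # Ks)" for K
      using that unfolding j_def by fastforce
    have vJ: "v (\<phi> j) \<in> ideal_lang J" using agree[OF big, of J] uJ[of j] by simp
    have "subseq w (u (\<phi> j))" using i inc subseq_order.order_trans unfolding j_def
      by (meson le_SucI le_add1)
    then have "u (\<phi> j) \<notin> avoiding w \<inter> lists A" by (simp add: avoiding_def)
    then have "v (\<phi> j) \<notin> avoiding w \<inter> lists A"
      unfolding Ks using agree[OF big] by auto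
    then have "subseq w (v (\<phi> j))" using v sub(2) unfolding avoiding_def by blast
    then show "\<exists>z. z \<in> E \<inter> ideal_lang J \<and> subseq w z" using v vJ by blast
  qed
  then show ?thesis unfolding downclose_def by blast
qed

section \<open>Codes of automata\<close>

text \<open>A triple in place of the datatype, since products and lists carry \<open>enc\<close>;
  the code of the triple is exactly what \<open>decode_nfa\<close> reads.\<close>

type_synonym nfa_expr = "nat list \<times> (nat \<times> nat \<times> nat) list \<times> nat list"

definition nfa_expr_lang :: "nfa_expr \<Rightarrow> lang" where
  "nfa_expr_lang M = nfa_lang (NFA (fst M) (fst (snd M)) (snd (snd M)))"

lemma decode_triple_enc: "decode_triple (enc t) = t"
  by (cases t) (simp add: decode_triple_def)

lemma decode_nfa_enc: "nfa_lang (decode_nfa (enc M)) = nfa_expr_lang M"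
proof -
  have "map decode_triple (list_decode (enc ts)) = ts" for ts :: "(nat \<times> nat \<times> nat) list"
    by (simp add: enc_list_def comp_def decode_triple_enc)
  then show ?thesis by (cases M) (simp add: decode_nfa_def nfa_expr_lang_def)
qed

lemma run_Nil_iff [simp]: "run M p [] q \<longleftrightarrow> p = q"
  by (auto elim: run.cases intro: run_nil)

lemma run_Cons_iff: "run M p (a # w) q \<longleftrightarrow> (\<exists>r. (p, a, r) \<in> set (trans M) \<and> run M r w q)"
  by (auto elim: run.cases intro: run_step)

lemma run_append: "run M p u q \<Longrightarrow> run M q v r \<Longrightarrow> run M p (u @ v) r"
  by (induction rule: run.induct) (auto intro: run_step)

lemma del_by_subseq: "del_by B u w \<Longrightarrow> subseq u w"
  by (induction rule: del_by.induct) auto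


lemma subseq_del_by: "subseq u w \<Longrightarrow> set w \<subseteq> B \<Longrightarrow> del_by B u w"
proof (induction w arbitrary: u)
  case Nil
  then have "u = []" using list_emb_Nil2 by blast
  then show ?case by (simp add: del_by.nil)
next
  case (Cons x w)
  show ?case
  proof (cases "subseq u w")
    case True
    then show ?thesis using Cons by (auto intro: del_by.drop)
  next
    case False
    then obtain v where "u = x # v" "subseq v w" using Cons.prems(1)
      by (cases u) (auto simp: subseq_Cons2_iff split: if_splits)
    then show ?thesis using Cons by (auto intro: del_by.keep)
  qed
qed

section \<open>Automata for ideals and their complements\<close>

text \<open>The branches are those of \<open>Cons_in_ideal_lang\<close>. A letter that fits neither
  part of the first factor abandons that factor, and with no factor left the run falls into the
  sink.\<close>

fun ideal_next :: "ideal_expr \<Rightarrow> nat \<Rightarrow> nat" where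
  "ideal_next [] x = 0"
| "ideal_next (p # J) x = (if x \<in> set (fst p) then Suc (enc (p # J))
     else if x = snd p then Suc (enc J) else ideal_next J x)"

fun ideal_states :: "ideal_expr \<Rightarrow> nat list" where
  "ideal_states [] = [Suc (enc ([] :: ideal_expr))]"
| "ideal_states (p # J) = Suc (enc (p # J)) # ideal_states J"

fun ideal_trans :: "nat list \<Rightarrow> ideal_expr \<Rightarrow> (nat \<times> nat \<times> nat) list" where
  "ideal_trans A [] = map (\<lambda>x. (Suc (enc ([] :: ideal_expr)), x, 0)) A"
| "ideal_trans A (p # J) = map (\<lambda>x. (Suc (enc (p # J)), x, ideal_next (p # J) x)) A @ ideal_trans A J"

text \<open>The greedy automaton: the state \<open>Suc (enc J)\<close> stands for the suffix \<open>J\<close> of an ideal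
  expression that remains to be matched, and \<open>0\<close> is the rejecting sink.\<close>

definition ideals_trans :: "nat list \<Rightarrow> ideal_expr list \<Rightarrow> (nat \<times> nat \<times> nat) list" where
  "ideals_trans A Js = map (\<lambda>x. (0, x, 0)) A @ concat (map (\<lambda>J. ideal_trans A J) Js)"

text \<open>All suffix states are final because every ideal contains the empty word; rejection
  happens only in the sink.\<close>

definition ideals_nfa :: "nat list \<Rightarrow> ideal_expr list \<Rightarrow> nfa_expr" where
  "ideals_nfa A Js = (map (\<lambda>J. Suc (enc J)) Js, ideals_trans A Js, concat (map (\<lambda>J. ideal_states J) Js))"

text \<open>Complementation by exchanging final states: from the start state every word over
  \<open>A\<close> has a run, and whether it ends in the sink depends only on the word.\<close>

definition coideal_nfa :: "nat list \<Rightarrow> ideal_expr \<Rightarrow> nfa_expr" where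
  "coideal_nfa A J = ([Suc (enc J)], ideals_trans A [J], [0])"

definition state_accepts :: "nat \<Rightarrow> word \<Rightarrow> bool" where
  "state_accepts q w \<longleftrightarrow> (\<exists>J. q = Suc (enc J) \<and> w \<in> ideal_lang J)"

lemma state_accepts_simps [simp]:
  "\<not> state_accepts 0 w" "state_accepts (Suc (enc J)) w \<longleftrightarrow> w \<in> ideal_lang J"
  by (auto simp: state_accepts_def)

lemma state_accepts_Nil: "state_accepts q [] \<longleftrightarrow> q \<noteq> 0"
proof (cases q)
  case (Suc n)
  then have "q = Suc (enc (dec n :: ideal_expr))" by simp
  then show ?thesis by (simp only: state_accepts_simps) simp
qed simp

lemma ideal_next_correct: "x # w \<in> ideal_lang J \<longleftrightarrow> state_accepts (ideal_next J x) w"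
proof (induction J)
  case (Cons p J)
  then show ?case by (cases p) (simp del: ideal_lang.simps)
qed simp

lemma ideal_trans_step: "(p, x, q) \<in> set (ideal_trans A J) \<Longrightarrow> x \<in> set A \<and> (\<exists>K. p = Suc (enc K) \<and> q = ideal_next K x)"
proof (induction J)
  case (Cons p J)
  then show ?case by (auto simp del: ideal_next.simps)
qed (auto intro!: exI[of _ "[]"])

lemma ideals_trans_step:
  assumes "(p, x, q) \<in> set (ideals_trans A Js)"
  shows "x \<in> set A" "state_accepts p (x # w) \<longleftrightarrow> state_accepts q w"
proof -
  from assms consider "x \<in> set A" "p = 0" "q = 0"
    | J where "(p, x, q) \<in> set (ideal_trans A J)"
    unfolding ideals_trans_def by auto
  then have "x \<in> set A \<and> (state_accepts p (x # w) \<longleftrightarrow> state_accepts q w)"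
    by cases (auto dest!: ideal_trans_step simp: ideal_next_correct)
  then show "x \<in> set A" "state_accepts p (x # w) \<longleftrightarrow> state_accepts q w" by simp_all
qed

text \<open>Each transition preserves \<open>state_accepts\<close> in both directions. The
  equivalence serves acceptance by suffix states as well as acceptance by the sink.\<close>

lemma ideals_run_sound:
  assumes "run M p w q" "trans M = ideals_trans A Js"
  shows "w \<in> lists (set A) \<and> (state_accepts p w \<longleftrightarrow> q \<noteq> 0)"
  using assms
proof (induction rule: run.induct)
  case (run_step p a q w r)
  then have "(p, a, q) \<in> set (ideals_trans A Js)" by simp
  from ideals_trans_step[OF this] show ?case using run_step by simp
qed (simp add: state_accepts_Nil)

lemma ideal_states_next:
  assumes "q \<in> set (ideal_states J)" "x \<in> set A"
  shows "\<exists>r. (q, x, r) \<in> set (ideal_trans A J) \<and> (r = 0 \<or> r \<in> set (ideal_states J))"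
  using assms(1)
proof (induction J)
  case Nil
  then show ?case using assms(2) by auto
next
  case (Cons p J)
  have head: "Suc (enc K) \<in> set (ideal_states K)" for K by (cases K) auto
  have next_states: "ideal_next K x = 0 \<or> ideal_next K x \<in> set (ideal_states K)" for K
    by (induction K) (auto simp: head)
  show ?case
  proof (cases "q = Suc (enc (p # J))")
    case True
    then have "(q, x, ideal_next (p # J) x) \<in> set (ideal_trans A (p # J))" using assms(2) by auto
    then show ?thesis using next_states by blast
  next
    case False
    then show ?thesis using Cons by auto
  qed
qed

lemma ideals_run_complete:
  assumes "w \<in> lists (set A)" "J \<in> set Js" "q = 0 \<or> q \<in> set (ideal_states J)" "trans M = ideals_trans A Js"
  shows "\<exists>r. (r = 0 \<or> r \<in> set (ideal_states J)) \<and> run M q w r"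
  using assms(3,1)
proof (induction w arbitrary: q)
  case Nil
  then show ?case by auto
next
  case (Cons x w)
  then have x: "x \<in> set A" by simp
  have "\<exists>r. (q, x, r) \<in> set (ideals_trans A Js) \<and> (r = 0 \<or> r \<in> set (ideal_states J))"
  proof (cases "q = 0")
    case True
    then show ?thesis using x by (auto simp: ideals_trans_def)
  next
    case False
    then obtain r where "(q, x, r) \<in> set (ideal_trans A J)" "r = 0 \<or> r \<in> set (ideal_states J)"
      using ideal_states_next[OF _ x] Cons.prems(1) by blast
    then show ?thesis using assms(2) by (auto simp: ideals_trans_def)
  qed
  then obtain r where r: "(q, x, r) \<in> set (trans M)" "r = 0 \<or> r \<in> set (ideal_states J)"
    using assms(4) by auto
  then obtain s where "s = 0 \<or> s \<in> set (ideal_states J)" "run M r w s"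
    using Cons.IH[OF r(2)] Cons.prems(2) by auto
  then show ?case using r(1) by (auto intro: run_step)
qed

lemma ideal_states_head: "Suc (enc J) \<in> set (ideal_states J)"
  by (cases J) auto

lemma ideal_states_nonzero: "0 \<notin> set (ideal_states J)"
  by (induction J) auto

lemma ideals_nfa_lang:
  "nfa_expr_lang (ideals_nfa A Js) = lists (set A) \<inter> (\<Union>J\<in>set Js. ideal_lang J)" (is "_ = ?R")
proof (intro equalityI subsetI)
  let ?M = "NFA (fst (ideals_nfa A Js)) (fst (snd (ideals_nfa A Js))) (snd (snd (ideals_nfa A Js)))"
  have tr: "trans ?M = ideals_trans A Js" by (simp add: ideals_nfa_def)
  fix w
  show "w \<in> ?R" if "w \<in> nfa_expr_lang (ideals_nfa A Js)"
  proof -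
    obtain p q where pq: "p \<in> set (init ?M)" "q \<in> set (final ?M)" "run ?M p w q"
      using \<open>w \<in> nfa_expr_lang (ideals_nfa A Js)\<close> unfolding nfa_expr_lang_def nfa_lang_def by blast
    have "q \<noteq> 0"
    proof
      assume "q = 0"
      then show False using pq(2) ideal_states_nonzero by (auto simp: ideals_nfa_def)
    qed
    then have "w \<in> lists (set A)" "state_accepts p w" using ideals_run_sound[OF pq(3) tr] by auto
    then show ?thesis using pq(1) by (auto simp: ideals_nfa_def)
  qed
  show "w \<in> nfa_expr_lang (ideals_nfa A Js)" if "w \<in> ?R"
  proof -
    obtain J where J: "J \<in> set Js" "w \<in> ideal_lang J" and w: "w \<in> lists (set A)" using \<open>w \<in> ?R\<close> by blast
    obtain r where r: "r = 0 \<or> r \<in> set (ideal_states J)" "run ?M (Suc (enc J)) w r"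
      using ideals_run_complete[OF w J(1) _ tr] ideal_states_head by blast
    have "r \<noteq> 0" using ideals_run_sound[OF r(2) tr] J(2) by simp
    then have "r \<in> set (final ?M)" using r(1) J(1) by (auto simp: ideals_nfa_def)
    moreover have "Suc (enc J) \<in> set (init ?M)" using J(1) by (simp add: ideals_nfa_def)
    ultimately show ?thesis using r(2) unfolding nfa_expr_lang_def nfa_lang_def by blast
  qed
qed

lemma coideal_nfa_lang: "nfa_expr_lang (coideal_nfa A J) = lists (set A) - ideal_lang J" (is "_ = ?R")
proof (intro equalityI subsetI)
  let ?M = "NFA (fst (coideal_nfa A J)) (fst (snd (coideal_nfa A J))) (snd (snd (coideal_nfa A J)))"
  have tr: "trans ?M = ideals_trans A [J]" by (simp add: coideal_nfa_def)
  fix w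
  show "w \<in> ?R" if "w \<in> nfa_expr_lang (coideal_nfa A J)"
  proof -
    have "run ?M (Suc (enc J)) w 0"
      using that unfolding nfa_expr_lang_def nfa_lang_def by (auto simp: coideal_nfa_def)
    from ideals_run_sound[OF this tr] show ?thesis by simp
  qed
  show "w \<in> nfa_expr_lang (coideal_nfa A J)" if w: "w \<in> ?R"
  proof -
    obtain r where r: "run ?M (Suc (enc J)) w r"
      using ideals_run_complete[OF _ _ _ tr, of w J "Suc (enc J)"] ideal_states_head w by auto
    have "r = 0" using ideals_run_sound[OF r tr] w by simp
    then show ?thesis using r unfolding nfa_expr_lang_def nfa_lang_def by (auto simp: coideal_nfa_def)
  qed
qed

section \<open>Automata for upward closures and for the languages of pumped words\<close>

text \<open>Insertion of letters is a loop at every state that a run can visit: the initial states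
  and the targets of transitions.\<close>

definition upclose_nfa :: "nat list \<Rightarrow> nfa_expr \<Rightarrow> nfa_expr" where
  "upclose_nfa A M = (fst M, fst (snd M) @ concat (map (\<lambda>s. map (\<lambda>x. (s, x, s)) A)
     (fst M @ map (\<lambda>t. snd (snd t)) (fst (snd M)))), snd (snd M))"

lemma upclose_nfa_lang: "nfa_expr_lang (upclose_nfa A M) = upclose (set A) (nfa_expr_lang M)"
proof -
  obtain i t f where M: "M = (i, t, f)" by (cases M) auto
  define S where "S = i @ map (\<lambda>t. snd (snd t)) t"
  define N where "N = NFA i t f"
  define N' where "N' = NFA i (t @ concat (map (\<lambda>s. map (\<lambda>x. (s, x, s)) A) S)) f"
  have sound: "\<exists>u. run N p u q \<and> del_by (set A) u w" if "run N' p w q" for p w q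
    using that
  proof (induction rule: run.induct)
    case (run_nil p)
    then show ?case by (auto intro: exI[of _ "[]"] del_by.nil)
  next
    case (run_step p a q w r)
    then obtain u where u: "run N q u r" "del_by (set A) u w" by blast
    from run_step.hyps(1) consider "(p, a, q) \<in> set t" | "p = q" "a \<in> set A" by (auto simp: N'_def)
    then show ?case
    proof cases
      case 1
      then have "run N p (a # u) r" using u(1) by (auto simp: N_def intro: run.run_step)
      then show ?thesis using u(2) del_by.keep by blast
    next
      case 2
      then show ?thesis using u del_by.drop by blast
    qed
  qed
  have complete: "run N' p w q" if "del_by (set A) u w" "run N p u q" "p \<in> set S" for p u w q
    using that
  proof (induction arbitrary: p rule: del_by.induct)
    case (keep u w a)
    then obtain r where r: "(p, a, r) \<in> set t" "run N r u q" by (auto simp: run_Cons_iff N_def)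
    then have "r \<in> set S" by (force simp: S_def)
    then show ?case using keep.IH[OF r(2)] r(1) by (auto simp: N'_def intro: run_step)
  next
    case (drop b u w)
    then have "(p, b, p) \<in> set (trans N')" by (auto simp: N'_def)
    then show ?case using drop by (auto intro: run_step)
  qed auto
  have "nfa_lang N' = upclose (set A) (nfa_lang N)"
  proof (intro equalityI subsetI)
    fix w assume "w \<in> nfa_lang N'"
    then show "w \<in> upclose (set A) (nfa_lang N)"
      using sound unfolding nfa_lang_def upclose_def by (fastforce simp: N_def N'_def)
  next
    fix w assume "w \<in> upclose (set A) (nfa_lang N)"
    then obtain u p q where "del_by (set A) u w" "run N p u q" "p \<in> set i" "q \<in> set f"
      unfolding nfa_lang_def upclose_def by (auto simp: N_def)
    then show "w \<in> nfa_lang N'" using complete[of u w p q]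
      unfolding nfa_lang_def by (auto simp: N'_def S_def)
  qed
  then show ?thesis by (simp add: nfa_expr_lang_def upclose_nfa_def M N_def N'_def S_def)
qed

section \<open>Automata for products of loops with exit letters\<close>

type_synonym cycle_expr = "(nat list \<times> nat \<times> nat) list"

text \<open>A factor stands for the words \<open>(u z)^k a\<close>. The separate last letter
  \<open>z\<close> keeps the loop nonempty, so no silent transition is needed; it will be a marker,
  the second letter of an alternation, or a letter to be counted.\<close>

fun cycle_lang :: "cycle_expr \<Rightarrow> lang" where
  "cycle_lang [] = {[]}"
| "cycle_lang ((u, z, a) # ts) = {concat (replicate k (u @ [z])) @ a # w |k w. w \<in> cycle_lang ts}"

text \<open>States are codes of pairs \<open>(v, T)\<close>: \<open>T\<close> lists the factors
  still to be read, including the current one, and \<open>v\<close> is the part of its loop word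
  left before \<open>z\<close>. The exit letter can be read exactly when \<open>v\<close> is the
  whole loop word.\<close>

definition cycle_start :: "cycle_expr \<Rightarrow> nat" where
  "cycle_start ts = enc (case ts of [] \<Rightarrow> [] | t # ts' \<Rightarrow> fst t, ts)"

fun block_trans :: "cycle_expr \<Rightarrow> nat list \<Rightarrow> (nat \<times> nat \<times> nat) list" where
  "block_trans T [] = []"
| "block_trans T (x # v) = (enc (x # v, T), x, enc (v, T)) # block_trans T v"

fun cycle_trans :: "cycle_expr \<Rightarrow> (nat \<times> nat \<times> nat) list" where
  "cycle_trans [] = []"
| "cycle_trans (t # ts) = block_trans (t # ts) (fst t) @
     [(enc ([] :: nat list, t # ts), fst (snd t), enc (fst t, t # ts)),
      (enc (fst t, t # ts), snd (snd t), cycle_start ts)] @ cycle_trans ts"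

definition cycle_nfa :: "cycle_expr \<Rightarrow> nfa_expr" where
  "cycle_nfa ts = ([cycle_start ts], cycle_trans ts, [enc ([] :: nat list, [] :: cycle_expr)])"

text \<open>The strict length bound records that the target is not the start of the loop, where the
  exit letter would be available.\<close>

lemma block_trans_step:
  "(p, x, q) \<in> set (block_trans T v) \<Longrightarrow>
    \<exists>v'. p = enc (x # v', T) \<and> q = enc (v', T) \<and> length v' < length v"
  by (induction v) (auto simp: less_Suc_eq simp del: enc_Pair)

lemma cycle_trans_step:
  assumes "(p, x, q) \<in> set (cycle_trans ts0)"
  shows "\<exists>v u z a ts. p = enc (v, (u, z, a) # ts) \<and>
    ((\<exists>v'. v = x # v' \<and> length v' < length u \<and> q = enc (v', (u, z, a) # ts)) \<or>
     (v = [] \<and> x = z \<and> q = enc (u, (u, z, a) # ts)) \<or> (v = u \<and> x = a \<and> q = cycle_start ts))"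
  using assms
proof (induction ts0)
  case (Cons t ts)
  obtain u z a where t: "t = (u, z, a)" by (cases t) auto
  from Cons.prems consider "(p, x, q) \<in> set (block_trans (t # ts) u)"
    | "p = enc ([] :: nat list, t # ts)" "x = z" "q = enc (u, t # ts)"
    | "p = enc (u, t # ts)" "x = a" "q = cycle_start ts"
    | "(p, x, q) \<in> set (cycle_trans ts)"
    by (auto simp: t)
  then show ?case
  proof cases
    case 1
    then obtain v' where "p = enc (x # v', t # ts)" "q = enc (v', t # ts)" "length v' < length u"
      using block_trans_step by blast
    then show ?thesis unfolding t by blast
  next
    case 2
    then show ?thesis unfolding t by blast
  next
    case 3
    then show ?thesis unfolding t by blast
  next
    case 4
    then show ?thesis by (rule Cons.IH)
  qed
qed simp

fun cycle_state_lang :: "nat list \<Rightarrow> cycle_expr \<Rightarrow> lang" where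
  "cycle_state_lang v [] = {[]}"
| "cycle_state_lang v ((u, z, a) # ts) = {v @ z # x |x. x \<in> cycle_lang ((u, z, a) # ts)} \<union>
     (if v = u then {a # x |x. x \<in> cycle_lang ts} else {})"

lemma cycle_state_lang_start: "cycle_state_lang u ((u, z, a) # ts) \<subseteq> cycle_lang ((u, z, a) # ts)"
proof
  fix w assume "w \<in> cycle_state_lang u ((u, z, a) # ts)"
  then consider x where "w = u @ z # x" "x \<in> cycle_lang ((u, z, a) # ts)"
    | x where "w = a # x" "x \<in> cycle_lang ts" by auto
  then show "w \<in> cycle_lang ((u, z, a) # ts)"
  proof cases
    case 1
    then obtain k y where "x = concat (replicate k (u @ [z])) @ a # y" "y \<in> cycle_lang ts" by auto
    then show ?thesis using 1(1) by (auto intro!: exI[of _ "Suc k"] exI[of _ y])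
  next
    case 2
    then show ?thesis by (auto intro!: exI[of _ 0])
  qed
qed

lemma cycle_state_lang_cycle_start:
  "cycle_start ts = enc (v, T) \<Longrightarrow> cycle_state_lang v T \<subseteq> cycle_lang ts"
  by (cases ts) (auto simp: cycle_start_def simp del: enc_Pair enc_nat_list cycle_lang.simps(2)
      cycle_state_lang.simps(2) intro: subsetD[OF cycle_state_lang_start])

lemma cycle_run_sound:
  assumes "run M p w q" "set (trans M) \<subseteq> set (cycle_trans ts0)" "q = enc ([] :: nat list, [] :: cycle_expr)"
  shows "\<exists>v T. p = enc (v, T) \<and> w \<in> cycle_state_lang v T"
  using assms
proof (induction rule: run.induct)
  case (run_nil p)
  then show ?case by (intro exI[of _ "[]"]) simp
next
  case (run_step p x q w r)
  then obtain v' T where IH: "q = enc (v', T)" "w \<in> cycle_state_lang v' T" by blast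
  have "(p, x, q) \<in> set (cycle_trans ts0)" using run_step by blast
  from cycle_trans_step[OF this] obtain v u z a ts where p: "p = enc (v, (u, z, a) # ts)"
    and c: "(\<exists>v'. v = x # v' \<and> length v' < length u \<and> q = enc (v', (u, z, a) # ts)) \<or>
     (v = [] \<and> x = z \<and> q = enc (u, (u, z, a) # ts)) \<or> (v = u \<and> x = a \<and> q = cycle_start ts)"
    by blast
  from c consider "v = x # v'" "length v' < length u" "T = (u, z, a) # ts"
    | "v = []" "x = z" "v' = u" "T = (u, z, a) # ts"
    | "v = u" "x = a" "q = cycle_start ts"
    unfolding IH(1) enc_eq_iff prod.inject by blast
  then have "x # w \<in> cycle_state_lang v ((u, z, a) # ts)"
  proof cases
    case 1
    \<comment> \<open>The strict length bound excludes \<open>v' = u\<close>, so \<open>w\<close>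
      must complete the current round of the loop.\<close>
    then show ?thesis using IH(2) by (auto split: if_splits)
  next
    case 2
    then have "w \<in> cycle_lang ((u, z, a) # ts)" using IH(2) subsetD[OF cycle_state_lang_start] by blast
    then show ?thesis using 2 by (auto simp del: cycle_lang.simps)
  next
    case 3
    then have "w \<in> cycle_lang ts" using cycle_state_lang_cycle_start[of ts v' T] IH by auto
    then show ?thesis using 3 by simp
  qed
  then show ?case using p by blast
qed

lemma block_run:
  "set (block_trans T v) \<subseteq> set (trans M) \<Longrightarrow> run M (enc (v, T)) v (enc ([] :: nat list, T))"
  by (induction v) (auto simp: run_Cons_iff simp del: enc_Pair)

lemma cycle_run_complete:
  "w \<in> cycle_lang ts \<Longrightarrow> set (cycle_trans ts) \<subseteq> set (trans M) \<Longrightarrow>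
    run M (cycle_start ts) w (enc ([] :: nat list, [] :: cycle_expr))"
proof (induction ts arbitrary: w)
  case Nil
  then show ?case by (simp add: cycle_start_def)
next
  case (Cons t ts)
  obtain u z a where t: "t = (u, z, a)" by (cases t) auto
  obtain k x where w: "w = concat (replicate k (u @ [z])) @ a # x" "x \<in> cycle_lang ts"
    using Cons.prems(1) by (auto simp: t)
  define s where "s = enc (u, t # ts)"
  have "run M s u (enc ([] :: nat list, t # ts))"
    using Cons.prems(2) unfolding s_def by (intro block_run) (auto simp: t)
  moreover have "run M (enc ([] :: nat list, t # ts)) [z] s"
    using Cons.prems(2) by (auto simp: s_def t run_Cons_iff)
  ultimately have loop: "run M s (u @ [z]) s" by (rule run_append)
  have "run M s (concat (replicate k (u @ [z]))) s"
    by (induction k) (auto simp del: append_assoc intro: run_append[OF loop])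
  moreover have "run M s (a # x) (enc ([] :: nat list, [] :: cycle_expr))"
    using Cons.prems(2) Cons.IH[OF w(2)] by (auto simp: s_def t run_Cons_iff)
  ultimately have "run M s w (enc ([] :: nat list, [] :: cycle_expr))"
    unfolding w(1) by (rule run_append)
  then show ?case by (simp add: s_def cycle_start_def t)
qed

lemma cycle_nfa_lang: "nfa_expr_lang (cycle_nfa ts) = cycle_lang ts"
proof (intro equalityI subsetI)
  let ?M = "NFA [cycle_start ts] (cycle_trans ts) [enc ([] :: nat list, [] :: cycle_expr)]"
  fix w
  show "w \<in> cycle_lang ts" if "w \<in> nfa_expr_lang (cycle_nfa ts)"
  proof -
    have "run ?M (cycle_start ts) w (enc ([] :: nat list, [] :: cycle_expr))"
      using that by (auto simp: nfa_expr_lang_def nfa_lang_def cycle_nfa_def)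
    from cycle_run_sound[OF this, of ts] obtain v T
      where "cycle_start ts = enc (v, T)" "w \<in> cycle_state_lang v T" by auto
    then show ?thesis using cycle_state_lang_cycle_start by blast
  qed
  show "w \<in> nfa_expr_lang (cycle_nfa ts)" if "w \<in> cycle_lang ts"
    using cycle_run_complete[OF that, of ?M]
    by (auto simp: nfa_expr_lang_def nfa_lang_def cycle_nfa_def)
qed

section \<open>Deleting and inserting letters from two disjoint sources\<close>

lemma del_by_filter:
  assumes "del_by B u w" "\<And>b. b \<in> B \<Longrightarrow> \<not> P b" shows "filter P u = filter P w"
  using assms by (induction rule: del_by.induct) auto

lemma del_by_filter_not: "del_by B (filter (\<lambda>x. x \<notin> B) w) w"
  by (induction w) (auto intro: del_by.intros)

lemma del_by_refl: "del_by B w w"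
  by (induction w) (auto intro: del_by.intros)

text \<open>Merging \<open>y\<close> and \<open>v\<close> from the left: a letter of
  \<open>Z\<close> is taken from \<open>y\<close>, equal heads are taken together, and otherwise the
  head of \<open>v\<close> is inserted. The merged word witnesses both upward closures, so a marked
  pumped word can be realised on top of a given word of a language.\<close>

lemma subseq_del_by_amalgam:
  assumes "subseq (filter (\<lambda>x. x \<notin> Z) y) v" "set v \<subseteq> A"
  shows "\<exists>x. del_by A y x \<and> del_by Z v x"
  using assms
proof (induction "length y + length v" arbitrary: y v rule: less_induct)
  case less
  show ?case
  proof (cases y)
    case Nil
    then have "del_by A y v" using less.prems by (auto intro: subseq_del_by)
    then show ?thesis using del_by_refl by blast
  next
    case (Cons b y')
    show ?thesis
    proof (cases "b \<in> Z")
      case True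
      then obtain x where "del_by A y' x" "del_by Z v x" using less Cons by fastforce
      then show ?thesis using True Cons by (blast intro: del_by.keep del_by.drop)
    next
      case False
      then obtain c v' where v: "v = c # v'" using less.prems(1) Cons by (cases v) auto
      show ?thesis
      proof (cases "b = c")
        case True
        then have "subseq (filter (\<lambda>x. x \<notin> Z) y') v'" using less.prems(1) False by (simp add: v Cons)
        then obtain x where "del_by A y' x" "del_by Z v' x" using less.hyps[of y' v'] less.prems(2) v Cons by auto
        then show ?thesis unfolding v Cons True by (blast intro: del_by.keep)
      next
        case neq: False
        then have "subseq (filter (\<lambda>x. x \<notin> Z) y) v'" using less.prems(1) False by (simp add: v Cons)
        then obtain x where "del_by A y x" "del_by Z v' x" using less.hyps[of y v'] less.prems(2) v by auto
        moreover have "c \<in> A" using less.prems(2) v by simp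
        ultimately show ?thesis unfolding v by (blast intro: del_by.keep del_by.drop)
      qed
    qed
  qed
qed

section \<open>Words of bounded languages and their exponents\<close>

definition blocks :: "nat list \<Rightarrow> nat list \<Rightarrow> word" where
  "blocks bs ks = concat (map (\<lambda>(b, k). replicate k b) (zip bs ks))"

lemma blocks_simps [simp]: "blocks [] ks = []" "blocks (b # bs) (k # ks) = replicate k b @ blocks bs ks"
  by (simp_all add: blocks_def)

lemma bounded_lang_blocks: "bounded_lang bs = {blocks bs ks |ks. length ks = length bs}"
  by (simp add: bounded_lang_def blocks_def)

lemma set_blocks: "set (blocks bs ks) \<subseteq> set bs"
  by (auto simp: blocks_def dest: set_zip_leftD split: if_splits)

lemma count_blocks_ge_iff:
  assumes "length ks = length bs" "distinct bs"
  shows "(\<forall>b\<in>set bs. m \<le> count_list (blocks bs ks) b) \<longleftrightarrow> (\<forall>k\<in>set ks. m \<le> k)"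
  using assms
proof (induction ks bs rule: list_induct2)
  case (Cons k ks b bs)
  have rep: "count_list (replicate k b) c = (if c = b then k else 0)" for c by (induction k) auto
  have "count_list (blocks bs ks) b = 0" using Cons.prems set_blocks[of bs ks] by (auto simp: count_list_0_iff)
  moreover have "b \<noteq> c" if "c \<in> set bs" for c using that Cons.prems by auto
  ultimately show ?case using Cons by (auto simp: rep)
qed simp

lemma diagonal_blocks_iff:
  assumes "distinct bs" "L = {blocks bs ks |ks. length ks = length bs \<and> P ks}"
  shows "diagonal (set bs) L \<longleftrightarrow> (\<forall>m. \<exists>ks. length ks = length bs \<and> (\<forall>k\<in>set ks. m \<le> k) \<and> P ks)"
proof -
  have "(\<exists>w\<in>L. \<forall>b\<in>set bs. m \<le> count_list w b) \<longleftrightarrow>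
      (\<exists>ks. length ks = length bs \<and> (\<forall>k\<in>set ks. m \<le> k) \<and> P ks)" for m
    unfolding assms(2) using count_blocks_ge_iff[OF _ assms(1)] by blast
  then show ?thesis unfolding diagonal_def by simp
qed

text \<open>The loop \<open>u z\<close> becomes the letter list of a star factor. The words of
  \<open>cycle_lang\<close> are then exactly the pumped words of this ideal, which connects the
  automata with cofinality.\<close>

definition cycle_ideal :: "cycle_expr \<Rightarrow> ideal_expr" where
  "cycle_ideal ts = map (\<lambda>(u, z, a). (u @ [z], a)) ts"

lemma cycle_lang_pump: "cycle_lang ts = {pump ks (cycle_ideal ts) |ks. length ks = length ts}"
proof (induction ts)
  case (Cons t ts)
  obtain u z a where t: "t = (u, z, a)" by (cases t) auto
  show ?case
  proof (intro equalityI subsetI)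
    fix w assume "w \<in> cycle_lang (t # ts)"
    then obtain k ks where "w = concat (replicate k (u @ [z])) @ a # pump ks (cycle_ideal ts)"
      "length ks = length ts" using Cons.IH by (auto simp: t)
    then show "w \<in> {pump ks (cycle_ideal (t # ts)) |ks. length ks = length (t # ts)}"
      by (auto simp: t cycle_ideal_def intro!: exI[of _ "k # ks"])
  next
    fix w assume "w \<in> {pump ks (cycle_ideal (t # ts)) |ks. length ks = length (t # ts)}"
    then obtain k ks where "w = pump (k # ks) (cycle_ideal (t # ts))" "length ks = length ts"
      by (auto simp: length_Suc_conv)
    then show "w \<in> cycle_lang (t # ts)" using Cons.IH by (auto simp: t cycle_ideal_def)
  qed
qed (simp add: cycle_ideal_def)

section \<open>Testing ideals with the simultaneous unboundedness problem\<close>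

text \<open>The loop of the \<open>i\<close>-th factor gets its own marker \<open>N + i\<close> (counted from the right), whose
  occurrences count the iterations.\<close>

fun mark :: "nat \<Rightarrow> ideal_expr \<Rightarrow> cycle_expr" where
  "mark N [] = []"
| "mark N (p # J) = (fst p, N + length J, snd p) # mark N J"

fun markers :: "nat \<Rightarrow> ideal_expr \<Rightarrow> nat list" where
  "markers N [] = []"
| "markers N (p # J) = (N + length J) # markers N J"

fun ideal_letters :: "ideal_expr \<Rightarrow> nat list" where
  "ideal_letters [] = []"
| "ideal_letters (p # J) = snd p # fst p @ ideal_letters J"

lemma length_mark [simp]: "length (mark N J) = length J" by (induction J) auto
lemma length_markers [simp]: "length (markers N J) = length J" by (induction J) auto

lemma set_markers: "set (markers N J) = {N..<N + length J}"
  by (induction J) auto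

lemma distinct_markers: "distinct (markers N J)"
  by (induction J) (auto simp: set_markers)

lemma filter_concat_replicate: "filter P (concat (replicate k u)) = concat (replicate k (filter P u))"
  by (induction k) auto

lemma concat_replicate_singleton: "concat (replicate k [x]) = replicate k x"
  by (induction k) auto

lemma pump_mark_filter:
  assumes "length ks = length J" "\<forall>x\<in>set (ideal_letters J). x < N"
  shows "filter (\<lambda>x. x < N) (pump ks (cycle_ideal (mark N J))) = pump ks J"
    and "filter (\<lambda>x. \<not> x < N) (pump ks (cycle_ideal (mark N J))) = blocks (markers N J) ks"
proof -
  have "filter (\<lambda>x. x < N) (pump ks (cycle_ideal (mark N J))) = pump ks J \<and>
    filter (\<lambda>x. \<not> x < N) (pump ks (cycle_ideal (mark N J))) = blocks (markers N J) ks"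
    using assms
  proof (induction ks J rule: list_induct2)
    case (Cons k ks p J)
    obtain B a where p: "p = (B, a)" by (cases p) auto
    have "filter (\<lambda>x. x < N) B = B" "filter (\<lambda>x. \<not> x < N) B = []"
      using Cons.prems by (auto simp: p filter_empty_conv intro!: filter_True)
    then show ?case using Cons
      by (auto simp: p cycle_ideal_def filter_concat_replicate concat_replicate_singleton)
  qed (simp add: cycle_ideal_def)
  then show "filter (\<lambda>x. x < N) (pump ks (cycle_ideal (mark N J))) = pump ks J"
    "filter (\<lambda>x. \<not> x < N) (pump ks (cycle_ideal (mark N J))) = blocks (markers N J) ks" by simp_all
qed

text \<open>A word \<open>x\<close> of the intersection is some \<open>v\<close> in \<open>L\<close>
  with markers inserted, and also a marked pumped word with letters of \<open>A\<close> inserted.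
  Markers exceed all letters, so deleting them embeds \<open>pump ks J\<close> into
  \<open>v\<close>, while projecting to them leaves the exponents \<open>ks\<close>. The converse
  builds \<open>x\<close> by amalgamation.\<close>

lemma marked_lang:
  assumes L: "L \<subseteq> lists (set A)" and N: "\<forall>x\<in>set A. x < N" "\<forall>x\<in>set (ideal_letters J). x < N"
  shows "proj (set (markers N J)) ` (upclose (set (markers N J)) L \<inter> upclose (set A) (cycle_lang (mark N J)))
    = {blocks (markers N J) ks |ks. length ks = length (markers N J) \<and> pump ks J \<in> downclose L}"
    (is "proj ?Z ` ?S = ?T")
proof (intro equalityI subsetI)
  have Z: "x \<in> ?Z \<Longrightarrow> \<not> x < N" for x by (simp add: set_markers)
  fix t assume "t \<in> proj ?Z ` ?S"
  then obtain x v y where t: "t = proj ?Z x" and v: "v \<in> L" "del_by ?Z v x"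
    and y: "y \<in> cycle_lang (mark N J)" "del_by (set A) y x"
    unfolding upclose_def by blast
  obtain ks where ks: "length ks = length J" "y = pump ks (cycle_ideal (mark N J))"
    using y(1) unfolding cycle_lang_pump by auto
  note flt = pump_mark_filter[OF ks(1) N(2), folded ks(2)]
  have "filter (\<lambda>x. x \<in> ?Z) y = filter (\<lambda>x. \<not> x < N) y"
  proof (rule filter_cong[OF refl])
    fix z assume "z \<in> set y"
    then have "\<not> z < N \<Longrightarrow> z \<in> set (filter (\<lambda>x. \<not> x < N) y)" by simp
    then have "\<not> z < N \<Longrightarrow> z \<in> ?Z" unfolding flt(2) using set_blocks by blast
    then show "z \<in> ?Z \<longleftrightarrow> \<not> z < N" using Z by blast
  qed
  moreover have "proj ?Z x = filter (\<lambda>x. x \<in> ?Z) y"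
    unfolding proj_def by (rule del_by_filter[symmetric, OF y(2)]) (use N(1) Z in blast)
  ultimately have "t = blocks (markers N J) ks" using t flt(2) by simp
  moreover have "subseq (filter (\<lambda>x. x < N) y) (filter (\<lambda>x. x < N) x)"
    using del_by_subseq[OF y(2)] by simp
  moreover have "filter (\<lambda>x. x < N) x = v"
  proof -
    have "filter (\<lambda>x. x < N) v = v" using v(1) L N(1) by (intro filter_True) auto
    moreover have "filter (\<lambda>x. x < N) v = filter (\<lambda>x. x < N) x" by (rule del_by_filter[OF v(2)]) (rule Z)
    ultimately show ?thesis by simp
  qed
  ultimately show "t \<in> ?T" using ks(1) v(1) flt(1) unfolding downclose_def by auto
next
  have Z: "x \<in> ?Z \<Longrightarrow> \<not> x < N" for x by (simp add: set_markers)
  fix t assume "t \<in> ?T"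
  then obtain ks v where ks: "length ks = length J" "t = blocks (markers N J) ks"
    and v: "v \<in> L" "subseq (pump ks J) v" unfolding downclose_def by auto
  define y where "y = pump ks (cycle_ideal (mark N J))"
  have y: "y \<in> cycle_lang (mark N J)" unfolding cycle_lang_pump y_def using ks(1) by auto
  note flt = pump_mark_filter[OF ks(1) N(2), folded y_def]
  have Zy: "z \<in> ?Z \<longleftrightarrow> \<not> z < N" if "z \<in> set y" for z
  proof -
    have "\<not> z < N \<Longrightarrow> z \<in> set (filter (\<lambda>x. \<not> x < N) y)" using that by simp
    then have "\<not> z < N \<Longrightarrow> z \<in> ?Z" unfolding flt(2) using set_blocks by blast
    then show ?thesis using Z by blast
  qed
  then have "filter (\<lambda>x. x \<notin> ?Z) y = filter (\<lambda>x. x < N) y" by (intro filter_cong) auto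
  then have "subseq (filter (\<lambda>x. x \<notin> ?Z) y) v" using flt(1) v(2) by simp
  moreover have "set v \<subseteq> set A" using v(1) L by auto
  ultimately obtain x where x: "del_by (set A) y x" "del_by ?Z v x" using subseq_del_by_amalgam by blast
  then have "x \<in> ?S" using y v(1) unfolding upclose_def by blast
  moreover have "proj ?Z x = filter (\<lambda>x. x \<in> ?Z) y"
    unfolding proj_def by (rule del_by_filter[symmetric, OF x(1)]) (use N(1) Z in blast)
  moreover have "filter (\<lambda>x. x \<in> ?Z) y = filter (\<lambda>x. \<not> x < N) y" using Zy by (intro filter_cong) auto
  ultimately show "t \<in> proj ?Z ` ?S" using ks(2) flt(2) by (metis image_eqI)
qed

lemma marked_lang_diagonal_iff:
  assumes "L \<subseteq> lists (set A)" "\<forall>x\<in>set A. x < N" "\<forall>x\<in>set (ideal_letters J). x < N"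
  shows "diagonal (set (markers N J)) (proj (set (markers N J)) `
      (upclose (set (markers N J)) L \<inter> upclose (set A) (cycle_lang (mark N J))))
    \<longleftrightarrow> ideal_lang J \<subseteq> downclose L"
  unfolding ideal_lang_subset_downclose_iff
  using diagonal_blocks_iff[OF distinct_markers marked_lang[OF assms]] by simp

section \<open>From unboundedness to separability\<close>

lemma conc_lists_optional:
  assumes "a \<in> B" shows "conc (lists B) (conc {[], [a]} S) = conc (lists B) S"
proof -
  have "conc (lists B) {[], [a]} = lists B"
    using assms concI[of x "lists B" "[]" "{[], [a]}" for x] by (auto elim!: concE)
  then show ?thesis by (simp add: conc_assoc[symmetric])
qed

text \<open>The pumped words have a block \<open>(f b g b)^k f b\<close> for each \<open>b\<close>.
  Exchanging \<open>f\<close> and \<open>g\<close> leaves the ideal unchanged but changes the first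
  letter of every block: the two languages share their ideal and differ only in a detail that short
  subwords miss.\<close>

definition alternation :: "(nat \<Rightarrow> nat) \<Rightarrow> (nat \<Rightarrow> nat) \<Rightarrow> nat list \<Rightarrow> cycle_expr" where
  "alternation f g bs = map (\<lambda>b. ([f b], g b, f b)) bs"

lemma alternation_ideal: "cycle_ideal (alternation f g bs) = map (\<lambda>b. ([f b, g b], f b)) bs"
  by (simp add: alternation_def cycle_ideal_def)

lemma length_alternation [simp]: "length (alternation f g bs) = length bs"
  by (simp add: alternation_def)

lemma alternation_ideal_swap:
  "ideal_lang (cycle_ideal (alternation f g bs)) = ideal_lang (cycle_ideal (alternation g f bs))"
  unfolding alternation_ideal
  by (induction bs) (auto simp: conc_lists_optional insert_commute)

lemma filter_alternation:
  assumes "length ks = length bs" "distinct bs" "b \<in> set bs"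
    and "\<And>b'. b' \<in> set bs \<Longrightarrow> b' \<noteq> b \<Longrightarrow> \<not> P (f b') \<and> \<not> P (g b')" "P (f b)" "P (g b)"
  shows "\<exists>k. (b, k) \<in> set (zip bs ks) \<and>
    filter P (pump ks (cycle_ideal (alternation f g bs))) = concat (replicate k [f b, g b]) @ [f b]"
  using assms
proof (induction ks bs rule: list_induct2)
  case (Cons k ks b' bs)
  have none: "filter P (pump ks (cycle_ideal (alternation f g bs))) = []"
    if "length ks = length bs" "\<And>b'. b' \<in> set bs \<Longrightarrow> \<not> P (f b') \<and> \<not> P (g b')" for ks bs
    using that
    by (induction ks bs rule: list_induct2) (auto simp: alternation_ideal filter_concat_replicate)
  show ?case
  proof (cases "b = b'")
    case True
    then have "filter P (pump ks (cycle_ideal (alternation f g bs))) = []"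
      using Cons by (intro none) auto
    then show ?thesis using Cons.prems True
      by (intro exI[of _ k]) (auto simp: alternation_ideal filter_concat_replicate)
  next
    case False
    then obtain k' where "(b, k') \<in> set (zip bs ks)"
      "filter P (pump ks (cycle_ideal (alternation f g bs))) = concat (replicate k' [f b, g b]) @ [f b]"
      using Cons by auto
    then show ?thesis using Cons.prems False
      by (intro exI[of _ k']) (auto simp: alternation_ideal filter_concat_replicate)
  qed
qed simp

text \<open>The filtered word is bounded from both sides: lying below \<open>v\<close> is a downward
  closed condition, having \<open>v\<close> as a subword is a piece, and antisymmetry gives
  equality.\<close>

lemma filter_eq_PT:
  assumes A: "finite A" and v: "set v \<subseteq> A" "filter P v = v"
  shows "{w \<in> lists A. filter P w = v} \<in> PT A"
proof -
  let ?D = "{w \<in> lists A. subseq (filter P w) v}"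
  have "downclosed ?D" unfolding downclosed_def
  proof (intro allI impI CollectI conjI)
    fix u w assume w: "w \<in> ?D" and u: "subseq u w"
    have "w \<in> lists A" and sub: "subseq (filter P w) v" using w by blast+
    show "u \<in> lists A" by (rule downclosedD[OF downclosed_lists \<open>w \<in> lists A\<close> u])
    have "subseq (filter P u) (filter P w)" using u by (rule subseq_filter)
    then show "subseq (filter P u) v" using sub by (rule subseq_order.order_trans)
  qed
  then have "?D \<inter> piece_lang A v \<in> PT A"
    using A v(1) by (intro PT.inter downclosed_PT PT.piece) auto
  moreover have "?D \<inter> piece_lang A v = {w \<in> lists A. filter P w = v}"
  proof (intro equalityI subsetI)
    fix w assume w: "w \<in> ?D \<inter> piece_lang A v"
    then have "w \<in> lists A" "subseq (filter P w) v" "subseq v w" by (simp_all add: piece_lang_def)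
    moreover have "subseq v (filter P w)" using subseq_filter[OF \<open>subseq v w\<close>, of P] v(2) by simp
    ultimately show "w \<in> {w \<in> lists A. filter P w = v}" using subseq_order.antisym by blast
  qed (auto simp: piece_lang_def)
  ultimately show ?thesis by simp
qed

lemma set_pump_alternation: "set (pump ks (cycle_ideal (alternation f g bs))) \<subseteq> f ` set bs \<union> g ` set bs"
proof (induction bs arbitrary: ks)
  case (Cons b bs)
  then show ?case by (cases ks) (force simp: alternation_ideal split: if_splits)+
qed (simp add: alternation_ideal)

text \<open>A block \<open>(b c)^k b\<close> has \<open>k + 1\<close> letters \<open>b\<close>,
  hence the \<open>Suc\<close>. Words with an exponent 0 have no alternating counterpart, which is
  harmless because diagonality concerns large exponents.\<close>

lemma filter_less_alternation:
  assumes "length ks = length bs" "\<forall>b\<in>set bs. b < N"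
  shows "filter (\<lambda>x. x < N) (pump ks (cycle_ideal (alternation (\<lambda>b. b) (\<lambda>b. b + N) bs))) = blocks bs (map Suc ks)"
  using assms
proof (induction ks bs rule: list_induct2)
  case (Cons k ks b bs)
  then show ?case
    by (auto simp: alternation_ideal filter_concat_replicate concat_replicate_singleton replicate_append_same
        simp flip: replicate_Suc)
qed (simp add: alternation_ideal)

lemma alternation_lists:
  "w \<in> cycle_lang (alternation f g bs) \<Longrightarrow> w \<in> lists (f ` set bs \<union> g ` set bs)"
  using set_pump_alternation by (fastforce simp: cycle_lang_pump)

lemma upclose_alternation:
  assumes L: "L \<subseteq> bounded_lang bs" and N: "\<forall>b\<in>set bs. b < N"
  shows "upclose ((\<lambda>b. b + N) ` set bs) L \<inter> cycle_lang (alternation (\<lambda>b. b) (\<lambda>b. b + N) bs)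
    = {pump ks (cycle_ideal (alternation (\<lambda>b. b) (\<lambda>b. b + N) bs)) |ks.
        length ks = length bs \<and> blocks bs (map Suc ks) \<in> L}" (is "?S \<inter> ?T = ?U")
proof (intro equalityI subsetI)
  let ?C = "(\<lambda>b. b + N) ` set bs"
  fix x assume "x \<in> ?S \<inter> ?T"
  then obtain v ks where v: "v \<in> L" "del_by ?C v x" and ks: "length ks = length bs"
    and x: "x = pump ks (cycle_ideal (alternation (\<lambda>b. b) (\<lambda>b. b + N) bs))"
    unfolding cycle_lang_pump upclose_def by auto
  have "set v \<subseteq> set bs" using v(1) L set_blocks unfolding bounded_lang_blocks by blast
  then have "filter (\<lambda>x. x < N) v = v" using N by (intro filter_True) auto
  moreover have "filter (\<lambda>x. x < N) v = filter (\<lambda>x. x < N) x" by (rule del_by_filter[OF v(2)]) auto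
  ultimately have "v = blocks bs (map Suc ks)" using filter_less_alternation[OF ks N] x by simp
  then show "x \<in> ?U" using x ks v(1) by blast
next
  let ?C = "(\<lambda>b. b + N) ` set bs"
  fix x assume "x \<in> ?U"
  then obtain ks where ks: "length ks = length bs" "blocks bs (map Suc ks) \<in> L"
    and x: "x = pump ks (cycle_ideal (alternation (\<lambda>b. b) (\<lambda>b. b + N) bs))" by blast
  have "filter (\<lambda>y. y \<notin> ?C) x = filter (\<lambda>y. y < N) x"
  proof (rule filter_cong[OF refl])
    fix y assume "y \<in> set x"
    then have "y \<in> set bs \<union> ?C" using set_pump_alternation[of ks "\<lambda>b. b" "\<lambda>b. b + N" bs] x by auto
    then show "y \<notin> ?C \<longleftrightarrow> y < N" using N by auto
  qed
  then have "del_by ?C (blocks bs (map Suc ks)) x"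
    using del_by_filter_not[of ?C x] filter_less_alternation[OF ks(1) N] x by simp
  then show "x \<in> ?S \<inter> ?T" using ks x unfolding upclose_def cycle_lang_pump by auto
qed

text \<open>Erasing all letters and inserting arbitrary ones turns any nonempty language of the
  class into one that contains all words over \<open>A\<close>. This provides a code for the regular
  language of alternating words; if \<open>L\<close> is empty, both languages to be separated are
  empty, and \<open>L\<close> is not diagonal either.\<close>

lemma upclose_proj_empty:
  assumes "L \<noteq> {}" shows "lists A \<subseteq> upclose A (proj {} ` L)"
proof
  fix w assume "w \<in> lists A"
  then have "del_by A [] w" by (intro subseq_del_by) auto
  moreover have "[] \<in> proj {} ` L" using assms by (auto simp: proj_def)
  ultimately show "w \<in> upclose A (proj {} ` L)" unfolding upclose_def by blast
qed

text \<open>Writing \<open>c = b + N\<close>, the words \<open>(bc)\<^sup>k b\<close> and \<open>(cb)\<^sup>k c\<close> have the same short subwords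
  exactly when \<open>k\<close> is large, so bounded blocks can be told apart and unbounded ones cannot.\<close>

lemma alternation_separable_iff:
  assumes dist: "distinct bs" and N: "\<forall>b\<in>set bs. b < N" and L: "L \<subseteq> bounded_lang bs"
  defines "C \<equiv> (\<lambda>b. b + N) ` set bs"
  defines "A \<equiv> set bs \<union> C"
  defines "I \<equiv> upclose C L \<inter> cycle_lang (alternation (\<lambda>b. b) (\<lambda>b. b + N) bs)"
  defines "E \<equiv> upclose A (proj {} ` L) \<inter> cycle_lang (alternation (\<lambda>b. b + N) (\<lambda>b. b) bs)"
  shows "I \<union> E \<subseteq> lists A" and "PT_separable A I E \<longleftrightarrow> \<not> diagonal (set bs) L"
proof -
  let ?J1 = "cycle_ideal (alternation (\<lambda>b. b) (\<lambda>b. b + N) bs)"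
  let ?J2 = "cycle_ideal (alternation (\<lambda>b. b + N) (\<lambda>b. b) bs)"
  have len: "length ?J1 = length bs" "length ?J2 = length bs" by (simp_all add: alternation_ideal)
  have IA: "I \<subseteq> lists A"
    unfolding I_def A_def C_def using alternation_lists[of _ "\<lambda>b. b" "\<lambda>b. b + N" bs] by auto
  have EA: "E \<subseteq> lists A"
    unfolding E_def A_def C_def using alternation_lists[of _ "\<lambda>b. b + N" "\<lambda>b. b" bs] by auto
  show "I \<union> E \<subseteq> lists A" using IA EA by blast
  have finA: "finite A" by (simp add: A_def C_def)
  have I: "I = {pump ks ?J1 |ks. length ks = length bs \<and> blocks bs (map Suc ks) \<in> L}"
    unfolding I_def C_def by (rule upclose_alternation[OF L N])
  have "L = {blocks bs ks |ks. length ks = length bs \<and> blocks bs ks \<in> L}"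
    using L unfolding bounded_lang_blocks by blast
  note diag = diagonal_blocks_iff[OF dist this]
  have "\<not> PT_separable A I E" if d: "diagonal (set bs) L"
  proof (rule common_ideal_not_PT_separable[OF finA IA EA])
    show "ideal_lang ?J1 \<subseteq> downclose (I \<inter> ideal_lang ?J1)"
      unfolding ideal_lang_subset_downclose_iff[of ?J1]
    proof
      fix m :: nat
      obtain ks where ks: "length ks = length bs" "\<forall>k\<in>set ks. Suc m \<le> k" "blocks bs ks \<in> L"
        using d unfolding diag by blast
      \<comment> \<open>Undoes the shift by \<open>Suc\<close>; all exponents are at least
        \<open>Suc m\<close>, so the subtraction is exact and leaves at least
        \<open>m\<close>.\<close>
      let ?ks = "map (\<lambda>k. k - 1) ks"
      have "map Suc ?ks = ks" using ks(2) by (auto simp: comp_def intro!: map_idI)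
      then have "pump ?ks ?J1 \<in> I" unfolding I using ks by (intro CollectI exI[of _ ?ks]) simp
      then have "pump ?ks ?J1 \<in> downclose (I \<inter> ideal_lang ?J1)"
        unfolding downclose_def using pump_in_ideal_lang by blast
      then show "\<exists>ks. length ks = length ?J1 \<and> (\<forall>k\<in>set ks. m \<le> k) \<and> pump ks ?J1 \<in> downclose (I \<inter> ideal_lang ?J1)"
        using ks len by (intro exI[of _ ?ks]) auto
    qed
    have "L \<noteq> {}" using d unfolding diagonal_def by blast
    then have E: "E = {pump ks ?J2 |ks. length ks = length bs}"
      unfolding E_def cycle_lang_pump
      using upclose_proj_empty[of L A] alternation_lists[of _ "\<lambda>b. b + N" "\<lambda>b. b" bs]
      by (auto simp: A_def C_def cycle_lang_pump Un_commute)
    have "ideal_lang ?J2 \<subseteq> downclose (E \<inter> ideal_lang ?J2)"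
      unfolding ideal_lang_subset_downclose_iff[of ?J2]
    proof
      fix m :: nat
      let ?ks = "replicate (length bs) m"
      have "pump ?ks ?J2 \<in> E" unfolding E by (intro CollectI exI[of _ ?ks]) simp
      then have "pump ?ks ?J2 \<in> downclose (E \<inter> ideal_lang ?J2)"
        unfolding downclose_def using pump_in_ideal_lang by blast
      then show "\<exists>ks. length ks = length ?J2 \<and> (\<forall>k\<in>set ks. m \<le> k) \<and> pump ks ?J2 \<in> downclose (E \<inter> ideal_lang ?J2)"
        using len by (intro exI[of _ ?ks]) auto
    qed
    then show "ideal_lang ?J1 \<subseteq> downclose (E \<inter> ideal_lang ?J1)"
      by (simp add: alternation_ideal_swap[of "\<lambda>b. b"])
  qed
  moreover have "PT_separable A I E" if nd: "\<not> diagonal (set bs) L"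
  proof -
    obtain m where m: "\<And>ks. length ks = length bs \<Longrightarrow> blocks bs ks \<in> L \<Longrightarrow> \<exists>k\<in>set ks. \<not> m \<le> k"
      using nd unfolding diag by blast
    let ?v = "\<lambda>b k. concat (replicate k [b, b + N]) @ [b]"
    \<comment> \<open>In every word of \<open>I\<close> some block has a small exponent. The
      separator asks for a letter \<open>b\<close> whose two-letter projection is one of finitely
      many words \<open>(b c)^k b\<close>.\<close>
    let ?S = "\<lambda>b k. {w \<in> lists A. filter (\<lambda>x. x = b \<or> x = b + N) w = ?v b k}"
    have "?S b k \<in> PT A" if "b \<in> set bs" for b k
    proof (rule filter_eq_PT[OF finA])
      show "set (?v b k) \<subseteq> A" using that by (auto simp: A_def C_def)
      show "filter (\<lambda>x. x = b \<or> x = b + N) (?v b k) = ?v b k" by (simp add: filter_concat_replicate)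
    qed
    then have "(\<Union>b\<in>set bs. \<Union>k\<in>{..<m}. ?S b k) \<in> PT A" by (intro PT_UN) auto
    moreover have "I \<subseteq> (\<Union>b\<in>set bs. \<Union>k\<in>{..<m}. ?S b k)"
    proof
      fix x assume x: "x \<in> I"
      then obtain ks where ks: "length ks = length bs" "blocks bs (map Suc ks) \<in> L" "x = pump ks ?J1"
        unfolding I by blast
      then obtain k where "k \<in> set ks" "\<not> m \<le> Suc k" using m[of "map Suc ks"] by auto
      then obtain i where i: "i < length bs" "ks ! i = k" using ks(1) by (auto simp: in_set_conv_nth)
      obtain k' where "(bs ! i, k') \<in> set (zip bs ks)"
        "filter (\<lambda>x. x = bs ! i \<or> x = bs ! i + N) x = ?v (bs ! i) k'"
        using filter_alternation[OF ks(1) dist, of "bs ! i" "\<lambda>x. x = bs ! i \<or> x = bs ! i + N"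
            "\<lambda>b. b" "\<lambda>b. b + N"] i(1) N nth_mem[OF i(1)] ks(3) by fastforce
      moreover from this(1) have "k' = k"
        using i dist ks(1) by (auto simp: in_set_zip nth_eq_iff_index_eq)
      ultimately have "x \<in> ?S (bs ! i) k" using x IA by auto
      moreover have "k \<in> {..<m}" using \<open>\<not> m \<le> Suc k\<close> by simp
      ultimately show "x \<in> (\<Union>b\<in>set bs. \<Union>k\<in>{..<m}. ?S b k)" using nth_mem[OF i(1)] by blast
    qed
    moreover have "(\<Union>b\<in>set bs. \<Union>k\<in>{..<m}. ?S b k) \<inter> E = {}"
    proof (rule ccontr)
      assume "(\<Union>b\<in>set bs. \<Union>k\<in>{..<m}. ?S b k) \<inter> E \<noteq> {}"
      then obtain b k x where b: "b \<in> set bs" and x: "x \<in> E"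
        and eq: "filter (\<lambda>x. x = b \<or> x = b + N) x = ?v b k" by blast
      obtain ks where ks: "length ks = length bs" "x = pump ks ?J2"
        using x unfolding E_def cycle_lang_pump by auto
      obtain k' where "filter (\<lambda>x. x = b \<or> x = b + N) x = concat (replicate k' [b + N, b]) @ [b + N]"
        using filter_alternation[OF ks(1) dist b, of "\<lambda>x. x = b \<or> x = b + N" "\<lambda>b. b + N" "\<lambda>b. b"]
          N b ks(2) by fastforce
      then have "?v b k = concat (replicate k' [b + N, b]) @ [b + N]" by (rule trans[OF eq[symmetric]])
      \<comment> \<open>The two projections start with \<open>b\<close> and with
        \<open>b + N\<close>, which differ because \<open>b < N\<close> makes \<open>N\<close>
        positive.\<close>
      then have "hd (?v b k) = hd (concat (replicate k' [b + N, b]) @ [b + N])" by (rule arg_cong)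
      then show False using N b by (cases k; cases k') auto
    qed
    ultimately show ?thesis unfolding PT_separable_def by blast
  qed
  ultimately show "PT_separable A I E \<longleftrightarrow> \<not> diagonal (set bs) L" by blast
qed

section \<open>Diagonality of regular languages\<close>

lemma run_path:
  assumes "run M p w q"
  shows "\<exists>f. f 0 = p \<and> f (length w) = q \<and> (\<forall>i<length w. (f i, w ! i, f (Suc i)) \<in> set (trans M))"
  using assms
proof (induction rule: run.induct)
  case (run_step p a q w r)
  then obtain f where "f 0 = q" "f (length w) = r" "\<forall>i<length w. (f i, w ! i, f (Suc i)) \<in> set (trans M)"
    by blast
  then show ?case using run_step.hyps(1)
    by (intro exI[of _ "\<lambda>i. case i of 0 \<Rightarrow> p | Suc j \<Rightarrow> f j"]) (auto simp: nth_Cons split: nat.split)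
qed auto

lemma path_run:
  assumes "\<forall>i<length w. (f i, w ! i, f (Suc i)) \<in> set (trans M)" "i \<le> j" "j \<le> length w"
  shows "run M (f i) (take (j - i) (drop i w)) (f j)"
  using assms(2,3)
proof (induction j rule: dec_induct)
  case (step j)
  have "take (Suc j - i) (drop i w) = take (j - i) (drop i w) @ [w ! j]"
    using step by (simp add: Suc_diff_le take_Suc_conv_app_nth)
  moreover have "run M (f j) [w ! j] (f (Suc j))" using assms(1) step by (auto simp: run_Cons_iff)
  ultimately show ?case using step by (auto intro: run_append)
qed simp

text \<open>Pigeonhole on the positions where \<open>a\<close> is read, mapped to the states from
  which it is read. Two positions with the same state enclose a loop that starts with
  \<open>a\<close>; only sources of transitions have to be counted in \<open>S\<close>.\<close>

lemma run_loop:
  assumes "run M p w q" "finite S" "\<forall>(s, b, t)\<in>set (trans M). s \<in> S" "card S < count_list w a"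
  shows "\<exists>s u v x. w = u @ v @ x \<and> run M p u s \<and> run M s v s \<and> run M s x q \<and> a \<in> set v"
proof -
  obtain f where f: "f 0 = p" "f (length w) = q" "\<forall>i<length w. (f i, w ! i, f (Suc i)) \<in> set (trans M)"
    using run_path[OF assms(1)] by blast
  define P where "P = {i. i < length w \<and> a = w ! i}"
  have "card P = count_list w a"
    unfolding P_def by (simp add: count_list_eq_length_filter length_filter_conv_card)
  moreover have "f ` P \<subseteq> S" using f(3) assms(3) unfolding P_def by fastforce
  ultimately have "\<not> inj_on f P"
    using assms(2,4) by (metis card_mono card_image not_le)
  then obtain i j where ij: "i \<in> P" "j \<in> P" "i < j" "f i = f j"
    unfolding inj_on_def by (metis nat_neq_iff)
  then have le: "i \<le> j" "j < length w" "i < length w" "w ! i = a" unfolding P_def by auto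
  let ?v = "take (j - i) (drop i w)"
  have "w = take i w @ ?v @ drop j w"
    using le(1) by (metis append_take_drop_id drop_drop le_add_diff_inverse2)
  moreover have "run M p (take i w) (f i)" using path_run[OF f(3), of 0 i] f(1) le by simp
  moreover have "run M (f i) ?v (f i)" using path_run[OF f(3), of i j] ij(4) le by simp
  moreover have "run M (f i) (drop j w) q" using path_run[OF f(3), of j "length w"] ij(4) f(2) le by simp
  moreover have "a \<in> set ?v"
    using ij(3) le by (auto simp: in_set_conv_nth intro!: exI[of _ 0])
  ultimately show ?thesis by blast
qed

lemma count_list_concat_replicate: "count_list (concat (replicate k v)) b = k * count_list v b"
  by (induction k) auto

lemma run_pump_letter:
  assumes "run M p w q" "finite S" "\<forall>(s, b, t)\<in>set (trans M). s \<in> S" "card S < count_list w a"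
  shows "\<exists>w'. run M p w' q \<and> (\<forall>b. count_list w b \<le> count_list w' b) \<and> m \<le> count_list w' a"
proof -
  obtain s u v x where w: "w = u @ v @ x" and r: "run M p u s" "run M s v s" "run M s x q" and a: "a \<in> set v"
    using run_loop[OF assms] by blast
  let ?w = "u @ concat (replicate (Suc m) v) @ x"
  have "run M s (concat (replicate k v)) s" for k by (induction k) (auto intro: run_append[OF r(2)])
  then have "run M p ?w q" using r by (intro run_append)
  moreover have "\<forall>b. count_list w b \<le> count_list ?w b" by (simp add: w count_list_concat_replicate)
  moreover have "m \<le> count_list ?w a"
  proof -
    have "1 \<le> count_list v a" using a by (simp add: Suc_le_eq count_list_0_iff flip: neq0_conv)
    then have "m \<le> m * count_list v a" by simp
    then show ?thesis unfolding count_list_append count_list_concat_replicate mult_Suc by linarith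
  qed
  ultimately show ?thesis by blast
qed

text \<open>Letters are pumped one after the other. No count ever decreases, so earlier gains
  persist and the remaining letters still exceed the threshold.\<close>

lemma run_pump:
  assumes "run M p w q" "finite S" "\<forall>(s, b, t)\<in>set (trans M). s \<in> S"
    and "finite A" "\<forall>a\<in>A. card S < count_list w a"
  shows "\<exists>w'. run M p w' q \<and> (\<forall>b. count_list w b \<le> count_list w' b) \<and> (\<forall>a\<in>A. m \<le> count_list w' a)"
  using assms(4,5)
proof (induction A rule: finite_induct)
  case empty
  then show ?case using assms(1) by auto
next
  case (insert a A)
  then obtain w1 where w1: "run M p w1 q" "\<forall>b. count_list w b \<le> count_list w1 b" "\<forall>a\<in>A. m \<le> count_list w1 a"
    by auto
  have "card S < count_list w1 a" using insert.prems w1(2) by (auto intro: less_le_trans)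
  then obtain w2 where "run M p w2 q" "\<forall>b. count_list w1 b \<le> count_list w2 b" "m \<le> count_list w2 a"
    using run_pump_letter[OF w1(1) assms(2,3)] by blast
  then show ?case using w1(2,3) by (intro exI[of _ w2]) (auto intro: order_trans)
qed

lemma element_le_list_encode: "x \<in> set xs \<Longrightarrow> x \<le> list_encode xs"
proof (induction xs)
  case (Cons y xs)
  then show ?case using le_prod_encode_1[of y "list_encode xs"] le_prod_encode_2[of "list_encode xs" y] by auto
qed simp

text \<open>Cantor codes are at least as large as their components. The code of an automaton
  therefore bounds its source states, which gives a pumping threshold without any analysis of the
  automaton.\<close>

lemma decode_nfa_source_le:
  assumes "(s, b, t) \<in> set (trans (decode_nfa n))" shows "s \<le> n"
proof -
  obtain x y where n: "n = prod_encode (x, y)" by (metis prod_decode_inverse surj_pair)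
  obtain z v where y: "y = prod_encode (z, v)" by (metis prod_decode_inverse surj_pair)
  obtain k where k: "k \<in> set (list_decode z)" "decode_triple k = (s, b, t)"
    using assms by (auto simp: decode_nfa_def n y)
  obtain p r where kp: "k = prod_encode (p, r)" by (metis prod_decode_inverse surj_pair)
  have "p = s" using k(2) by (simp add: decode_triple_def kp split: prod.splits)
  then have "s \<le> k" using kp le_prod_encode_1 by simp
  also have "k \<le> z" using element_le_list_encode[OF k(1)] by simp
  also have "z \<le> y" using y le_prod_encode_1 by simp
  also have "y \<le> n" using n le_prod_encode_2 by simp
  finally show ?thesis .
qed

lemma count_list_subseq: "subseq u w \<Longrightarrow> count_list u a \<le> count_list w a"
  by (induction rule: list_emb.induct) auto

text \<open>A word of \<open>L\<close> with many occurrences of each letter is accepted by the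
  automaton and can be pumped there. The pumped word lies only in the downward closure, but a word
  of \<open>L\<close> above it has at least the same counts.\<close>

lemma diagonal_iff_bounded:
  assumes "nfa_lang (decode_nfa n) = downclose L" "finite A"
  shows "diagonal A L \<longleftrightarrow> (\<exists>w\<in>L. \<forall>a\<in>A. n + 2 \<le> count_list w a)"
proof
  assume "diagonal A L"
  then show "\<exists>w\<in>L. \<forall>a\<in>A. n + 2 \<le> count_list w a" unfolding diagonal_def by blast
next
  assume "\<exists>w\<in>L. \<forall>a\<in>A. n + 2 \<le> count_list w a"
  then obtain w where w: "w \<in> L" "\<forall>a\<in>A. n + 2 \<le> count_list w a" by blast
  then have "w \<in> nfa_lang (decode_nfa n)" unfolding assms(1) downclose_def by blast
  then obtain p q where pq: "p \<in> set (init (decode_nfa n))" "q \<in> set (final (decode_nfa n))" "run (decode_nfa n) p w q"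
    unfolding nfa_lang_def by blast
  have src: "\<forall>(s, b, t)\<in>set (trans (decode_nfa n)). s \<in> {..n}" using decode_nfa_source_le by auto
  \<comment> \<open>There are \<open>n + 1\<close> possible sources, and pigeonhole needs one
    occurrence more; this is the origin of \<open>n + 2\<close>.\<close>
  have cnt: "\<forall>a\<in>A. card {..n} < count_list w a" using w(2) by (auto simp: Suc_le_eq)
  show "diagonal A L" unfolding diagonal_def
  proof
    fix m
    obtain w' where w': "run (decode_nfa n) p w' q" "\<forall>a\<in>A. m \<le> count_list w' a"
      using run_pump[OF pq(3) _ src assms(2) cnt] by blast
    then have "w' \<in> downclose L" using pq assms(1) unfolding nfa_lang_def by blast
    then obtain v where "v \<in> L" "subseq w' v" unfolding downclose_def by blast
    then show "\<exists>w\<in>L. \<forall>a\<in>A. m \<le> count_list w a"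
      using w'(2) by (intro bexI[of _ v]) (auto intro: order_trans[OF _ count_list_subseq])
  qed
qed

section \<open>Lower bounds on letter counts as regular conditions\<close>

lemma replicate_in_cycle_lang: "replicate K x \<in> cycle_lang (replicate K ([], x, x))"
  by (induction K) (auto intro!: exI[of _ 0])

lemma cycle_lang_count_ge: "w \<in> cycle_lang (replicate K ([], x, x)) \<Longrightarrow> K \<le> count_list w x"
proof (induction K arbitrary: w)
  case (Suc K)
  then obtain k v where "w = replicate k x @ x # v" "v \<in> cycle_lang (replicate K ([], x, x))"
    by (auto simp: concat_replicate_singleton)
  then show ?case using Suc.IH[of v] by simp
qed simp

text \<open>The \<open>K\<close> factors, each of the form \<open>x^k x\<close>, produce
  \<open>x^K\<close> and otherwise only higher powers of \<open>x\<close>; their upward closure over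
  \<open>A\<close> is the desired condition.\<close>

lemma count_ge_iff:
  assumes "w \<in> lists A"
  shows "w \<in> upclose A (cycle_lang (replicate K ([], x, x))) \<longleftrightarrow> K \<le> count_list w x"
proof
  assume "w \<in> upclose A (cycle_lang (replicate K ([], x, x)))"
  then obtain u where "u \<in> cycle_lang (replicate K ([], x, x))" "subseq u w"
    unfolding upclose_def using del_by_subseq by blast
  then show "K \<le> count_list w x" by (rule order_trans[OF cycle_lang_count_ge count_list_subseq])
next
  assume K: "K \<le> count_list w x"
  have "filter (\<lambda>y. x = y) w = replicate (count_list w x) x"
    by (induction w) auto
  then have "subseq (replicate (count_list w x) x) w" by (metis subseq_filter_left)
  moreover have "replicate (count_list w x) x = replicate (count_list w x - K) x @ replicate K x"
    using K by (simp flip: replicate_add)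
  ultimately have "subseq (replicate (count_list w x - K) x @ replicate K x) w" by simp
  then have "subseq (replicate K x) w" by (rule list_emb_appendD[THEN exE]) auto
  then have "del_by A (replicate K x) w" using assms by (intro subseq_del_by) auto
  then show "w \<in> upclose A (cycle_lang (replicate K ([], x, x)))"
    unfolding upclose_def using replicate_in_cycle_lang by blast
qed

section \<open>Computing the automata\<close>

text \<open>Operations on syntax are total, so each is computed once on \<open>UNIV\<close>; the
  domain \<open>D\<close> then enters only through the arguments.\<close>

lemma computable_total2:
  assumes "computable UNIV (\<lambda>e. F (fst e) (snd e))" "computable D f" "computable D g"
  shows "computable D (\<lambda>x. F (f x) (g x))"
  using computable_comp[OF computable_Pair[OF assms(2,3)] assms(1)] by simp

lemma computable_total1:
  assumes "computable UNIV F" "computable D f" shows "computable D (\<lambda>x. F (f x))"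
  using computable_comp[OF assms(2,1)] by simp

lemma computable_ideal_next:
  assumes "computable D J" "computable D x"
  shows "computable D (\<lambda>e. ideal_next (J e) (x e))"
proof (rule computable_total2[OF _ assms])
  have "computable UNIV (\<lambda>e :: ideal_expr \<times> nat. rec_list 0 (\<lambda>p J acc. if snd e \<in> set (fst p) then Suc (enc (p # J))
     else if snd e = snd p then Suc (enc J) else acc) (fst e) :: nat)"
    by (intro computable_rec_list computable_intros)
  moreover have "rec_list 0 (\<lambda>p J acc. if x \<in> set (fst p) then Suc (enc (p # J))
     else if x = snd p then Suc (enc J) else acc) K = ideal_next K x" for x K
    by (induction K) auto
  ultimately show "computable UNIV (\<lambda>e. ideal_next (fst e) (snd e))" by simp
qed

lemma computable_ideal_states:
  assumes "computable D J" shows "computable D (\<lambda>e. ideal_states (J e))"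
proof (rule computable_total1[OF _ assms])
  have "computable UNIV (\<lambda>e :: ideal_expr. rec_list [Suc (enc ([] :: ideal_expr))] (\<lambda>p J acc. Suc (enc (p # J)) # acc) e)"
    by (intro computable_rec_list computable_intros)
  moreover have "rec_list [Suc (enc ([] :: ideal_expr))] (\<lambda>p J acc. Suc (enc (p # J)) # acc) K = ideal_states K" for K
    by (induction K) auto
  ultimately show "computable UNIV ideal_states" by simp
qed

lemma computable_ideal_trans:
  assumes "computable D A" "computable D J"
  shows "computable D (\<lambda>e. ideal_trans (A e) (J e))"
proof (rule computable_total2[OF _ assms])
  have "computable UNIV (\<lambda>e. rec_list (map (\<lambda>x. (Suc (enc ([] :: ideal_expr)), x, 0 :: nat)) (fst e))
     (\<lambda>p J acc. map (\<lambda>x. (Suc (enc (p # J)), x, ideal_next (p # J) x)) (fst e) @ acc) (snd e))"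
    by (intro computable_rec_list computable_intros computable_ideal_next)
  moreover have "rec_list (map (\<lambda>x. (Suc (enc ([] :: ideal_expr)), x, 0 :: nat)) A)
     (\<lambda>p J acc. map (\<lambda>x. (Suc (enc (p # J)), x, ideal_next (p # J) x)) A @ acc) K = ideal_trans A K" for A K
    by (induction K) auto
  ultimately show "computable UNIV (\<lambda>e. ideal_trans (fst e) (snd e))" by simp
qed

lemma computable_ideals_nfa:
  assumes "computable D A" "computable D Js"
  shows "computable D (\<lambda>e. ideals_nfa (A e) (Js e))"
  unfolding ideals_nfa_def ideals_trans_def
  by (rule computable_total2[OF _ assms])
    (intro computable_intros computable_ideal_trans computable_ideal_states)

lemma computable_coideal_nfa:
  assumes "computable D A" "computable D J"
  shows "computable D (\<lambda>e. coideal_nfa (A e) (J e))"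
  unfolding coideal_nfa_def ideals_trans_def
  by (rule computable_total2[OF _ assms])
    (intro computable_intros computable_ideal_trans computable_ideal_states)

lemma computable_upclose_nfa:
  assumes "computable D A" "computable D M"
  shows "computable D (\<lambda>e. upclose_nfa (A e) (M e))"
  unfolding upclose_nfa_def
  by (rule computable_total2[OF _ assms]) (intro computable_intros)

lemma computable_block_trans:
  assumes "computable D T" "computable D v"
  shows "computable D (\<lambda>e. block_trans (T e) (v e))"
proof (rule computable_total2[OF _ assms])
  have "computable UNIV (\<lambda>e :: cycle_expr \<times> nat list. rec_list [] (\<lambda>x v acc. (enc (x # v, fst e), x, enc (v, fst e)) # acc) (snd e))"
    by (intro computable_rec_list computable_intros)
  moreover have "rec_list [] (\<lambda>x v acc. (enc (x # v, T), x, enc (v, T)) # acc) u = block_trans T u" for T u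
    by (induction u) auto
  ultimately show "computable UNIV (\<lambda>e. block_trans (fst e) (snd e))" by simp
qed

lemma computable_cycle_start:
  assumes "computable D ts" shows "computable D (\<lambda>e. cycle_start (ts e))"
proof (rule computable_total1[OF _ assms])
  have "computable UNIV (\<lambda>ts :: cycle_expr. enc (rec_list [] (\<lambda>t ts' acc. fst t) ts, ts))"
    by (intro computable_rec_list computable_intros)
  moreover have "rec_list [] (\<lambda>t ts' acc. fst t) ts = (case ts of [] \<Rightarrow> [] | t # ts' \<Rightarrow> fst t)" for ts :: cycle_expr
    by (cases ts) auto
  ultimately show "computable UNIV cycle_start" unfolding cycle_start_def by (simp del: enc_Pair)
qed

lemma computable_cycle_nfa:
  assumes "computable D ts" shows "computable D (\<lambda>e. cycle_nfa (ts e))"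
proof (rule computable_total1[OF _ assms])
  let ?h = "\<lambda>t ts acc. block_trans (t # ts) (fst t) @
     [(enc ([] :: nat list, t # ts), fst (snd t), enc (fst t, t # ts)),
      (enc (fst t, t # ts), snd (snd t), cycle_start ts)] @ acc"
  have "computable UNIV (\<lambda>ts. rec_list [] (\<lambda>t ts acc. ?h t ts acc) ts)"
    by (intro computable_rec_list computable_intros computable_block_trans computable_cycle_start)
  moreover have "rec_list [] (\<lambda>t ts acc. ?h t ts acc) ts = cycle_trans ts" for ts
    by (induction ts) (simp_all del: enc_Pair)
  ultimately have "computable UNIV cycle_trans" by simp
  then have "computable UNIV (\<lambda>ts. cycle_trans ts)" .
  then show "computable UNIV cycle_nfa" unfolding cycle_nfa_def
    by (intro computable_intros computable_cycle_start)
qed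

lemma computable_mark:
  assumes "computable D N" "computable D J"
  shows "computable D (\<lambda>e. mark (N e) (J e))"
proof (rule computable_total2[OF _ assms])
  have "computable UNIV (\<lambda>e. rec_list [] (\<lambda>p J acc. (fst p, fst e + length J, snd p) # acc) (snd e) :: cycle_expr)"
    by (intro computable_rec_list computable_intros)
  moreover have "rec_list [] (\<lambda>p J acc. (fst p, N + length J, snd p) # acc) K = mark N K" for N K
    by (induction K) auto
  ultimately show "computable UNIV (\<lambda>e. mark (fst e) (snd e))" by simp
qed

lemma computable_markers:
  assumes "computable D N" "computable D J"
  shows "computable D (\<lambda>e. markers (N e) (J e))"
proof (rule computable_total2[OF _ assms])
  have "computable UNIV (\<lambda>e :: nat \<times> ideal_expr. rec_list [] (\<lambda>p J acc. (fst e + length J) # acc) (snd e))"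
    by (intro computable_rec_list computable_intros)
  moreover have "rec_list [] (\<lambda>p J acc. (N + length J) # acc) K = markers N K" for N and K :: ideal_expr
    by (induction K) auto
  ultimately show "computable UNIV (\<lambda>e. markers (fst e) (snd e))" by simp
qed

lemma computable_ideal_letters:
  assumes "computable D J" shows "computable D (\<lambda>e. ideal_letters (J e))"
proof (rule computable_total1[OF _ assms])
  have "computable UNIV (\<lambda>e :: ideal_expr. rec_list [] (\<lambda>p J acc. snd p # fst p @ acc) e)"
    by (intro computable_rec_list computable_intros)
  moreover have "rec_list [] (\<lambda>p J acc. snd p # fst p @ acc) K = ideal_letters K" for K :: ideal_expr
    by (induction K) auto
  ultimately show "computable UNIV ideal_letters" by simp
qed

text \<open>The sign \<open>0\<close> means membership.\<close>

fun sign_patterns :: "ideal_expr list \<Rightarrow> (ideal_expr \<times> nat) list list" where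
  "sign_patterns [] = [[]]"
| "sign_patterns (J # Js) = map (\<lambda>c. (J, 0) # c) (sign_patterns Js) @ map (\<lambda>c. (J, 1) # c) (sign_patterns Js)"

lemma computable_sign_patterns:
  assumes "computable D Js" shows "computable D (\<lambda>e. sign_patterns (Js e))"
proof (rule computable_total1[OF _ assms])
  have "computable UNIV (\<lambda>Js :: ideal_expr list. rec_list [[]]
      (\<lambda>J Js acc. map (\<lambda>c. (J, 0 :: nat) # c) acc @ map (\<lambda>c. (J, 1) # c) acc) Js)"
    by (intro computable_rec_list computable_intros)
  moreover have "rec_list [[]] (\<lambda>J Js acc. map (\<lambda>c. (J, 0 :: nat) # c) acc @ map (\<lambda>c. (J, 1) # c) acc) Js
      = sign_patterns Js" for Js
    by (induction Js) auto
  ultimately show "computable UNIV sign_patterns" by simp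
qed

lemma sign_pattern_of_word:
  "map (\<lambda>J. (J, if x \<in> ideal_lang J then 0 else 1)) Js \<in> set (sign_patterns Js)"
  by (induction Js) auto

lemma map_fst_sign_patterns: "c \<in> set (sign_patterns Js) \<Longrightarrow> map fst c = Js"
  by (induction Js arbitrary: c) auto

definition signed_nfa :: "nat list \<Rightarrow> ideal_expr \<times> nat \<Rightarrow> nfa_expr" where
  "signed_nfa A s = (if snd s = 0 then ideals_nfa A [fst s] else coideal_nfa A (fst s))"

lemma signed_nfa_lang:
  "nfa_expr_lang (signed_nfa A s) = {w \<in> lists (set A). w \<in> ideal_lang (fst s) \<longleftrightarrow> snd s = 0}"
  by (auto simp: signed_nfa_def ideals_nfa_lang coideal_nfa_lang)

lemma computable_signed_nfa:
  assumes "computable D A" "computable D s"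
  shows "computable D (\<lambda>e. signed_nfa (A e) (s e))"
  unfolding signed_nfa_def
  by (rule computable_total2[OF _ assms])
    (intro computable_intros computable_ideals_nfa computable_coideal_nfa)

section \<open>Decision problems for full trios\<close>

lemma bounded_lang_subset_lists: "bounded_lang bs \<subseteq> lists (set bs)"
  using set_blocks by (auto simp: bounded_lang_blocks)

section \<open>The four problems restated for encoded data on a domain\<close>

lemma SUP_decidable_iff:
  "SUP_decidable R Lg \<longleftrightarrow>
    decidable {(r, bs). r \<in> R \<and> distinct bs \<and> Lg r \<subseteq> bounded_lang bs} (\<lambda>(r, bs). diagonal (set bs) (Lg r))"
    (is "?L \<longleftrightarrow> ?R")
proof
  assume ?L
  then obtain p where p: "\<forall>r\<in>R. \<forall>a. distinct (list_decode a) \<and> Lg r \<subseteq> bounded_lang (list_decode a) \<longrightarrow>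
      eval p [pair r a] (if diagonal (set (list_decode a)) (Lg r) then 1 else 0)"
    unfolding SUP_decidable_def by blast
  have "eval p [enc (r, bs)] (enc (of_bool (diagonal (set bs) (Lg r)) :: nat))"
    if "r \<in> R" "distinct bs" "Lg r \<subseteq> bounded_lang bs" for r bs
    using p[rule_format, of r "list_encode bs"] that by (simp add: pair_def of_bool_def)
  then show ?R unfolding decidable_def computable_def
    by (intro exI[of _ p]) (auto simp del: enc_Pair)
next
  assume ?R
  then obtain p where p: "\<forall>e\<in>{(r, bs). r \<in> R \<and> distinct bs \<and> Lg r \<subseteq> bounded_lang bs}.
      eval p [enc e] (enc (of_bool (case e of (r, bs) \<Rightarrow> diagonal (set bs) (Lg r)) :: nat))"
    unfolding decidable_def computable_def by blast
  have "eval p [pair r a] (if diagonal (set (list_decode a)) (Lg r) then 1 else 0)"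
    if "r \<in> R" "distinct (list_decode a) \<and> Lg r \<subseteq> bounded_lang (list_decode a)" for r a
    using p[rule_format, of "(r, list_decode a)"] that by (simp add: pair_def of_bool_def)
  then show ?L unfolding SUP_decidable_def by blast
qed

lemma diagonal_decidable_iff:
  "diagonal_decidable R Lg \<longleftrightarrow>
    decidable {(r, as). r \<in> R \<and> Lg r \<subseteq> lists (set as)} (\<lambda>(r, as). diagonal (set as) (Lg r))"
    (is "?L \<longleftrightarrow> ?R")
proof
  assume ?L
  then obtain p where p: "\<forall>r\<in>R. \<forall>a. Lg r \<subseteq> lists (decode_set a) \<longrightarrow>
      eval p [pair r a] (if diagonal (decode_set a) (Lg r) then 1 else 0)"
    unfolding diagonal_decidable_def by blast
  have "eval p [enc (r, as)] (enc (of_bool (diagonal (set as) (Lg r)) :: nat))"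
    if "r \<in> R" "Lg r \<subseteq> lists (set as)" for r as
    using p[rule_format, of r "list_encode as"] that by (simp add: pair_def of_bool_def decode_set_def)
  then show ?R unfolding decidable_def computable_def
    by (intro exI[of _ p]) (auto simp del: enc_Pair)
next
  assume ?R
  then obtain p where p: "\<forall>e\<in>{(r, as). r \<in> R \<and> Lg r \<subseteq> lists (set as)}.
      eval p [enc e] (enc (of_bool (case e of (r, as) \<Rightarrow> diagonal (set as) (Lg r)) :: nat))"
    unfolding decidable_def computable_def by blast
  have "eval p [pair r a] (if diagonal (decode_set a) (Lg r) then 1 else 0)"
    if "r \<in> R" "Lg r \<subseteq> lists (decode_set a)" for r a
    using p[rule_format, of "(r, list_decode a)"] that by (simp add: pair_def of_bool_def decode_set_def)
  then show ?L unfolding diagonal_decidable_def by blast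
qed

lemma PT_sep_decidable_iff:
  "PT_sep_decidable R Lg \<longleftrightarrow>
    decidable {(r, s, as). r \<in> R \<and> s \<in> R \<and> Lg r \<union> Lg s \<subseteq> lists (set as)}
      (\<lambda>(r, s, as). PT_separable (set as) (Lg r) (Lg s))"
    (is "?L \<longleftrightarrow> ?R")
proof
  assume ?L
  then obtain p where p: "\<forall>r\<in>R. \<forall>s\<in>R. \<forall>a. Lg r \<union> Lg s \<subseteq> lists (decode_set a) \<longrightarrow>
      eval p [pair r (pair s a)] (if PT_separable (decode_set a) (Lg r) (Lg s) then 1 else 0)"
    unfolding PT_sep_decidable_def by blast
  have "eval p [enc (r, s, as)] (enc (of_bool (PT_separable (set as) (Lg r) (Lg s)) :: nat))"
    if "r \<in> R" "s \<in> R" "Lg r \<union> Lg s \<subseteq> lists (set as)" for r s as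
    using p[rule_format, of r s "list_encode as"] that by (simp add: pair_def of_bool_def decode_set_def)
  then show ?R unfolding decidable_def computable_def
    by (intro exI[of _ p]) (auto simp del: enc_Pair)
next
  assume ?R
  then obtain p where p: "\<forall>e\<in>{(r, s, as). r \<in> R \<and> s \<in> R \<and> Lg r \<union> Lg s \<subseteq> lists (set as)}.
      eval p [enc e] (enc (of_bool (case e of (r, s, as) \<Rightarrow> PT_separable (set as) (Lg r) (Lg s)) :: nat))"
    unfolding decidable_def computable_def by blast
  have "eval p [pair r (pair s a)] (if PT_separable (decode_set a) (Lg r) (Lg s) then 1 else 0)"
    if "r \<in> R" "s \<in> R" "Lg r \<union> Lg s \<subseteq> lists (decode_set a)" for r s a
    using p[rule_format, of "(r, s, list_decode a)"] that by (simp add: pair_def of_bool_def decode_set_def)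
  then show ?L unfolding PT_sep_decidable_def by blast
qed

text \<open>A specification promises some output with property \<open>Q\<close>. Choosing one such
  output per input turns the program into a function that can be used in terms; \<open>C\<close> is
  the promise on the input.\<close>

lemma computable_choice:
  fixes R :: "nat set" and Q :: "nat \<Rightarrow> 'b::codable \<Rightarrow> nat \<Rightarrow> bool"
  assumes "\<forall>r\<in>R. \<forall>b. C r (dec b) \<longrightarrow> (\<exists>r'. eval p [pair r b] r' \<and> Q r (dec b) r')"
  shows "\<exists>f. computable {(r, b). r \<in> R \<and> C r b} f \<and> (\<forall>r\<in>R. \<forall>b. C r b \<longrightarrow> Q r b (f (r, b)))"
proof -
  define f where "f = (\<lambda>(r, b). SOME r'. eval p [pair r (enc b)] r' \<and> Q r b r')"
  have f: "eval p [pair r (enc b)] (f (r, b)) \<and> Q r b (f (r, b))" if "r \<in> R" "C r b" for r b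
  proof -
    have "\<exists>r'. eval p [pair r (enc b)] r' \<and> Q r b r'"
      using assms[rule_format, of r "enc b"] that by simp
    then show ?thesis unfolding f_def prod.case by (rule someI_ex)
  qed
  then have "computable {(r, b). r \<in> R \<and> C r b} f"
    unfolding computable_def by (intro exI[of _ p]) (auto simp: pair_def)
  then show ?thesis using f by blast
qed

lemma downclosure_computable_iff:
  "downclosure_computable R Lg \<longleftrightarrow>
    (\<exists>f. computable {(r, as). r \<in> R \<and> Lg r \<subseteq> lists (set as)} f \<and>
      (\<forall>r\<in>R. \<forall>as. Lg r \<subseteq> lists (set as) \<longrightarrow> nfa_lang (decode_nfa (f (r, as))) = downclose (Lg r)))"
    (is "?L \<longleftrightarrow> ?R")
proof
  assume ?L
  then obtain p where p: "\<forall>r\<in>R. \<forall>a. Lg r \<subseteq> lists (set (dec a)) \<longrightarrow>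
      (\<exists>n. eval p [pair r a] n \<and> nfa_lang (decode_nfa n) = downclose (Lg r))"
    unfolding downclosure_computable_def decode_set_def by (auto simp: dec_list_def)
  show ?R
    using computable_choice[OF p] by simp
next
  assume ?R
  then obtain f p where p: "\<forall>e\<in>{(r, as). r \<in> R \<and> Lg r \<subseteq> lists (set as)}. eval p [enc e] (f e)"
    and f: "\<forall>r\<in>R. \<forall>as. Lg r \<subseteq> lists (set as) \<longrightarrow> nfa_lang (decode_nfa (f (r, as))) = downclose (Lg r)"
    unfolding computable_def by auto
  have "eval p [pair r a] (f (r, list_decode a)) \<and> nfa_lang (decode_nfa (f (r, list_decode a))) = downclose (Lg r)"
    if "r \<in> R" "Lg r \<subseteq> lists (decode_set a)" for r a
    using p[rule_format, of "(r, list_decode a)"] f that by (simp add: pair_def decode_set_def)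
  then show ?L unfolding downclosure_computable_def by blast
qed

locale trio =
  fixes R :: "nat set" and Lg :: "nat \<Rightarrow> lang"
    and project :: "nat \<times> nat list \<Rightarrow> nat" and extend :: "nat \<times> nat list \<Rightarrow> nat"
    and restrict :: "nat \<times> nfa_expr \<Rightarrow> nat"
  assumes project: "r \<in> R \<Longrightarrow> project (r, b) \<in> R \<and> Lg (project (r, b)) = proj (set b) ` Lg r"
    and extend: "r \<in> R \<Longrightarrow> extend (r, b) \<in> R \<and> Lg (extend (r, b)) = upclose (set b) (Lg r)"
    and restrict: "r \<in> R \<Longrightarrow> restrict (r, M) \<in> R \<and> Lg (restrict (r, M)) = Lg r \<inter> nfa_expr_lang M"
    and computable_project': "computable {(r, b). r \<in> R} project"
    and computable_extend': "computable {(r, b). r \<in> R} extend"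
    and computable_restrict': "computable {(r, M). r \<in> R} restrict"

lemma full_trio_trio:
  assumes "full_trio R Lg" obtains project extend restrict where "trio R Lg project extend restrict"
proof -
  have "\<exists>p. \<forall>r\<in>R. \<forall>b. \<exists>r'. eval p [pair r b] r' \<and> r' \<in> R \<and> Lg r' = proj (decode_set b) ` Lg r"
    using assms unfolding full_trio_def by (elim conjE)
  then obtain p1 where p1: "\<forall>r\<in>R. \<forall>b. \<exists>r'. eval p1 [pair r b] r' \<and> r' \<in> R \<and> Lg r' = proj (decode_set b) ` Lg r" ..
  have "\<exists>p. \<forall>r\<in>R. \<forall>b. \<exists>r'. eval p [pair r b] r' \<and> r' \<in> R \<and> Lg r' = upclose (decode_set b) (Lg r)"
    using assms unfolding full_trio_def by (elim conjE)
  then obtain p2 where p2: "\<forall>r\<in>R. \<forall>b. \<exists>r'. eval p2 [pair r b] r' \<and> r' \<in> R \<and> Lg r' = upclose (decode_set b) (Lg r)" ..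
  have "\<exists>p. \<forall>r\<in>R. \<forall>n. \<exists>r'. eval p [pair r n] r' \<and> r' \<in> R \<and> Lg r' = Lg r \<inter> nfa_lang (decode_nfa n)"
    using assms unfolding full_trio_def by (elim conjE)
  then obtain p3 where p3: "\<forall>r\<in>R. \<forall>n. \<exists>r'. eval p3 [pair r n] r' \<and> r' \<in> R \<and> Lg r' = Lg r \<inter> nfa_lang (decode_nfa n)" ..
  have dec: "decode_set b = set (dec b)" for b by (simp add: decode_set_def dec_list_def)
  have nfa: "nfa_lang (decode_nfa n) = nfa_expr_lang (dec n)" for n using decode_nfa_enc[of "dec n"] by simp
  obtain project where 1: "computable {(r, b). r \<in> R \<and> True} project"
    "\<forall>r\<in>R. \<forall>b. True \<longrightarrow> project (r, b) \<in> R \<and> Lg (project (r, b)) = proj (set b) ` Lg r"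
    using computable_choice[of R "\<lambda>_ _. True" p1 "\<lambda>r b r'. r' \<in> R \<and> Lg r' = proj (set b) ` Lg r"] p1
    unfolding dec by blast
  obtain extend where 2: "computable {(r, b). r \<in> R \<and> True} extend"
    "\<forall>r\<in>R. \<forall>b. True \<longrightarrow> extend (r, b) \<in> R \<and> Lg (extend (r, b)) = upclose (set b) (Lg r)"
    using computable_choice[of R "\<lambda>_ _. True" p2 "\<lambda>r b r'. r' \<in> R \<and> Lg r' = upclose (set b) (Lg r)"] p2
    unfolding dec by blast
  obtain restrict where 3: "computable {(r, b). r \<in> R \<and> True} restrict"
    "\<forall>r\<in>R. \<forall>b. True \<longrightarrow> restrict (r, b) \<in> R \<and> Lg (restrict (r, b)) = Lg r \<inter> nfa_expr_lang b"
    using computable_choice[of R "\<lambda>_ _. True" p3 "\<lambda>r b r'. r' \<in> R \<and> Lg r' = Lg r \<inter> nfa_expr_lang b"] p3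
    unfolding nfa by blast
  show thesis
    using 1 2 3 by (intro that[of project extend restrict] trio.intro) (simp_all del: split_paired_All)
qed

context trio
begin

lemma computable_project:
  assumes "computable D f" "computable D g" "\<And>x. x \<in> D \<Longrightarrow> f x \<in> R"
  shows "computable D (\<lambda>x. project (f x, g x))"
  using assms(3) by (intro computable_comp[OF computable_Pair[OF assms(1,2)] computable_project']) simp

lemma computable_extend:
  assumes "computable D f" "computable D g" "\<And>x. x \<in> D \<Longrightarrow> f x \<in> R"
  shows "computable D (\<lambda>x. extend (f x, g x))"
  using assms(3) by (intro computable_comp[OF computable_Pair[OF assms(1,2)] computable_extend']) simp

lemma computable_restrict:
  assumes "computable D f" "computable D g" "\<And>x. x \<in> D \<Longrightarrow> f x \<in> R"
  shows "computable D (\<lambda>x. restrict (f x, g x))"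
  using assms(3) by (intro computable_comp[OF computable_Pair[OF assms(1,2)] computable_restrict']) simp

definition restricts :: "nat \<Rightarrow> nfa_expr list \<Rightarrow> nat" where
  "restricts r Ms = foldl (\<lambda>r M. restrict (r, M)) r Ms"

lemma restricts:
  "r \<in> R \<Longrightarrow> restricts r Ms \<in> R \<and> Lg (restricts r Ms) = {w \<in> Lg r. \<forall>M\<in>set Ms. w \<in> nfa_expr_lang M}"
  by (induction Ms arbitrary: r) (auto simp: restricts_def restrict)

lemma computable_restricts:
  assumes "computable D f" "computable D g" "\<And>x. x \<in> D \<Longrightarrow> f x \<in> R"
  shows "computable D (\<lambda>x. restricts (f x) (g x))"
proof -
  let ?h = "\<lambda>e :: nat \<times> nfa_expr \<times> 'a. restrict (fst e, fst (snd e))"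
  have "computable {e :: nat \<times> nfa_expr \<times> 'a. fst e \<in> R} ?h"
    by (intro computable_restrict computable_fst computable_snd computable_id) simp
  then have "computable D (\<lambda>x. foldl (\<lambda>acc y. ?h (acc, y, x)) (f x) (g x))"
    by (rule computable_foldl_invariant[OF assms(1,2), where Inv = "\<lambda>x r. r \<in> R"])
      (auto simp: assms(3) restrict)
  then show ?thesis by (simp add: restricts_def)
qed

text \<open>Projecting to the empty alphabet leaves \<open>\<epsilon>\<close> exactly when the language is nonempty.\<close>

lemma SUP_decidable_imp_empty:
  assumes "SUP_decidable R Lg" shows "decidable R (\<lambda>r. Lg r = {})"
proof -
  \<comment> \<open>Over the empty alphabet the counting condition is vacuous, so diagonality is
    just nonemptiness.\<close>
  let ?f = "\<lambda>r. (project (r, []), [] :: nat list)"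
  have "computable R ?f"
    by (intro computable_Pair computable_project computable_id computable_const)
  moreover have "?f r \<in> {(r, bs). r \<in> R \<and> distinct bs \<and> Lg r \<subseteq> bounded_lang bs}" if "r \<in> R" for r
    using project[OF that, of "[]"] by (auto simp: bounded_lang_blocks proj_def)
  ultimately have "decidable R (\<lambda>r. \<not> (case ?f r of (r, bs) \<Rightarrow> diagonal (set bs) (Lg r)))"
    by (intro decidable_Not decidable_comp[OF _ assms[unfolded SUP_decidable_iff]])
  then show ?thesis
    by (rule decidable_cong) (auto simp: diagonal_def project)
qed

lemma SUP_decidable_imp_ideal_test:
  assumes "SUP_decidable R Lg"
  shows "decidable {(r, as, J). r \<in> R \<and> Lg r \<subseteq> lists (set as)}
    (\<lambda>(r, as, J). ideal_lang J \<subseteq> downclose (Lg r))" (is "decidable ?D _")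
proof -
  \<comment> \<open>One more than the sum of all letters in sight exceeds each of them, so the
    markers from \<open>N\<close> upwards are fresh.\<close>
  define N where "N = (\<lambda>e :: nat \<times> nat list \<times> ideal_expr.
    Suc (sum_list (fst (snd e) @ ideal_letters (snd (snd e)))))"
  define Z where "Z = (\<lambda>e. markers (N e) (snd (snd e)))"
  define T where "T = (\<lambda>e. restrict (extend (fst e, Z e),
    upclose_nfa (fst (snd e)) (cycle_nfa (mark (N e) (snd (snd e))))))"
  have N: "computable D N" for D
    unfolding N_def by (intro computable_intros computable_ideal_letters)
  have Z: "computable D Z" for D
    unfolding Z_def by (intro computable_intros computable_markers N)
  have T: "computable ?D T"
    unfolding T_def
    by (intro computable_restrict computable_extend computable_upclose_nfa computable_cycle_nfa
        computable_mark N Z computable_fst computable_snd computable_id)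
      (auto simp: extend)
  have correct: "(project (T e, Z e), Z e) \<in> {(r, bs). r \<in> R \<and> distinct bs \<and> Lg r \<subseteq> bounded_lang bs}"
    "diagonal (set (Z e)) (Lg (project (T e, Z e))) \<longleftrightarrow> (case e of (r, as, J) \<Rightarrow> ideal_lang J \<subseteq> downclose (Lg r))"
    "T e \<in> R"
    if e: "e \<in> ?D" for e
  proof -
    obtain r as J where eq: "e = (r, as, J)" by (cases e)
    have r: "r \<in> R" "Lg r \<subseteq> lists (set as)" using e eq by auto
    have less: "x < N e" if "x \<in> set as \<or> x \<in> set (ideal_letters J)" for x
      using member_le_sum_list[of x "as @ ideal_letters J"] that by (auto simp: N_def eq)
    then have less': "\<forall>x\<in>set as. x < N e" "\<forall>x\<in>set (ideal_letters J). x < N e" by auto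
    have Te: "T e \<in> R" "Lg (T e) = upclose (set (Z e)) (Lg r) \<inter> upclose (set as) (cycle_lang (mark (N e) J))"
      using r by (auto simp: T_def eq extend restrict upclose_nfa_lang cycle_nfa_lang)
    have P: "project (T e, Z e) \<in> R" "Lg (project (T e, Z e)) = proj (set (markers (N e) J)) `
        (upclose (set (markers (N e) J)) (Lg r) \<inter> upclose (set as) (cycle_lang (mark (N e) J)))"
      using project[OF Te(1)] Te(2) by (auto simp: Z_def eq)
    show "T e \<in> R" by (rule Te(1))
    have "Lg (project (T e, Z e)) \<subseteq> bounded_lang (Z e)"
      unfolding P(2) marked_lang[OF r(2) less'] bounded_lang_blocks by (auto simp: Z_def eq)
    then show "(project (T e, Z e), Z e) \<in> {(r, bs). r \<in> R \<and> distinct bs \<and> Lg r \<subseteq> bounded_lang bs}"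
      using P(1) by (simp add: Z_def distinct_markers)
    show "diagonal (set (Z e)) (Lg (project (T e, Z e))) \<longleftrightarrow> (case e of (r, as, J) \<Rightarrow> ideal_lang J \<subseteq> downclose (Lg r))"
      unfolding P(2) using marked_lang_diagonal_iff[OF r(2) less'] by (simp add: Z_def eq)
  qed
  have "computable ?D (\<lambda>e. (project (T e, Z e), Z e))"
    by (intro computable_Pair computable_project T Z correct(3))
  then have "decidable ?D (\<lambda>e. case (project (T e, Z e), Z e) of (r, bs) \<Rightarrow> diagonal (set bs) (Lg r))"
    by (rule decidable_comp[OF _ assms[unfolded SUP_decidable_iff] correct(1)])
  then show ?thesis by (rule decidable_cong) (use correct(2) in auto)
qed

lemma SUP_decidable_imp_downclosure_computable:
  assumes "SUP_decidable R Lg" shows "downclosure_computable R Lg"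
proof -
  define D where "D = {(r, as). r \<in> R \<and> Lg r \<subseteq> lists (set as)}"
  \<comment> \<open>The first condition says that the ideals cover the language: no word survives
    intersection with all their complements. Since a union of ideals is downward closed, they then
    cover the downward closure as well, and the second condition makes this an equality.\<close>
  define cert where "cert = (\<lambda>(x :: nat \<times> nat list) Js.
    Lg (restricts (fst x) (map (\<lambda>J. coideal_nfa (snd x) J) Js)) = {} \<and>
    (\<forall>J\<in>set Js. ideal_lang J \<subseteq> downclose (Lg (fst x))))"
  have "decidable {e. fst e \<in> D} (\<lambda>e. cert (fst e) (snd e))"
    unfolding cert_def
  proof (intro decidable_conj decidable_ball_set computable_snd computable_id)
    have "computable {e. fst e \<in> D} (\<lambda>e. restricts (fst (fst e)) (map (\<lambda>J. coideal_nfa (snd (fst e)) J) (snd e)))"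
      by (intro computable_restricts computable_intros computable_coideal_nfa) (auto simp: D_def)
    then show "decidable {e. fst e \<in> D}
        (\<lambda>e. Lg (restricts (fst (fst e)) (map (\<lambda>J. coideal_nfa (snd (fst e)) J) (snd e))) = {})"
      by (rule decidable_comp[OF _ SUP_decidable_imp_empty[OF assms]]) (auto simp: D_def restricts)
    have "computable {e. snd e \<in> {e :: (nat \<times> nat list) \<times> ideal_expr list. fst e \<in> D}}
        (\<lambda>e. (fst (fst (snd e)), snd (fst (snd e)), fst e))"
      by (intro computable_intros)
    from decidable_comp[OF this SUP_decidable_imp_ideal_test[OF assms]]
    show "decidable {e. snd e \<in> {e :: (nat \<times> nat list) \<times> ideal_expr list. fst e \<in> D}}
        (\<lambda>e. ideal_lang (fst e) \<subseteq> downclose (Lg (fst (fst (snd e)))))"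
      by (auto simp: D_def)
  qed
  moreover have cert_iff: "cert x Js \<longleftrightarrow> downclose (Lg (fst x)) = (\<Union>J\<in>set Js. ideal_lang J)" if x: "x \<in> D" for x Js
  proof -
    have r: "fst x \<in> R" and sub: "Lg (fst x) \<subseteq> lists (set (snd x))" using x by (auto simp: D_def)
    have "Lg (restricts (fst x) (map (\<lambda>J. coideal_nfa (snd x) J) Js)) = {} \<longleftrightarrow>
        Lg (fst x) \<subseteq> (\<Union>J\<in>set Js. ideal_lang J)"
      using restricts[OF r] sub by (fastforce simp: coideal_nfa_lang)
    also have "\<dots> \<longleftrightarrow> downclose (Lg (fst x)) \<subseteq> (\<Union>J\<in>set Js. ideal_lang J)"
    proof
      assume "Lg (fst x) \<subseteq> (\<Union>J\<in>set Js. ideal_lang J)"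
      then show "downclose (Lg (fst x)) \<subseteq> (\<Union>J\<in>set Js. ideal_lang J)"
        unfolding downclose_def using downclosedD[OF downclosed_ideal_lang] by blast
    next
      assume "downclose (Lg (fst x)) \<subseteq> (\<Union>J\<in>set Js. ideal_lang J)"
      then show "Lg (fst x) \<subseteq> (\<Union>J\<in>set Js. ideal_lang J)" unfolding downclose_def by blast
    qed
    finally show ?thesis unfolding cert_def by blast
  qed
  moreover have sub: "downclose (Lg (fst x)) \<subseteq> lists (set (snd x))" if "x \<in> D" for x
  proof
    fix u assume "u \<in> downclose (Lg (fst x))"
    then obtain v where v: "v \<in> Lg (fst x)" "subseq u v" unfolding downclose_def by blast
    then have "v \<in> lists (set (snd x))" using that by (auto simp: D_def)
    then show "u \<in> lists (set (snd x))" using v(2) by (rule downclosedD[OF downclosed_lists])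
  qed
  moreover have "\<exists>Js. cert x Js" if "x \<in> D" for x
    using downclosed_ideal_union[OF _ downclosed_downclose sub[OF that]] cert_iff[OF that]
    unfolding ideal_union_def by blast
  ultimately obtain f where f: "computable D f" "\<forall>x\<in>D. cert x (f x)"
    using computable_search[of D cert] by blast
  have "computable D (\<lambda>x. enc (ideals_nfa (snd x) (f x)))"
    by (intro computable_enc computable_ideals_nfa computable_snd computable_id f(1))
  moreover have "nfa_lang (decode_nfa (enc (ideals_nfa (snd x) (f x)))) = downclose (Lg (fst x))" if "x \<in> D" for x
  proof -
    have "downclose (Lg (fst x)) = (\<Union>J\<in>set (f x). ideal_lang J)" using f(2) that cert_iff[OF that] by blast
    then show ?thesis using sub[OF that] by (simp add: decode_nfa_enc ideals_nfa_lang Int_absorb1)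
  qed
  ultimately show ?thesis
    unfolding downclosure_computable_iff D_def
    by (intro exI[of _ "\<lambda>x. enc (ideals_nfa (snd x) (f x))"]) auto
qed

lemma SUP_decidable_imp_PT_sep_decidable:
  assumes "SUP_decidable R Lg" shows "PT_sep_decidable R Lg"
proof -
  define D where "D = {(r, s, as). r \<in> R \<and> s \<in> R \<and> Lg r \<union> Lg s \<subseteq> lists (set as)}"
  \<comment> \<open>Pairs of words cannot be examined together, so indistinguishability is tested
    pattern by pattern: for every choice of memberships in the listed ideals, one of the two
    languages must have no word with that pattern.\<close>
  define sep where "sep = (\<lambda>(x :: nat \<times> nat \<times> nat list) Js. \<forall>c\<in>set (sign_patterns Js).
    Lg (restricts (fst x) (map (\<lambda>s. signed_nfa (snd (snd x)) s) c)) = {} \<or>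
    Lg (restricts (fst (snd x)) (map (\<lambda>s. signed_nfa (snd (snd x)) s) c)) = {})"
  define insep where "insep = (\<lambda>(x :: nat \<times> nat \<times> nat list) J.
    ideal_lang J \<subseteq> downclose (Lg (restrict (fst x, ideals_nfa (snd (snd x)) [J]))) \<and>
    ideal_lang J \<subseteq> downclose (Lg (restrict (fst (snd x), ideals_nfa (snd (snd x)) [J]))))"
  have dec_sep: "decidable {e. fst e \<in> D} (\<lambda>e. sep (fst e) (snd e))"
    unfolding sep_def
  proof (intro decidable_ball_set decidable_disj computable_sign_patterns computable_snd computable_id)
    let ?E = "{e. snd e \<in> {e :: (nat \<times> nat \<times> nat list) \<times> ideal_expr list. fst e \<in> D}}"
    have "computable ?E (\<lambda>e. restricts (fst (fst (snd e))) (map (\<lambda>s. signed_nfa (snd (snd (fst (snd e)))) s) (fst e)))"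
      by (intro computable_restricts computable_intros computable_signed_nfa) (auto simp: D_def)
    then show "decidable ?E (\<lambda>e. Lg (restricts (fst (fst (snd e))) (map (\<lambda>s. signed_nfa (snd (snd (fst (snd e)))) s) (fst e))) = {})"
      by (rule decidable_comp[OF _ SUP_decidable_imp_empty[OF assms]]) (auto simp: D_def restricts)
    have "computable ?E (\<lambda>e. restricts (fst (snd (fst (snd e)))) (map (\<lambda>s. signed_nfa (snd (snd (fst (snd e)))) s) (fst e)))"
      by (intro computable_restricts computable_intros computable_signed_nfa) (auto simp: D_def)
    then show "decidable ?E (\<lambda>e. Lg (restricts (fst (snd (fst (snd e)))) (map (\<lambda>s. signed_nfa (snd (snd (fst (snd e)))) s) (fst e))) = {})"
      by (rule decidable_comp[OF _ SUP_decidable_imp_empty[OF assms]]) (auto simp: D_def restricts)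
  qed
  have dec_insep: "decidable {e. fst e \<in> D} (\<lambda>e. insep (fst e) (snd e))"
    unfolding insep_def
  proof (intro decidable_conj)
    let ?E = "{e :: (nat \<times> nat \<times> nat list) \<times> ideal_expr. fst e \<in> D}"
    have "computable ?E (\<lambda>e. (restrict (fst (fst e), ideals_nfa (snd (snd (fst e))) [snd e]), snd (snd (fst e)), snd e))"
      by (intro computable_Pair computable_restrict computable_intros computable_ideals_nfa) (auto simp: D_def)
    from decidable_comp[OF this SUP_decidable_imp_ideal_test[OF assms]]
    show "decidable ?E (\<lambda>e. ideal_lang (snd e) \<subseteq> downclose (Lg (restrict (fst (fst e), ideals_nfa (snd (snd (fst e))) [snd e]))))"
      by (simp add: D_def restrict le_infI1 case_prod_beta)
    have "computable ?E (\<lambda>e. (restrict (fst (snd (fst e)), ideals_nfa (snd (snd (fst e))) [snd e]), snd (snd (fst e)), snd e))"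
      by (intro computable_Pair computable_restrict computable_intros computable_ideals_nfa) (auto simp: D_def)
    from decidable_comp[OF this SUP_decidable_imp_ideal_test[OF assms]]
    show "decidable ?E (\<lambda>e. ideal_lang (snd e) \<subseteq> downclose (Lg (restrict (fst (snd (fst e)), ideals_nfa (snd (snd (fst e))) [snd e]))))"
      by (simp add: D_def restrict le_infI1 case_prod_beta)
  qed
  have sep_iff: "sep x Js \<longleftrightarrow> (\<forall>u\<in>Lg (fst x). \<forall>v\<in>Lg (fst (snd x)). \<not> ideal_indist (set Js) u v)"
    if "x \<in> D" for x Js
  proof -
    obtain r s as where x: "x = (r, s, as)" by (cases x)
    have rs: "r \<in> R" "s \<in> R" "Lg r \<subseteq> lists (set as)" "Lg s \<subseteq> lists (set as)"
      using \<open>x \<in> D\<close> by (auto simp: D_def x)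
    have lang: "Lg (restricts t (map (\<lambda>s. signed_nfa as s) c)) = {w \<in> Lg t. \<forall>s\<in>set c. w \<in> ideal_lang (fst s) \<longleftrightarrow> snd s = 0}"
      if "t \<in> R" "Lg t \<subseteq> lists (set as)" for t c
      using restricts[OF that(1)] that(2) by (auto simp: signed_nfa_lang)
    have sep: "sep x Js \<longleftrightarrow> (\<forall>c\<in>set (sign_patterns Js). \<forall>u\<in>Lg r. \<forall>v\<in>Lg s.
        \<not> (\<forall>t\<in>set c. (u \<in> ideal_lang (fst t) \<longleftrightarrow> snd t = 0) \<and> (v \<in> ideal_lang (fst t) \<longleftrightarrow> snd t = 0)))"
      unfolding sep_def x fst_conv snd_conv lang[OF rs(1,3)] lang[OF rs(2,4)] by blast
    show ?thesis
    proof
      assume s: "sep x Js"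
      show "\<forall>u\<in>Lg (fst x). \<forall>v\<in>Lg (fst (snd x)). \<not> ideal_indist (set Js) u v"
      proof (intro ballI notI)
        fix u v assume uv: "u \<in> Lg (fst x)" "v \<in> Lg (fst (snd x))" "ideal_indist (set Js) u v"
        let ?c = "map (\<lambda>J. (J, if u \<in> ideal_lang J then 0 else 1 :: nat)) Js"
        have "\<forall>t\<in>set ?c. (u \<in> ideal_lang (fst t) \<longleftrightarrow> snd t = 0) \<and> (v \<in> ideal_lang (fst t) \<longleftrightarrow> snd t = 0)"
          using uv(3) by (auto simp: ideal_indist_def)
        moreover have "?c \<in> set (sign_patterns Js)" by (rule sign_pattern_of_word)
        moreover have "u \<in> Lg r" "v \<in> Lg s" using uv(1,2) by (simp_all add: x)
        ultimately show False using s[unfolded sep] by blast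
      qed
    next
      assume *: "\<forall>u\<in>Lg (fst x). \<forall>v\<in>Lg (fst (snd x)). \<not> ideal_indist (set Js) u v"
      show "sep x Js" unfolding sep
      proof (intro ballI notI)
        fix c u v assume c: "c \<in> set (sign_patterns Js)" and uv: "u \<in> Lg r" "v \<in> Lg s"
          and t: "\<forall>t\<in>set c. (u \<in> ideal_lang (fst t) \<longleftrightarrow> snd t = 0) \<and> (v \<in> ideal_lang (fst t) \<longleftrightarrow> snd t = 0)"
        have "set Js = fst ` set c" using map_fst_sign_patterns[OF c] by (metis set_map)
        then have "ideal_indist (set Js) u v" using t by (auto simp: ideal_indist_def)
        then show False using * uv by (simp add: x)
      qed
    qed
  qed
  have sep_correct: "PT_separable (set (snd (snd x))) (Lg (fst x)) (Lg (fst (snd x))) \<longleftrightarrow> (\<exists>Js. sep x Js)"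
    if "x \<in> D" for x
    unfolding sep_iff[OF that] using that by (intro PT_separable_iff) (auto simp: D_def)
  have ex_insep: "\<exists>J. insep x J" if x: "x \<in> D" "\<not> PT_separable (set (snd (snd x))) (Lg (fst x)) (Lg (fst (snd x)))" for x
  proof -
    have sub: "Lg (fst x) \<subseteq> lists (set (snd (snd x)))" "Lg (fst (snd x)) \<subseteq> lists (set (snd (snd x)))"
      "fst x \<in> R" "fst (snd x) \<in> R"
      using x(1) by (auto simp: D_def)
    have lang: "Lg (restrict (r, ideals_nfa (snd (snd x)) [J])) = Lg r \<inter> ideal_lang J"
      if "r \<in> R" "Lg r \<subseteq> lists (set (snd (snd x)))" for r J
      using restrict[OF that(1)] that(2) by (auto simp: ideals_nfa_lang)
    show ?thesis
      unfolding insep_def lang[OF sub(3,1)] lang[OF sub(4,2)]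
      by (rule not_PT_separable_common_ideal[OF _ sub(1,2) x(2)]) simp
  qed
  have insep_sound: "\<not> PT_separable (set (snd (snd x))) (Lg (fst x)) (Lg (fst (snd x)))" if x: "x \<in> D" "insep x J" for x J
  proof -
    have sub: "Lg (fst x) \<subseteq> lists (set (snd (snd x)))" "Lg (fst (snd x)) \<subseteq> lists (set (snd (snd x)))"
      "fst x \<in> R" "fst (snd x) \<in> R"
      using x(1) by (auto simp: D_def)
    have lang: "Lg (restrict (r, ideals_nfa (snd (snd x)) [J])) = Lg r \<inter> ideal_lang J"
      if "r \<in> R" "Lg r \<subseteq> lists (set (snd (snd x)))" for r
      using restrict[OF that(1)] that(2) by (auto simp: ideals_nfa_lang)
    show ?thesis
      using x(2) unfolding insep_def lang[OF sub(3,1)] lang[OF sub(4,2)]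
      by (intro common_ideal_not_PT_separable[OF _ sub(1,2)]) auto
  qed
  have dec: "decidable {e. fst e \<in> D} (\<lambda>e. sep (fst e) (fst (snd e)) \<or> insep (fst e) (snd (snd e)))"
  proof (intro decidable_disj)
    have "computable {e. fst e \<in> D} (\<lambda>e :: (nat \<times> nat \<times> nat list) \<times> ideal_expr list \<times> ideal_expr. (fst e, fst (snd e)))"
      by (intro computable_intros)
    from decidable_comp[OF this dec_sep]
    show "decidable {e. fst e \<in> D} (\<lambda>e :: (nat \<times> nat \<times> nat list) \<times> ideal_expr list \<times> ideal_expr. sep (fst e) (fst (snd e)))"
      by simp
    have "computable {e. fst e \<in> D} (\<lambda>e :: (nat \<times> nat \<times> nat list) \<times> ideal_expr list \<times> ideal_expr. (fst e, snd (snd e)))"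
      by (intro computable_intros)
    from decidable_comp[OF this dec_insep]
    show "decidable {e. fst e \<in> D} (\<lambda>e :: (nat \<times> nat \<times> nat list) \<times> ideal_expr list \<times> ideal_expr. insep (fst e) (snd (snd e)))"
      by simp
  qed
  \<comment> \<open>A candidate has two components, and success of either one suffices; so the
    search ends whether or not a separator exists.\<close>
  have ex: "\<exists>c. sep x (fst c) \<or> insep x (snd c)" if "x \<in> D" for x
    using ex_insep[OF that] sep_correct[OF that] by (metis fst_conv snd_conv)
  obtain f where f: "computable D f" "\<forall>x\<in>D. sep x (fst (f x)) \<or> insep x (snd (f x))"
    using computable_search[OF dec ex] by blast
  have "computable D (\<lambda>x. (x, fst (f x)))" by (intro computable_intros f(1))
  from decidable_comp[OF this dec_sep] have "decidable D (\<lambda>x. sep x (fst (f x)))" by simp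
  \<comment> \<open>If the list component fails its test, the ideal component was the successful one
    and refutes separability. Hence retesting the list decides the question.\<close>
  moreover have "sep x (fst (f x)) \<longleftrightarrow> PT_separable (set (snd (snd x))) (Lg (fst x)) (Lg (fst (snd x)))"
    if "x \<in> D" for x
    using f(2) that sep_correct[OF that] insep_sound[OF that] by blast
  ultimately have "decidable D (\<lambda>x. PT_separable (set (snd (snd x))) (Lg (fst x)) (Lg (fst (snd x))))"
    by (rule decidable_cong)
  then show ?thesis unfolding PT_sep_decidable_iff D_def by (rule decidable_cong) auto
qed

lemma downclosure_computable_imp_diagonal_decidable:
  assumes "downclosure_computable R Lg" shows "diagonal_decidable R Lg"
proof -
  obtain f where f: "computable {(r, as). r \<in> R \<and> Lg r \<subseteq> lists (set as)} f"
    "\<forall>r\<in>R. \<forall>as. Lg r \<subseteq> lists (set as) \<longrightarrow> nfa_lang (decode_nfa (f (r, as))) = downclose (Lg r)"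
    using assms unfolding downclosure_computable_iff by blast
  \<comment> \<open>Emptiness has to be extracted from downward closures alone: after projection to
    the empty alphabet, the language is nonempty iff the computed automaton accepts the empty word,
    that is, iff some initial state is final.\<close>
  define g where "g = (\<lambda>r. dec (f (project (r, []), [])) :: nfa_expr)"
  have pr: "(project (r, []), []) \<in> {(r, as). r \<in> R \<and> Lg r \<subseteq> lists (set as)}" if "r \<in> R" for r
    using project[OF that, of "[]"] by (auto simp: proj_def)
  have "computable R (\<lambda>r. f (project (r, []), []))"
    by (rule computable_comp[OF _ f(1) pr])
      (intro computable_Pair computable_project computable_id computable_const)
  then have g: "computable R g" unfolding g_def computable_def by simp
  have empty: "decidable R (\<lambda>r. Lg r = {})"
  proof -
    have "decidable R (\<lambda>r. \<not> (\<exists>p\<in>set (fst (g r)). p \<in> set (snd (snd (g r)))))"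
      by (intro decidable_Not decidable_bex_set decidable_in_set computable_fst computable_snd computable_id
          g computable_comp[OF _ g]) auto
    moreover have "(\<exists>p\<in>set (fst (g r)). p \<in> set (snd (snd (g r)))) \<longleftrightarrow> Lg r \<noteq> {}" if r: "r \<in> R" for r
    proof -
      have "nfa_expr_lang (g r) = downclose (proj {} ` Lg r)"
        using f(2) pr[OF r] project[OF r, of "[]"] decode_nfa_enc[of "g r"] by (auto simp: g_def)
      moreover have "[] \<in> nfa_expr_lang (g r) \<longleftrightarrow> (\<exists>p\<in>set (fst (g r)). p \<in> set (snd (snd (g r))))"
        by (auto simp: nfa_expr_lang_def nfa_lang_def)
      moreover have "[] \<in> downclose (proj {} ` Lg r) \<longleftrightarrow> Lg r \<noteq> {}"
        by (auto simp: downclose_def)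
      ultimately show ?thesis by simp
    qed
    ultimately show ?thesis by (elim decidable_cong) auto
  qed
  define D where "D = {(r, as). r \<in> R \<and> Lg r \<subseteq> lists (set as)}"
  \<comment> \<open>The code \<open>f x\<close> of the automaton for the downward closure is itself
    the pumping bound, so the required numbers of occurrences can be imposed by regular
    restrictions.\<close>
  define h where "h = (\<lambda>x. restricts (fst x) (map (\<lambda>a.
    upclose_nfa (snd x) (cycle_nfa (replicate (f x + 2) ([], a, a)))) (snd x)))"
  have "computable {e. snd e \<in> D} (\<lambda>e :: nat \<times> nat \<times> nat list. f (snd e))"
    by (rule computable_comp[OF _ f(1)]) (auto simp: D_def intro!: computable_snd computable_id)
  then have "computable D h" unfolding h_def
    by (intro computable_restricts computable_intros computable_upclose_nfa computable_cycle_nfa)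
      (auto simp: D_def)
  then have "decidable D (\<lambda>x. Lg (h x) \<noteq> {})"
    by (intro decidable_Not decidable_comp[OF _ empty]) (auto simp: h_def D_def restricts)
  moreover have "Lg (h x) \<noteq> {} \<longleftrightarrow> diagonal (set (snd x)) (Lg (fst x))" if x: "x \<in> D" for x
  proof -
    have r: "fst x \<in> R" "Lg (fst x) \<subseteq> lists (set (snd x))" using x by (auto simp: D_def)
    have "nfa_lang (decode_nfa (f x)) = downclose (Lg (fst x))" using f(2) r by (cases x) auto
    note diag = diagonal_iff_bounded[OF this, of "set (snd x)"]
    have "Lg (h x) = {w \<in> Lg (fst x). \<forall>a\<in>set (snd x). f x + 2 \<le> count_list w a}"
      unfolding h_def using restricts[OF r(1)] r(2) count_ge_iff
      by (auto simp: upclose_nfa_lang cycle_nfa_lang subset_iff simp del: replicate_Suc in_lists_conv_set)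
    then show ?thesis using diag by auto
  qed
  ultimately have "decidable D (\<lambda>x. diagonal (set (snd x)) (Lg (fst x)))" by (rule decidable_cong)
  then show ?thesis unfolding diagonal_decidable_iff D_def by (rule decidable_cong) auto
qed

lemma diagonal_decidable_imp_SUP_decidable:
  assumes "diagonal_decidable R Lg" shows "SUP_decidable R Lg"
  using assms unfolding diagonal_decidable_iff SUP_decidable_iff decidable_def
  by (rule computable_subset) (use bounded_lang_subset_lists in blast)

lemma PT_sep_decidable_imp_SUP_decidable:
  assumes "PT_sep_decidable R Lg" shows "SUP_decidable R Lg"
proof -
  define D where "D = {(r, bs). r \<in> R \<and> distinct bs \<and> Lg r \<subseteq> bounded_lang bs}"
  \<comment> \<open>Exceeds every letter of the enumeration, so the shifted copies
    \<open>b + N\<close> are new letters.\<close>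
  define N where "N = (\<lambda>x :: nat \<times> nat list. Suc (sum_list (snd x)))"
  define C where "C = (\<lambda>x. map (\<lambda>b. b + N x) (snd x))"
  define I where "I = (\<lambda>x. restrict (extend (fst x, C x),
    cycle_nfa (alternation (\<lambda>b. b) (\<lambda>b. b + N x) (snd x))))"
  \<comment> \<open>Projecting everything away and then inserting letters yields all words over the
    doubled alphabet, provided the given language is nonempty; the automaton cuts this down to the
    alternations that start with the shifted letter.\<close>
  define E where "E = (\<lambda>x. restrict (extend (project (fst x, []), snd x @ C x),
    cycle_nfa (alternation (\<lambda>b. b + N x) (\<lambda>b. b) (snd x))))"
  have N: "computable F (\<lambda>e. N (k e))" if "computable F k" for F and k :: "'c::codable \<Rightarrow> nat \<times> nat list"
    unfolding N_def by (intro computable_intros that)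
  have C: "computable D C" unfolding C_def by (intro computable_intros N)
  have I: "computable D I" unfolding I_def alternation_def
    by (intro computable_restrict computable_extend computable_cycle_nfa computable_intros C N)
      (auto simp: D_def extend)
  have E: "computable D E" unfolding E_def alternation_def
    by (intro computable_restrict computable_extend computable_project computable_cycle_nfa computable_intros C N)
      (auto simp: D_def extend project)
  have correct: "(I x, E x, snd x @ C x) \<in> {(r, s, as). r \<in> R \<and> s \<in> R \<and> Lg r \<union> Lg s \<subseteq> lists (set as)}"
    "PT_separable (set (snd x @ C x)) (Lg (I x)) (Lg (E x)) \<longleftrightarrow> \<not> diagonal (set (snd x)) (Lg (fst x))"
    if x: "x \<in> D" for x
  proof -
    have r: "fst x \<in> R" "distinct (snd x)" "Lg (fst x) \<subseteq> bounded_lang (snd x)" using x by (auto simp: D_def)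
    have less: "\<forall>b\<in>set (snd x). b < N x" unfolding N_def by (auto simp: less_Suc_eq_le member_le_sum_list)
    have set_C: "set (C x) = (\<lambda>b. b + N x) ` set (snd x)" by (simp add: C_def)
    have IR: "I x \<in> R" and ER: "E x \<in> R" using r(1) by (auto simp: I_def E_def restrict extend project)
    have LI: "Lg (I x) = upclose ((\<lambda>b. b + N x) ` set (snd x)) (Lg (fst x)) \<inter>
        cycle_lang (alternation (\<lambda>b. b) (\<lambda>b. b + N x) (snd x))"
      using r(1) by (simp add: I_def restrict extend cycle_nfa_lang set_C)
    have LE: "Lg (E x) = upclose (set (snd x) \<union> (\<lambda>b. b + N x) ` set (snd x)) (proj {} ` Lg (fst x)) \<inter>
        cycle_lang (alternation (\<lambda>b. b + N x) (\<lambda>b. b) (snd x))"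
      using r(1) by (simp add: E_def restrict extend project cycle_nfa_lang set_C)
    note alt = alternation_separable_iff[OF r(2) less r(3), folded LI LE]
    show "(I x, E x, snd x @ C x) \<in> {(r, s, as). r \<in> R \<and> s \<in> R \<and> Lg r \<union> Lg s \<subseteq> lists (set as)}"
      using IR ER alt(1) by (simp only: mem_Collect_eq prod.case set_append set_C)
    show "PT_separable (set (snd x @ C x)) (Lg (I x)) (Lg (E x)) \<longleftrightarrow> \<not> diagonal (set (snd x)) (Lg (fst x))"
      using alt(2) by (simp add: set_C)
  qed
  have "computable D (\<lambda>x. (I x, E x, snd x @ C x))" by (intro computable_intros I E C)
  from decidable_Not[OF decidable_comp[OF this assms[unfolded PT_sep_decidable_iff] correct(1)]]
  have "decidable D (\<lambda>x. \<not> PT_separable (set (snd x @ C x)) (Lg (I x)) (Lg (E x)))" by simp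
  then have "decidable D (\<lambda>x. diagonal (set (snd x)) (Lg (fst x)))"
    by (rule decidable_cong) (simp add: correct(2) del: set_append)
  then show ?thesis unfolding SUP_decidable_iff D_def by (rule decidable_cong) auto
qed

end

theorem theorem2p3:
  fixes R :: "nat set" and Lg :: "nat \<Rightarrow> lang"
  assumes "full_trio R Lg"
  shows "(PT_sep_decidable R Lg \<longleftrightarrow> diagonal_decidable R Lg)
       \<and> (diagonal_decidable R Lg \<longleftrightarrow> SUP_decidable R Lg)
       \<and> (SUP_decidable R Lg \<longleftrightarrow> downclosure_computable R Lg)"
proof -
  obtain project extend restrict where "trio R Lg project extend restrict"
    using assms by (rule full_trio_trio)
  then interpret trio R Lg project extend restrict .
  show ?thesis
    using SUP_decidable_imp_PT_sep_decidable PT_sep_decidable_imp_SUP_decidable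
      SUP_decidable_imp_downclosure_computable downclosure_computable_imp_diagonal_decidable
      diagonal_decidable_imp_SUP_decidable by blast
qed

end
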